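(* Let $0<s<1$, $a=1-2s$ and $u\in\mathscr S(\mathbb R^n)$. The function $$U(x,z)=\int_{\mathbb R^n}K^{(a)}_z(x,y)\,u(y)\,dy,\qquad x\in\mathbb R^n,\ z>0,$$ solves the extension problem $\mathscr L_aU=0$, $U(x,0)=u(x)$, in the sense that for every $x_0\in\mathbb R^n$ one has $$\lim_{(x,z)\to(x_0,0)}U(x,z)=u(x_0),$$ the limit being taken with $z>0$.
   Context: Let $n\ge3$ and let $\mathscr X=\{X_1,\dots,X_m\}$ be $C^\infty$ vector fields on $\mathbb R^n$ satisfying Hörmander's finite rank condition $\operatorname{rank}\operatorname{Lie}[X_1,\dots,X_m](x)=n$ at every $x\in\mathbb R^n$, with sub-Laplacean $\mathscr L=-\sum_{i=1}^mX_i^\star X_i$ ($X_i^\star$ the formal adjoint). It is assumed that outside a large compact set $\mathscr L$ coincides with the standard Laplacian. Let $d$ be the Carnot-Carathéodory distance of $\mathscr X$: $d(x,y)=\inf T$ over piecewise $C^1$ curves $\gamma:[0,T]\to\mathbb R^n$ with $\gamma(0)=x,\gamma(T)=y$ and $\gamma'=\sum_ia_i(t)X_i(\gamma)$ with $a_i$ piecewise continuous, $\sum_i|a_i|\le1$; $B(x,r)$ are its balls and $|B(x,r)|$ their Lebesgue measure. The heat operator $\mathscr H=\partial_t-\mathscr L$ admits a positive fundamental solution $p(x,t;\xi,\tau)=p(x,\xi;t-\tau)$, smooth in $\mathbb R^{n+1}\setminus\{(\xi,\tau)\}$; $p(x,y,t)$ denotes it with $\tau=0$. Recalled facts: there is $M>0$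 such that for all $k,j\ge 0$ one has $|\partial_t^kX_{j_1}\cdots X_{j_j}p(x,y,t)|\le\frac{C}{t^{k+j/2}|B(x,\sqrt t)|}e^{-Md(x,y)^2/t}$ with $C=C(\mathscr X,k,j)$, and $p(x,y,t)\ge\frac{C^{-1}}{|B(x,\sqrt t)|}e^{-M^{-1}d(x,y)^2/t}$; moreover $\int_{\mathbb R^n}p(x,y,t)\,dy=1$, and the doubling condition $|B(x,2r)|\le C_d|B(x,r)|$ holds for all $x\in\mathbb R^n$, $r>0$. $\mathscr S(\mathbb R^n)$ is the Schwartz class; $\mathscr B_a=\frac{\partial^2}{\partial z^2}+\frac az\frac{\partial}{\partial z}$; the extension operator is $\mathscr L_a=z^a(\mathscr L+\mathscr B_a)$ on $\mathbb R^{n+1}_+=\{(x,z):x\in\mathbb R^n,\ z>0\}$, with $\mathscr L$ acting in $x$. Its Poisson kernel is $$K^{(a)}_z(x,y)=\frac{1}{2^{1-a}\Gamma(\frac{1-a}2)}\,z^{1-a}\int_0^\infty\frac{e^{-\frac{z^2}{4t}}}{t^{\frac{3-a}2}}\,p(x,y,t)\,dt,$$ where $\Gamma(\cdot)$ is Euler's gamma function. *)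

theory Defs
  imports "HOL-Analysis.Analysis"
begin

section \<open>Smooth functions and the Schwartz class\<close>

text \<open>Intended for open \<open>S\<close> in a finite-dimensional space, where this is the class \<open>C^k\<close>.\<close>

primrec Ck_on :: "nat \<Rightarrow> 'a::real_normed_vector set \<Rightarrow> ('a \<Rightarrow> 'b::real_normed_vector) \<Rightarrow> bool" where
  "Ck_on 0 S f \<longleftrightarrow> continuous_on S f"
| "Ck_on (Suc k) S f \<longleftrightarrow>
     (\<forall>x\<in>S. f differentiable (at x)) \<and> (\<forall>v. Ck_on k S (\<lambda>x. frechet_derivative f (at x) v))"

definition smooth_on :: "'a::real_normed_vector set \<Rightarrow> ('a \<Rightarrow> 'b::real_normed_vector) \<Rightarrow> bool" where
  "smooth_on S f \<longleftrightarrow> (\<forall>k. Ck_on k S f)"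

definition test_function :: "('a::real_normed_vector \<Rightarrow> real) \<Rightarrow> bool" where
  "test_function f \<longleftrightarrow> smooth_on UNIV f \<and> compact (closure {x. f x \<noteq> 0})"

text \<open>A vector field \<open>V\<close> acting on functions: \<open>(V f)(x)\<close> is the derivative of \<open>f\<close> at \<open>x\<close> along \<open>V(x)\<close>.\<close>

definition vf_apply :: "('a::real_normed_vector \<Rightarrow> 'a) \<Rightarrow> ('a \<Rightarrow> real) \<Rightarrow> 'a \<Rightarrow> real" where
  "vf_apply V f x = frechet_derivative f (at x) (V x)"

definition partial :: "'a::real_normed_vector \<Rightarrow> ('a \<Rightarrow> real) \<Rightarrow> 'a \<Rightarrow> real" where
  "partial b = vf_apply (\<lambda>_. b)"

definition schwartz :: "('a::euclidean_space \<Rightarrow> real) \<Rightarrow> bool" where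
  "schwartz u \<longleftrightarrow> smooth_on UNIV u \<and>
     (\<forall>k bs. set bs \<subseteq> Basis \<longrightarrow> (\<exists>C. \<forall>x. (1 + norm x) ^ k * \<bar>foldr partial bs u x\<bar> \<le> C))"

section \<open>Vector fields and the sub-Laplacian\<close>

text \<open>The formal adjoint of \<open>V = \<Sum>\<^sub>b V\<^sub>b \<partial>\<^sub>b\<close> is \<open>V\<^sup>* f = - \<Sum>\<^sub>b \<partial>\<^sub>b (V\<^sub>b f)\<close>.\<close>

definition formal_adjoint :: "('a::euclidean_space \<Rightarrow> 'a) \<Rightarrow> ('a \<Rightarrow> real) \<Rightarrow> 'a \<Rightarrow> real" where
  "formal_adjoint V f x = - (\<Sum>b\<in>Basis. partial b (\<lambda>y. (V y \<bullet> b) * f y) x)"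

definition sub_laplacian ::
  "nat \<Rightarrow> (nat \<Rightarrow> 'a::euclidean_space \<Rightarrow> 'a) \<Rightarrow> ('a \<Rightarrow> real) \<Rightarrow> 'a \<Rightarrow> real" where
  "sub_laplacian m X f x = - (\<Sum>i=1..m. formal_adjoint (X i) (vf_apply (X i) f) x)"

definition laplacian :: "('a::euclidean_space \<Rightarrow> real) \<Rightarrow> 'a \<Rightarrow> real" where
  "laplacian f x = (\<Sum>b\<in>Basis. partial b (partial b f) x)"

definition lie_bracket ::
  "('a::real_normed_vector \<Rightarrow> 'a) \<Rightarrow> ('a \<Rightarrow> 'a) \<Rightarrow> 'a \<Rightarrow> 'a" where
  "lie_bracket V W x = frechet_derivative W (at x) (V x) - frechet_derivative V (at x) (W x)"

inductive_set lie_algebra ::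
  "nat \<Rightarrow> (nat \<Rightarrow> 'a::real_normed_vector \<Rightarrow> 'a) \<Rightarrow> ('a \<Rightarrow> 'a) set"
  for m :: nat and X :: "nat \<Rightarrow> 'a \<Rightarrow> 'a" where
  gen: "i \<in> {1..m} \<Longrightarrow> X i \<in> lie_algebra m X"
| zero: "(\<lambda>_. 0) \<in> lie_algebra m X"
| add: "V \<in> lie_algebra m X \<Longrightarrow> W \<in> lie_algebra m X \<Longrightarrow> (\<lambda>x. V x + W x) \<in> lie_algebra m X"
| scale: "V \<in> lie_algebra m X \<Longrightarrow> (\<lambda>x. c *\<^sub>R V x) \<in> lie_algebra m X"
| bracket: "V \<in> lie_algebra m X \<Longrightarrow> W \<in> lie_algebra m X \<Longrightarrow> lie_bracket V W \<in> lie_algebra m X"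

definition hormander :: "nat \<Rightarrow> (nat \<Rightarrow> 'a::euclidean_space \<Rightarrow> 'a) \<Rightarrow> bool" where
  "hormander m X \<longleftrightarrow> (\<forall>x. dim ((\<lambda>V. V x) ` lie_algebra m X) = DIM('a))"

definition laplacian_outside_compact ::
  "nat \<Rightarrow> (nat \<Rightarrow> 'a::euclidean_space \<Rightarrow> 'a) \<Rightarrow> bool" where
  "laplacian_outside_compact m X \<longleftrightarrow>
     (\<exists>K. compact K \<and>
        (\<forall>f x. smooth_on UNIV f \<longrightarrow> x \<notin> K \<longrightarrow> sub_laplacian m X f x = laplacian f x))"

section \<open>Carnot-Caratheodory distance\<close>

definition piecewise_continuous :: "real \<Rightarrow> (real \<Rightarrow> real) \<Rightarrow> bool" where
  "piecewise_continuous T a \<longleftrightarrow>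
     (\<exists>F. finite F \<and> continuous_on ({0..T} - F) a) \<and>
     (\<forall>t\<in>{0..<T}. \<exists>l. (a \<longlongrightarrow> l) (at_right t)) \<and>
     (\<forall>t\<in>{0<..T}. \<exists>l. (a \<longlongrightarrow> l) (at_left t))"

definition admissible_curve ::
  "nat \<Rightarrow> (nat \<Rightarrow> 'a::euclidean_space \<Rightarrow> 'a) \<Rightarrow> real \<Rightarrow> (real \<Rightarrow> 'a) \<Rightarrow> bool" where
  "admissible_curve m X T \<gamma> \<longleftrightarrow>
     0 \<le> T \<and> \<gamma> piecewise_C1_differentiable_on {0..T} \<and>
     (\<exists>a. (\<forall>i\<in>{1..m}. piecewise_continuous T (a i)) \<and>
          (\<forall>t\<in>{0..T}. (\<Sum>i=1..m. \<bar>a i t\<bar>) \<le> 1) \<and>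
          (\<exists>F. finite F \<and> (\<forall>t\<in>{0..T} - F.
             (\<gamma> has_vector_derivative (\<Sum>i=1..m. a i t *\<^sub>R X i (\<gamma> t))) (at t))))"

text \<open>Extended-real valued, so that the infimum over an empty set of curves is \<open>\<infinity>\<close> instead of an
  unspecified real number. (By the Chow-Rashevskii theorem this never happens for Hormander fields.)\<close>

definition cc_dist ::
  "nat \<Rightarrow> (nat \<Rightarrow> 'a::euclidean_space \<Rightarrow> 'a) \<Rightarrow> 'a \<Rightarrow> 'a \<Rightarrow> ereal" where
  "cc_dist m X x y =
     Inf {ereal T | T. \<exists>\<gamma>. admissible_curve m X T \<gamma> \<and> \<gamma> 0 = x \<and> \<gamma> T = y}"

definition cc_vol ::
  "nat \<Rightarrow> (nat \<Rightarrow> 'a::euclidean_space \<Rightarrow> 'a) \<Rightarrow> 'a \<Rightarrow> real \<Rightarrow> real" where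
  "cc_vol m X x r = measure lebesgue {y. cc_dist m X x y < ereal r}"

definition doubling :: "nat \<Rightarrow> (nat \<Rightarrow> 'a::euclidean_space \<Rightarrow> 'a) \<Rightarrow> bool" where
  "doubling m X \<longleftrightarrow> (\<exists>C. \<forall>x. \<forall>r>0. cc_vol m X x (2 * r) \<le> C * cc_vol m X x r)"

section \<open>Heat kernel\<close>

text \<open>The formal adjoint of \<open>\<partial>\<^sub>t - L\<close>; note that \<open>L = - \<Sum>\<^sub>i X\<^sub>i\<^sup>* X\<^sub>i\<close> is formally self-adjoint.\<close>

definition heat_adjoint ::
  "nat \<Rightarrow> (nat \<Rightarrow> 'a::euclidean_space \<Rightarrow> 'a) \<Rightarrow> ('a \<times> real \<Rightarrow> real) \<Rightarrow> 'a \<times> real \<Rightarrow> real" where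
  "heat_adjoint m X \<phi> = (\<lambda>(x, t).
     - deriv (\<lambda>s. \<phi> (x, s)) t - sub_laplacian m X (\<lambda>y. \<phi> (y, t)) x)"

text \<open>\<open>p x \<xi> t\<close> generates the fundamental solution \<open>(x, t) \<mapsto> p x \<xi> (t - \<tau>)\<close> with pole \<open>(\<xi>, \<tau>)\<close>,
  which is positive for \<open>t > \<tau>\<close> and vanishes for \<open>t < \<tau>\<close>. The last clause states that
  applying \<open>\<partial>\<^sub>t - L\<close> to it gives, in the sense of distributions, the Dirac mass at the pole.\<close>

definition heat_fundamental_solution ::
  "nat \<Rightarrow> (nat \<Rightarrow> 'a::euclidean_space \<Rightarrow> 'a) \<Rightarrow> ('a \<Rightarrow> 'a \<Rightarrow> real \<Rightarrow> real) \<Rightarrow> bool" where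
  "heat_fundamental_solution m X p \<longleftrightarrow>
     (\<forall>x \<xi> t. t > 0 \<longrightarrow> p x \<xi> t > 0) \<and>
     (\<forall>x \<xi> t. t < 0 \<longrightarrow> p x \<xi> t = 0) \<and>
     (\<forall>\<xi> \<tau>. smooth_on (UNIV - {(\<xi>, \<tau>)}) (\<lambda>(x, t). p x \<xi> (t - \<tau>))) \<and>
     (\<forall>\<xi> \<tau> K. compact K \<longrightarrow> set_integrable lborel K (\<lambda>(x, t). p x \<xi> (t - \<tau>))) \<and>
     (\<forall>\<xi> \<tau> \<phi>. test_function \<phi> \<longrightarrow>
        (LINT w|lborel. p (fst w) \<xi> (snd w - \<tau>) * heat_adjoint m X \<phi> w) = \<phi> (\<xi>, \<tau>))"

text \<open>\<open>exp (- c * d\<^sup>2)\<close> with the convention \<open>exp (- \<infinity>) = 0\<close>.\<close>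

definition gauss :: "real \<Rightarrow> ereal \<Rightarrow> real" where
  "gauss c d = (if d = \<infinity> then 0 else exp (- c * (real_of_ereal d)\<^sup>2))"

text \<open>\<open>X_word X [j\<^sub>1, \<dots>, j\<^sub>l] f = X\<^sub>j\<^sub>1 \<dots> X\<^sub>j\<^sub>l f\<close>; below it acts on the first variable of \<open>p\<close>.\<close>

definition X_word :: "(nat \<Rightarrow> 'a::real_normed_vector \<Rightarrow> 'a) \<Rightarrow> nat list \<Rightarrow> ('a \<Rightarrow> real) \<Rightarrow> 'a \<Rightarrow> real" where
  "X_word X js f = foldr (\<lambda>j. vf_apply (X j)) js f"

definition gaussian_bounds ::
  "nat \<Rightarrow> (nat \<Rightarrow> 'a::euclidean_space \<Rightarrow> 'a) \<Rightarrow> ('a \<Rightarrow> 'a \<Rightarrow> real \<Rightarrow> real) \<Rightarrow> bool" where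
  "gaussian_bounds m X p \<longleftrightarrow> (\<exists>M>0.
     (\<forall>k l. \<exists>C>0. \<forall>js x y t. set js \<subseteq> {1..m} \<longrightarrow> length js = l \<longrightarrow> t > 0 \<longrightarrow>
        \<bar>(deriv ^^ k) (\<lambda>r. X_word X js (\<lambda>x'. p x' y r) x) t\<bar>
          \<le> C / (t powr (real k + real l / 2) * cc_vol m X x (sqrt t))
              * gauss (M / t) (cc_dist m X x y)) \<and>
     (\<exists>C>0. \<forall>x y t. t > 0 \<longrightarrow>
        p x y t \<ge> inverse C / cc_vol m X x (sqrt t) * gauss (inverse M / t) (cc_dist m X x y)))"

section \<open>Extension operator and Poisson kernel\<close>

definition bessel_op :: "real \<Rightarrow> (real \<Rightarrow> real) \<Rightarrow> real \<Rightarrow> real" where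
  "bessel_op a f z = deriv (deriv f) z + a / z * deriv f z"

definition extension_op ::
  "nat \<Rightarrow> (nat \<Rightarrow> 'a::euclidean_space \<Rightarrow> 'a) \<Rightarrow> real \<Rightarrow> ('a \<Rightarrow> real \<Rightarrow> real) \<Rightarrow> 'a \<Rightarrow> real \<Rightarrow> real" where
  "extension_op m X a U x z =
     z powr a * (sub_laplacian m X (\<lambda>y. U y z) x + bessel_op a (U x) z)"

definition poisson_integrand ::
  "('a \<Rightarrow> 'a \<Rightarrow> real \<Rightarrow> real) \<Rightarrow> real \<Rightarrow> real \<Rightarrow> 'a \<Rightarrow> 'a \<Rightarrow> real \<Rightarrow> real" where
  "poisson_integrand p a z x y t = exp (- z\<^sup>2 / (4 * t)) / t powr ((3 - a) / 2) * p x y t"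

definition poisson_kernel ::
  "('a \<Rightarrow> 'a \<Rightarrow> real \<Rightarrow> real) \<Rightarrow> real \<Rightarrow> real \<Rightarrow> 'a \<Rightarrow> 'a \<Rightarrow> real" where
  "poisson_kernel p a z x y =
     1 / (2 powr (1 - a) * Gamma ((1 - a) / 2)) * z powr (1 - a)
       * (LINT t:{0<..}|lborel. poisson_integrand p a z x y t)"

end

theory Submission
  imports Defs
begin

text \<open>
  The Gaussian upper and lower bounds, together with doubling, give
  \<open>\<bar>X\<^sub>J p(x,y,t)\<bar> \<le> C t^(-|J|/2) p(x,y,ct)\<close> for every word \<open>J\<close>. As \<open>p\<close> has unit mass in \<open>y\<close>, every integral of
  \<open>z\<^sup>\<alpha> t\<^sup>\<beta> exp (- z\<^sup>2 / 4t) X\<^sub>J p(x,y,t) u(y)\<close> with \<open>\<beta> < -1\<close> is bounded, locally uniformly in \<open>z\<close>. Since the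
  coordinate derivatives are locally combinations of words (Hormander's condition and Cramer's rule),
  these bounds in mean allow differentiation under the integral: each such integral is locally
  Lipschitz, hence \<open>C\<^sup>1\<close> with derivatives of the same kind, hence smooth. The distributional equation for
  \<open>p\<close> yields \<open>\<partial>\<^sub>t p = L p\<close> pointwise, and the time weight of the Poisson kernel satisfies \<open>\<partial>\<^sub>t g = B\<^sub>a g\<close>, so
  \<open>(L + B\<^sub>a) U\<close> is the integral of the exact derivative \<open>\<partial>\<^sub>t (g p)\<close>. For the boundary values, \<open>d\<close> is
  bounded below off the diagonal, so the heat semigroup converges to \<open>u\<close> as \<open>t \<rightarrow> 0\<close>, and the time weight,
  of total mass \<open>4\<^sup>s \<Gamma>(s)\<close>, concentrates at \<open>t = 0\<close> as \<open>z \<rightarrow> 0\<close>.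
\<close>

section \<open>Calculus of \<open>C\<^sup>k\<close> functions\<close>

text \<open>The majorant \<open>p x y (c * t)\<close> moves with \<open>x\<close>, and nothing
  proved here makes it locally uniform in \<open>x\<close>: that would call for a Harnack inequality
  or for metric geometry of \<open>d\<close>. Only its integral over \<open>y\<close>, equal to 1,
  is uniform, so every estimate is an L1 estimate. The smoothness induction closes because the
  integrals form a family indexed by (\<open>\<alpha>\<close>, \<open>\<beta>\<close>,
  \<open>J\<close>): a derivative along \<open>X i\<close> puts \<open>i\<close> in front of
  \<open>J\<close>, and a z-derivative leads to (\<open>\<alpha> - 1\<close>,
  \<open>\<beta>\<close>) and (\<open>\<alpha> + 1\<close>, \<open>\<beta> - 1\<close>). Both keep
  \<open>\<beta> < -1\<close>, which is convergence for large t; near t = 0 the factor exp(-z^2/4t)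
  absorbs every negative power of t, including t^(-|J|/2). The constant c is 1/M^2, because the
  lower bound at time t/M^2 decays at the rate M/t of the upper bound at time t. The exponents of
  the Poisson weight are \<open>\<alpha> = 2 * s\<close> and \<open>\<beta> = - 1 - s\<close>; then
  \<open>\<alpha> * (\<alpha> - 1 + a) = 0\<close>, which removes the one term of the Bessel
  operator that has no counterpart in the t-derivative.\<close>

abbreviation FD :: "('a::real_normed_vector \<Rightarrow> 'b::real_normed_vector) \<Rightarrow> 'a \<Rightarrow> 'a \<Rightarrow> 'b" where
  "FD f x \<equiv> frechet_derivative f (at x)"

lemma has_derivative_frechet:
  "f differentiable (at x) \<Longrightarrow> (f has_derivative FD f x) (at x)"
  by (simp add: frechet_derivative_works)

lemma Ck_on_subset: "Ck_on k S f \<Longrightarrow> T \<subseteq> S \<Longrightarrow> Ck_on k T f"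
  by (induction k arbitrary: f) (auto intro: continuous_on_subset)

lemma Ck_on_SucD: "Ck_on (Suc k) S f \<Longrightarrow> Ck_on k S f"
proof (induction k arbitrary: f)
  case 0
  then show ?case
    by (auto intro!: continuous_at_imp_continuous_on differentiable_imp_continuous_within)
next
  case (Suc k)
  then show ?case by (metis Ck_on.simps(2))
qed

lemma Ck_on_le: "Ck_on k S f \<Longrightarrow> j \<le> k \<Longrightarrow> Ck_on j S f"
  by (induction k) (auto simp: le_Suc_eq dest: Ck_on_SucD simp del: Ck_on.simps)

lemma Ck_on_imp_continuous_on: "Ck_on k S f \<Longrightarrow> continuous_on S f"
  using Ck_on_le[of k S f 0] by simp

lemma Ck_on_imp_differentiable: "Ck_on (Suc k) S f \<Longrightarrow> x \<in> S \<Longrightarrow> f differentiable (at x)"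
  by simp

lemma frechet_derivative_cong_open:
  assumes "open S" "x \<in> S" "\<And>y. y \<in> S \<Longrightarrow> f y = g y" "f differentiable (at x)"
  shows "g differentiable (at x)" "FD g x = FD f x"
proof -
  have "(g has_derivative FD f x) (at x)"
    by (rule has_derivative_transform_within_open[OF has_derivative_frechet[OF assms(4)] assms(1,2)])
       (use assms in auto)
  then show "g differentiable (at x)" "FD g x = FD f x"
    using frechet_derivative_at by (fastforce simp: differentiable_def)+
qed

text \<open>\<open>Ck_on\<close> refers to derivatives in the full space, so agreement on a set
  determines them only when the set is open.\<close>

lemma Ck_on_cong:
  assumes "open S" "\<And>x. x \<in> S \<Longrightarrow> f x = g x" "Ck_on k S f"
  shows "Ck_on k S g"
  using assms(2,3)
proof (induction k arbitrary: f g)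
  case 0
  then show ?case by (metis Ck_on.simps(1) continuous_on_cong)
next
  case (Suc k)
  have D: "g differentiable (at x)" "FD g x = FD f x"
    if "x \<in> S" for x
    using frechet_derivative_cong_open[OF \<open>open S\<close> that, of f g] Suc.prems that by auto
  have "Ck_on k S (\<lambda>x. FD g x v)" for v
    by (rule Suc.IH[of "\<lambda>x. FD f x v"]) (use D Suc.prems in auto)
  then show ?case using D by auto
qed

lemma Ck_on_SucI:
  assumes "open S" "\<And>x. x \<in> S \<Longrightarrow> (f has_derivative f' x) (at x)"
    and "\<And>v. Ck_on k S (\<lambda>x. f' x v)"
  shows "Ck_on (Suc k) S f"
proof -
  have eq: "FD f x = f' x" if "x \<in> S" for x
    using frechet_derivative_at[OF assms(2)[OF that]] by simp
  have "Ck_on k S (\<lambda>x. FD f x v)" for v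
    by (rule Ck_on_cong[OF assms(1) _ assms(3)[of v]]) (simp add: eq)
  then show ?thesis using assms(2) by (auto simp: differentiable_def)
qed

lemma Ck_on_SucE:
  assumes "Ck_on (Suc k) S f" "x \<in> S"
  shows "(f has_derivative FD f x) (at x)"
  using assms by (simp add: has_derivative_frechet)

lemma Ck_on_const: "open S \<Longrightarrow> Ck_on k S (\<lambda>x. c)"
proof (induction k arbitrary: c)
  case (Suc k)
  show ?case by (rule Ck_on_SucI[where f'="\<lambda>_ _. 0"]) (use Suc in auto)
qed auto

lemma Ck_on_bounded_linear:
  assumes "bounded_linear L" "open S"
  shows "Ck_on k S f \<Longrightarrow> Ck_on k S (\<lambda>x. L (f x))"
proof (induction k arbitrary: f)
  case 0
  then show ?case
    using bounded_linear.continuous_on[OF assms(1)] by auto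
next
  case (Suc k)
  show ?case
    by (rule Ck_on_SucI[where f'="\<lambda>x v. L (FD f x v)", OF assms(2)])
       (use Suc Ck_on_SucE[OF Suc.prems] in \<open>auto intro!: bounded_linear.has_derivative[OF assms(1)]\<close>)
qed

lemma Ck_on_add:
  assumes "open S"
  shows "Ck_on k S f \<Longrightarrow> Ck_on k S g \<Longrightarrow> Ck_on k S (\<lambda>x. f x + g x)"
proof (induction k arbitrary: f g)
  case 0
  then show ?case by (auto intro: continuous_intros)
next
  case (Suc k)
  show ?case
    by (rule Ck_on_SucI[OF assms has_derivative_add[OF Ck_on_SucE[OF Suc.prems(1)] Ck_on_SucE[OF Suc.prems(2)]]])
       (use Suc in auto)
qed

lemma Ck_on_sum:
  assumes "open S" "\<And>i. i \<in> I \<Longrightarrow> Ck_on k S (f i)"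
  shows "Ck_on k S (\<lambda>x. \<Sum>i\<in>I. f i x)"
  using assms(2)
  by (induction I rule: infinite_finite_induct) (auto intro!: Ck_on_const Ck_on_add assms(1))

lemma Ck_on_sum_list:
  assumes "open S" "\<And>i. i \<in> set L \<Longrightarrow> Ck_on k S (f i)"
  shows "Ck_on k S (\<lambda>x. \<Sum>i\<leftarrow>L. f i x)"
  using assms(2)
  by (induction L) (auto intro!: Ck_on_const Ck_on_add assms(1))

lemma Ck_on_bilinear:
  assumes "bounded_bilinear B" "open S"
  shows "Ck_on k S f \<Longrightarrow> Ck_on k S g \<Longrightarrow> Ck_on k S (\<lambda>x. B (f x) (g x))"
proof (induction k arbitrary: f g)
  case 0
  then show ?case by (auto intro: bounded_bilinear.continuous_on[OF assms(1)])
next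
  case (Suc k)
  show ?case
    by (rule Ck_on_SucI[OF assms(2) bounded_bilinear.FDERIV[OF assms(1) Ck_on_SucE[OF Suc.prems(1)] Ck_on_SucE[OF Suc.prems(2)]]])
       (use Suc.prems Ck_on_SucD[OF Suc.prems(1)] Ck_on_SucD[OF Suc.prems(2)]
          in \<open>auto intro!: Ck_on_add assms Suc.IH\<close>)
qed

lemmas Ck_on_mult = Ck_on_bilinear[OF bounded_bilinear_mult]
lemmas Ck_on_scaleR = Ck_on_bilinear[OF bounded_bilinear_scaleR]

lemma Ck_on_inner_left: "open S \<Longrightarrow> Ck_on k S f \<Longrightarrow> Ck_on k S (\<lambda>x. f x \<bullet> b)"
  by (rule Ck_on_bounded_linear[OF bounded_linear_inner_left])

lemma Ck_on_prod:
  fixes f :: "'i \<Rightarrow> 'a::real_normed_vector \<Rightarrow> real"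
  assumes "open S" "\<And>i. i \<in> I \<Longrightarrow> Ck_on k S (f i)"
  shows "Ck_on k S (\<lambda>x. \<Prod>i\<in>I. f i x)"
  using assms(2)
  by (induction I rule: infinite_finite_induct) (auto intro!: Ck_on_const Ck_on_mult assms(1))

text \<open>The whole chain of derivatives of the outer function is supplied at once: the chain rule
  moves from \<open>\<phi> j\<close> to \<open>\<phi> (Suc j)\<close>, so the induction on
  \<open>k\<close> closes with \<open>j\<close> arbitrary. It serves for reciprocals and for bump
  functions.\<close>

lemma Ck_on_compose_real:
  fixes \<phi> :: "nat \<Rightarrow> real \<Rightarrow> real"
  assumes \<phi>: "\<And>j t. t \<in> T \<Longrightarrow> (\<phi> j has_real_derivative \<phi> (Suc j) t) (at t)"
    and "open S" "\<And>x. x \<in> S \<Longrightarrow> f x \<in> T"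
  shows "Ck_on k S f \<Longrightarrow> Ck_on k S (\<lambda>x. \<phi> j (f x))"
proof (induction k arbitrary: j)
  case 0
  have "continuous_on T (\<phi> j)"
    using \<phi> by (intro continuous_at_imp_continuous_on) (auto intro: DERIV_isCont)
  then show ?case
    using 0 assms(3) by (auto intro!: continuous_on_compose2[of T "\<phi> j" S f])
next
  case (Suc k)
  show ?case
  proof (rule Ck_on_SucI[OF assms(2)])
    show "((\<lambda>x. \<phi> j (f x)) has_derivative (\<lambda>v. \<phi> (Suc j) (f x) * FD f x v)) (at x)"
      if "x \<in> S" for x
      using has_derivative_compose[OF Ck_on_SucE[OF Suc.prems that]
          \<phi>[OF assms(3)[OF that], unfolded has_field_derivative_def]] by simp
    show "Ck_on k S (\<lambda>x. \<phi> (Suc j) (f x) * FD f x v)" for v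
      using Suc Ck_on_SucD[OF Suc.prems] by (auto intro!: Ck_on_mult assms(2))
  qed
qed

lemma Ck_on_compose_affine:
  assumes L: "bounded_linear L" and "open T" "\<And>x. x \<in> T \<Longrightarrow> L x + c \<in> S"
  shows "Ck_on k S f \<Longrightarrow> Ck_on k T (\<lambda>x. f (L x + c))"
proof (induction k arbitrary: f)
  case 0
  have "continuous_on T (\<lambda>x. L x + c)"
    by (intro continuous_intros bounded_linear.continuous_on[OF L])
  then show ?case using 0 assms(3) by (auto intro!: continuous_on_compose2[of S f T])
next
  case (Suc k)
  show ?case
  proof (rule Ck_on_SucI[OF assms(2)])
    fix x assume x: "x \<in> T"
    have "((\<lambda>x. L x + c) has_derivative L) (at x)"
      using bounded_linear_imp_has_derivative[OF L] by (auto intro!: derivative_eq_intros)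
    from has_derivative_compose[OF this Ck_on_SucE[OF Suc.prems assms(3)[OF x]]]
    show "((\<lambda>x. f (L x + c)) has_derivative (\<lambda>v. FD f (L x + c) (L v))) (at x)" .
  next
    show "Ck_on k T (\<lambda>x. FD f (L x + c) (L v))" for v
      by (rule Suc.IH[of "\<lambda>x. FD f x (L v)"]) (use Suc.prems in auto)
  qed
qed

lemma Ck_on_fst: "Ck_on k S f \<Longrightarrow> open S \<Longrightarrow> open T \<Longrightarrow> Ck_on k (S \<times> T) (\<lambda>w. f (fst w))"
  using Ck_on_compose_affine[OF bounded_linear_fst, of "S \<times> T" 0 S k f] by (auto simp: open_Times)

lemma Ck_on_slice:
  assumes "Ck_on k (S \<times> T) f" "open S" "t \<in> T"
  shows "Ck_on k S (\<lambda>x. f (x, t))"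
  using Ck_on_compose_affine[OF bounded_linear_Pair[OF bounded_linear_ident bounded_linear_zero],
      of S "(0, t)" "S \<times> T" k f] assms
  by auto

lemma Ck_on_inverse:
  fixes f :: "'a::real_normed_vector \<Rightarrow> real"
  assumes "Ck_on k S f" "open S" "\<And>x. x \<in> S \<Longrightarrow> f x \<noteq> 0"
  shows "Ck_on k S (\<lambda>x. inverse (f x))"
proof -
  define \<phi> :: "nat \<Rightarrow> real \<Rightarrow> real" where "\<phi> = (\<lambda>j t. (-1)^j * fact j * inverse t ^ (Suc j))"
  have "(\<phi> j has_real_derivative \<phi> (Suc j) t) (at t)" if "t \<in> - {0}" for j t
  proof -
    have "((\<lambda>t. inverse t ^ Suc j) has_real_derivative - real (Suc j) * inverse t ^ Suc (Suc j)) (at t)"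
      using DERIV_power[OF DERIV_inverse[of t UNIV], of "Suc j"] that by (simp add: algebra_simps)
    from DERIV_cmult[OF this, of "(-1)^j * fact j"] show ?thesis
      by (simp add: \<phi>_def algebra_simps)
  qed
  from Ck_on_compose_real[of "-{0}" \<phi>, OF this assms(2) _ assms(1), of 0]
  show ?thesis using assms(3) by (simp add: \<phi>_def)
qed

lemma frechet_derivative_eq_sum_Basis:
  fixes f :: "'a::euclidean_space \<Rightarrow> 'b::real_normed_vector"
  assumes "f differentiable (at x)"
  shows "FD f x v = (\<Sum>b\<in>Basis. (v \<bullet> b) *\<^sub>R FD f x b)"
proof -
  have lin: "linear (FD f x)"
    using assms by (rule linear_frechet_derivative)
  have "FD f x (\<Sum>b\<in>Basis. (v \<bullet> b) *\<^sub>R b) = (\<Sum>b\<in>Basis. (v \<bullet> b) *\<^sub>R FD f x b)"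
    using lin by (simp add: linear_sum linear_cmul)
  then show ?thesis by (simp add: euclidean_representation)
qed

text \<open>\<open>Ck_on\<close> speaks of derivatives along constant directions only; expanding the
  direction \<open>V x\<close> in the basis reduces a moving direction to those.\<close>

lemma Ck_on_directional:
  fixes f :: "'a::euclidean_space \<Rightarrow> 'b::real_normed_vector"
  assumes "open S" "Ck_on (Suc k) S f" "Ck_on k S V"
  shows "Ck_on k S (\<lambda>x. FD f x (V x))"
proof -
  have "Ck_on k S (\<lambda>x. \<Sum>b\<in>Basis. (V x \<bullet> b) *\<^sub>R FD f x b)"
    using assms by (auto intro!: Ck_on_sum Ck_on_scaleR Ck_on_inner_left)
  then show ?thesis
    by (rule Ck_on_cong[OF assms(1), rotated])
       (use assms(2) in \<open>auto simp: frechet_derivative_eq_sum_Basis[symmetric]\<close>)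
qed

lemma smooth_on_imp_Ck_on: "smooth_on S f \<Longrightarrow> Ck_on k S f"
  by (simp add: smooth_on_def)

lemma smooth_on_vf_apply:
  fixes f :: "'a::euclidean_space \<Rightarrow> real"
  assumes "open S" "smooth_on S f" "smooth_on S V"
  shows "smooth_on S (vf_apply V f)"
  unfolding smooth_on_def vf_apply_def
  using assms by (auto intro!: Ck_on_directional simp: smooth_on_imp_Ck_on simp del: Ck_on.simps)

lemma smooth_on_differentiable: "smooth_on S f \<Longrightarrow> x \<in> S \<Longrightarrow> f differentiable (at x)"
  using Ck_on_imp_differentiable smooth_on_def by blast

section \<open>Symmetry of second derivatives\<close>

lemma directional_DERIV:
  fixes f :: "'a::real_normed_vector \<Rightarrow> real"
  assumes "f differentiable (at (y + r *\<^sub>R v))"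
  shows "((\<lambda>r. f (y + r *\<^sub>R v)) has_real_derivative FD f (y + r *\<^sub>R v) v) (at r)"
proof -
  have "((\<lambda>r. y + r *\<^sub>R v) has_derivative (\<lambda>r. r *\<^sub>R v)) (at r)"
    by (auto intro!: derivative_eq_intros)
  from has_derivative_compose[OF this has_derivative_frechet[OF assms]]
  have "((\<lambda>r. f (y + r *\<^sub>R v)) has_derivative (\<lambda>s. FD f (y + r *\<^sub>R v) (s *\<^sub>R v))) (at r)" .
  moreover have "(\<lambda>s. FD f (y + r *\<^sub>R v) (s *\<^sub>R v)) =
      (*) (FD f (y + r *\<^sub>R v) v)"
    using linear_cmul[OF linear_frechet_derivative[OF assms], where b = v] by (auto simp: mult.commute)
  ultimately show ?thesis by (simp add: has_field_derivative_def)
qed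

text \<open>Both orders of differentiation compute the limit of the same second-order difference quotient.\<close>

lemma second_difference_mean_value:
  fixes f :: "'a::real_normed_vector \<Rightarrow> real"
  assumes f: "Ck_on 2 UNIV f" and t: "t > 0"
  shows "\<exists>\<theta> \<eta>. 0 < \<theta> \<and> \<theta> < t \<and> 0 < \<eta> \<and> \<eta> < t \<and>
    f (x + t *\<^sub>R v + t *\<^sub>R w) - f (x + t *\<^sub>R v) - f (x + t *\<^sub>R w) + f x =
    t\<^sup>2 * FD (\<lambda>y. FD f y v) (x + \<theta> *\<^sub>R v + \<eta> *\<^sub>R w) w"
proof -
  let ?D = "\<lambda>v y. FD f y v"
  have f1: "f differentiable (at y)" and f2: "?D v differentiable (at y)" for y v
    using f by (auto simp: numeral_2_eq_2)
  define g where "g = (\<lambda>r. f (x + r *\<^sub>R v + t *\<^sub>R w) - f (x + r *\<^sub>R v))"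
  have g': "(g has_real_derivative ?D v (x + r *\<^sub>R v + t *\<^sub>R w) - ?D v (x + r *\<^sub>R v)) (at r)" for r
    unfolding g_def
    using DERIV_diff[OF directional_DERIV[OF f1, where y = "x + t *\<^sub>R w" and r = r and v = v]
        directional_DERIV[OF f1, where y = x and r = r and v = v]] by (simp add: ac_simps)
  obtain \<theta> where th: "0 < \<theta>" "\<theta> < t"
    "g t - g 0 = (t - 0) * (?D v (x + \<theta> *\<^sub>R v + t *\<^sub>R w) - ?D v (x + \<theta> *\<^sub>R v))"
    using MVT2[OF t g'] by blast
  obtain \<eta> where et: "0 < \<eta>" "\<eta> < t"
    "?D v (x + \<theta> *\<^sub>R v + t *\<^sub>R w) - ?D v (x + \<theta> *\<^sub>R v + 0 *\<^sub>R w)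
      = (t - 0) * FD (?D v) (x + \<theta> *\<^sub>R v + \<eta> *\<^sub>R w) w"
    using MVT2[OF t, of "\<lambda>r. ?D v (x + \<theta> *\<^sub>R v + r *\<^sub>R w)"
        "\<lambda>r. FD (?D v) (x + \<theta> *\<^sub>R v + r *\<^sub>R w) w", OF directional_DERIV[OF f2]]
    by blast
  show ?thesis
    using th et by (intro exI[of _ \<theta>] exI[of _ \<eta>]) (auto simp: g_def power2_eq_square algebra_simps)
qed

lemma second_derivative_symmetric:
  fixes f :: "'a::real_normed_vector \<Rightarrow> real"
  assumes f: "Ck_on 2 UNIV f"
  shows "FD (\<lambda>y. FD f y v) x w =
         FD (\<lambda>y. FD f y w) x v"
proof -
  define t where "t = (\<lambda>k. inverse (real (Suc k)))"
  have t: "t k > 0" for k by (simp add: t_def)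
  have t0: "t \<longlonglongrightarrow> 0" unfolding t_def by (rule LIMSEQ_inverse_real_of_nat)
  let ?\<Delta> = "\<lambda>k. f (x + t k *\<^sub>R v + t k *\<^sub>R w) - f (x + t k *\<^sub>R v) - f (x + t k *\<^sub>R w) + f x"
  \<comment> \<open>\<open>?\<Delta>\<close> belongs to the outer \<open>v\<close> and
    \<open>w\<close>. The local fact binds fresh directions and takes \<open>eq\<close> as a
    premise, so it applies to both orders, the second difference being symmetric in the two
    directions.\<close>
  have lim: "(\<lambda>k. ?\<Delta> k / (t k)\<^sup>2) \<longlonglongrightarrow> FD (\<lambda>y. FD f y v) x w"
    if eq: "\<And>k. ?\<Delta> k = f (x + t k *\<^sub>R v + t k *\<^sub>R w) - f (x + t k *\<^sub>R v) - f (x + t k *\<^sub>R w) + f x" for v w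
  proof -
    obtain \<theta> \<eta> where *: "\<And>k. 0 < \<theta> k \<and> \<theta> k < t k \<and> 0 < \<eta> k \<and> \<eta> k < t k \<and> ?\<Delta> k =
      (t k)\<^sup>2 * FD (\<lambda>y. FD f y v) (x + \<theta> k *\<^sub>R v + \<eta> k *\<^sub>R w) w"
      unfolding eq using second_difference_mean_value[OF f t, where x = x and v = v and w = w] by metis
    have th: "\<theta> \<longlonglongrightarrow> 0" "\<eta> \<longlonglongrightarrow> 0"
      by (rule tendsto_sandwich[OF always_eventually always_eventually tendsto_const t0]; use * in \<open>blast intro: less_imp_le\<close>)+
    have "(\<lambda>k. x + \<theta> k *\<^sub>R v + \<eta> k *\<^sub>R w) \<longlonglongrightarrow> x + 0 *\<^sub>R v + 0 *\<^sub>R w"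
      by (intro tendsto_add tendsto_scaleR tendsto_const th)
    then have l: "(\<lambda>k. x + \<theta> k *\<^sub>R v + \<eta> k *\<^sub>R w) \<longlonglongrightarrow> x" by simp
    have "isCont (\<lambda>z. FD (\<lambda>y. FD f y v) z w) x"
      using f by (auto simp: numeral_2_eq_2 continuous_on_eq_continuous_at)
    from isCont_tendsto_compose[OF this l]
    have "(\<lambda>k. FD (\<lambda>y. FD f y v) (x + \<theta> k *\<^sub>R v + \<eta> k *\<^sub>R w) w)
      \<longlonglongrightarrow> FD (\<lambda>y. FD f y v) x w" .
    moreover have "?\<Delta> k / (t k)\<^sup>2 =
      FD (\<lambda>y. FD f y v) (x + \<theta> k *\<^sub>R v + \<eta> k *\<^sub>R w) w" for k
      using *[of k] t[of k] by simp
    ultimately show ?thesis by (simp only:)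
  qed
  have "(\<lambda>k. ?\<Delta> k / (t k)\<^sup>2) \<longlonglongrightarrow> FD (\<lambda>y. FD f y v) x w"
    by (rule lim) simp
  moreover have "(\<lambda>k. ?\<Delta> k / (t k)\<^sup>2) \<longlonglongrightarrow> FD (\<lambda>y. FD f y w) x v"
    by (rule lim) (simp add: algebra_simps)
  ultimately show ?thesis by (rule LIMSEQ_unique)
qed

section \<open>Words in the vector fields\<close>

lemma smooth_on_X_word:
  assumes "\<And>i. i \<in> {1..m} \<Longrightarrow> smooth_on UNIV (X i)" "smooth_on UNIV (f :: 'a::euclidean_space \<Rightarrow> real)"
  shows "set J \<subseteq> {1..m} \<Longrightarrow> smooth_on UNIV (X_word X J f)"
  by (induction J) (auto simp: X_word_def assms(2) intro!: smooth_on_vf_apply assms(1))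

lemma X_word_append: "X_word X (J @ J') f = X_word X J (X_word X J' f)"
  by (simp add: X_word_def)

lemma X_word_Cons: "X_word X (j # J) f = vf_apply (X j) (X_word X J f)"
  by (simp add: X_word_def)

lemma X_word_Nil [simp]: "X_word X [] f = f"
  by (simp add: X_word_def)

lemma sum_list_concat: "sum_list (concat xss) = (\<Sum>xs\<leftarrow>xss. sum_list xs)"
  by (induction xss) auto

lemma has_derivative_sum_list:
  assumes "\<And>i. i \<in> set L \<Longrightarrow> (f i has_derivative f' i) F"
  shows "((\<lambda>x. \<Sum>i\<leftarrow>L. f i x) has_derivative (\<lambda>v. \<Sum>i\<leftarrow>L. f' i v)) F"
  using assms by (induction L) (auto intro!: derivative_eq_intros)

lemma vf_apply_sum_list:
  assumes "\<And>c J. (c, J) \<in> set L \<Longrightarrow> g J differentiable (at x)"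
  shows "vf_apply V (\<lambda>y. \<Sum>(c, J)\<leftarrow>L. c * g J y) x = (\<Sum>(c, J)\<leftarrow>L. c * vf_apply V (g J) x)"
proof -
  have "((\<lambda>y. \<Sum>i\<leftarrow>L. fst i * g (snd i) y) has_derivative
      (\<lambda>v. \<Sum>i\<leftarrow>L. fst i * FD (g (snd i)) x v)) (at x)"
    using assms by (intro has_derivative_sum_list has_derivative_mult_right has_derivative_frechet) force
  from frechet_derivative_at[OF this, symmetric] show ?thesis
    by (simp add: vf_apply_def case_prod_unfold)
qed

text \<open>Separates the first-order part, the derivative of \<open>W\<close> along
  \<open>V\<close>, from the Hessian part. In a commutator the Hessian parts cancel by symmetry and
  the first-order parts leave the coordinate formula of the bracket.\<close>

lemma vf_apply_vf_apply:
  fixes f :: "'a::euclidean_space \<Rightarrow> real"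
  assumes f: "Ck_on 2 UNIV f" and W: "W differentiable (at x)"
  shows "vf_apply V (vf_apply W f) x = FD f x (FD W x (V x)) +
    (\<Sum>b\<in>Basis. \<Sum>c\<in>Basis. (W x \<bullet> b) * (V x \<bullet> c) * FD (\<lambda>y. FD f y b) x c)"
proof -
  have f1: "f differentiable (at y)" and f2: "(\<lambda>y. FD f y v) differentiable (at y)" for y v
    using f by (auto simp: numeral_2_eq_2)
  have eq: "vf_apply W f = (\<lambda>y. \<Sum>b\<in>Basis. (W y \<bullet> b) * FD f y b)"
    by (rule ext) (simp add: vf_apply_def frechet_derivative_eq_sum_Basis[OF f1, of _ "W _"])
  have "(vf_apply W f has_derivative (\<lambda>v. \<Sum>b\<in>Basis.
      (W x \<bullet> b) * FD (\<lambda>y. FD f y b) x v +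
      (FD W x v \<bullet> b) * FD f x b)) (at x)"
    unfolding eq
    by (intro has_derivative_sum has_derivative_mult has_derivative_inner_left has_derivative_frechet f2 W)
  from frechet_derivative_at[OF this, symmetric]
  have "vf_apply V (vf_apply W f) x = (\<Sum>b\<in>Basis.
      (W x \<bullet> b) * FD (\<lambda>y. FD f y b) x (V x) +
      (FD W x (V x) \<bullet> b) * FD f x b)"
    by (simp add: vf_apply_def)
  also have "\<dots> = (\<Sum>b\<in>Basis. (W x \<bullet> b) * (\<Sum>c\<in>Basis. (V x \<bullet> c) * FD (\<lambda>y. FD f y b) x c))
      + FD f x (FD W x (V x))"
    by (simp add: sum.distrib frechet_derivative_eq_sum_Basis[OF f2, of _ _ "V x"]
        frechet_derivative_eq_sum_Basis[OF f1, of _ "FD W x (V x)"])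
  finally show ?thesis by (simp add: sum_distrib_left mult.assoc)
qed

lemma vf_apply_lie_bracket:
  fixes f :: "'a::euclidean_space \<Rightarrow> real"
  assumes f: "Ck_on 2 UNIV f" and V: "V differentiable (at x)" and W: "W differentiable (at x)"
  shows "vf_apply (lie_bracket V W) f x = vf_apply V (vf_apply W f) x - vf_apply W (vf_apply V f) x"
proof -
  let ?H = "\<lambda>b c. FD (\<lambda>y. FD f y b) x c"
  have "(\<Sum>b\<in>Basis. \<Sum>c\<in>Basis. (V x \<bullet> b) * (W x \<bullet> c) * ?H b c) =
        (\<Sum>c\<in>Basis. \<Sum>b\<in>Basis. (V x \<bullet> b) * (W x \<bullet> c) * ?H b c)"
    by (rule sum.swap)
  also have "\<dots> = (\<Sum>b\<in>Basis. \<Sum>c\<in>Basis. (W x \<bullet> b) * (V x \<bullet> c) * ?H b c)"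
    by (intro sum.cong refl) (simp add: second_derivative_symmetric[OF f] mult_ac)
  finally have sym: "(\<Sum>b\<in>Basis. \<Sum>c\<in>Basis. (V x \<bullet> b) * (W x \<bullet> c) * ?H b c) =
      (\<Sum>b\<in>Basis. \<Sum>c\<in>Basis. (W x \<bullet> b) * (V x \<bullet> c) * ?H b c)" .
  have lin: "linear (FD f x)"
    using f by (intro linear_frechet_derivative) (auto simp: numeral_2_eq_2)
  show ?thesis
    unfolding vf_apply_vf_apply[OF f V] vf_apply_vf_apply[OF f W] sym
    by (simp add: vf_apply_def lie_bracket_def linear_diff[OF lin])
qed

text \<open>The Gaussian bounds concern words in the given fields only, whereas Hormander's
  condition speaks of brackets. As operators, brackets are commutators, so every element of the Lie
  algebra acts as a combination of words with constant coefficients; this is preserved by each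
  generating rule.\<close>

lemma lie_algebra_words:
  fixes X :: "nat \<Rightarrow> 'a::euclidean_space \<Rightarrow> 'a"
  assumes X: "\<And>i. i \<in> {1..m} \<Longrightarrow> smooth_on UNIV (X i)" and "V \<in> lie_algebra m X"
  shows "smooth_on UNIV V \<and> (\<exists>L :: (real \<times> nat list) list. (\<forall>(c, J)\<in>set L. set J \<subseteq> {1..m}) \<and>
    (\<forall>f x. smooth_on UNIV f \<longrightarrow> vf_apply V f x = (\<Sum>(c, J)\<leftarrow>L. c * X_word X J f x)))"
  using assms(2)
proof induction
  case (gen i)
  show ?case
    by (intro conjI X gen exI[of _ "[(1, [i])]"]) (use gen in \<open>auto simp: X_word_Cons\<close>)
next
  case zero
  show ?case
    by (intro conjI exI[of _ "[]"])
       (auto simp: smooth_on_def vf_apply_def linear_0[OF linear_frechet_derivative]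
          smooth_on_differentiable Ck_on_const)
next
  case (add V W)
  then obtain L L' where L: "\<forall>(c, J)\<in>set L. set J \<subseteq> {1..m}" "\<forall>(c, J)\<in>set L'. set J \<subseteq> {1..m}"
    "\<And>f x. smooth_on UNIV f \<Longrightarrow> vf_apply V f x = (\<Sum>(c, J)\<leftarrow>L. c * X_word X J f x)"
    "\<And>f x. smooth_on UNIV f \<Longrightarrow> vf_apply W f x = (\<Sum>(c, J)\<leftarrow>L'. c * X_word X J f x)" by blast
  have "smooth_on UNIV (\<lambda>x. V x + W x)"
    using add by (auto simp: smooth_on_def intro!: Ck_on_add)
  moreover have "vf_apply (\<lambda>x. V x + W x) f x = (\<Sum>(c, J)\<leftarrow>L @ L'. c * X_word X J f x)"
    if f: "smooth_on UNIV f" for f x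
    using L(3)[OF f, of x] L(4)[OF f, of x] linear_frechet_derivative[OF smooth_on_differentiable[OF f UNIV_I]]
    by (simp add: vf_apply_def linear_add)
  moreover have "\<forall>(c, J)\<in>set (L @ L'). set J \<subseteq> {1..m}" using L by auto
  ultimately show ?case by blast
next
  case (scale V r)
  then obtain L where L: "\<forall>(c, J)\<in>set L. set J \<subseteq> {1..m}"
    "\<And>f x. smooth_on UNIV f \<Longrightarrow> vf_apply V f x = (\<Sum>(c, J)\<leftarrow>L. c * X_word X J f x)" by blast
  have "smooth_on UNIV (\<lambda>x. r *\<^sub>R V x)"
    using scale by (auto simp: smooth_on_def intro!: Ck_on_scaleR Ck_on_const)
  moreover have "vf_apply (\<lambda>x. r *\<^sub>R V x) f x = (\<Sum>(c, J)\<leftarrow>map (\<lambda>(c, J). (r * c, J)) L. c * X_word X J f x)"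
    if f: "smooth_on UNIV f" for f x
  proof -
    have "vf_apply (\<lambda>x. r *\<^sub>R V x) f x = r * (\<Sum>(c, J)\<leftarrow>L. c * X_word X J f x)"
      using L(2)[OF f, of x] linear_frechet_derivative[OF smooth_on_differentiable[OF f UNIV_I]]
      by (simp add: vf_apply_def linear_cmul)
    also have "\<dots> = (\<Sum>(c, J)\<leftarrow>map (\<lambda>(c, J). (r * c, J)) L. c * X_word X J f x)"
      by (simp add: sum_list_const_mult[symmetric] case_prod_unfold o_def mult.assoc)
    finally show ?thesis .
  qed
  moreover have "\<forall>(c, J)\<in>set (map (\<lambda>(c, J). (r * c, J)) L). set J \<subseteq> {1..m}" using L by auto
  ultimately show ?case by blast
next
  case (bracket V W)
  then obtain L L' where L: "\<And>c J. (c, J)\<in>set L \<Longrightarrow> set J \<subseteq> {1..m}" "\<And>c J. (c, J)\<in>set L' \<Longrightarrow> set J \<subseteq> {1..m}"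
    "\<And>f x. smooth_on UNIV f \<Longrightarrow> vf_apply V f x = (\<Sum>(c, J)\<leftarrow>L. c * X_word X J f x)"
    "\<And>f x. smooth_on UNIV f \<Longrightarrow> vf_apply W f x = (\<Sum>(c, J)\<leftarrow>L'. c * X_word X J f x)" by blast
  have sm: "smooth_on UNIV V" "smooth_on UNIV W" using bracket by auto
  have "smooth_on UNIV (lie_bracket V W)"
    unfolding smooth_on_def lie_bracket_def
  proof
    fix k
    have "Ck_on k UNIV (\<lambda>x. FD W x (V x) + (-1) *\<^sub>R FD V x (W x))"
      using sm by (intro Ck_on_add Ck_on_scaleR Ck_on_const Ck_on_directional) (auto simp: smooth_on_def simp del: Ck_on.simps)
    then show "Ck_on k UNIV (\<lambda>x. FD W x (V x) - FD V x (W x))"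
      by simp
  qed
  moreover
  \<comment> \<open>The words of \<open>r\<close> times the composed operator: words are
    concatenated and coefficients multiplied. The values 1 and -1 of \<open>r\<close> give the two
    halves of the commutator.\<close>
  define prods :: "(real \<times> nat list) list \<Rightarrow> (real \<times> nat list) list \<Rightarrow> real \<Rightarrow> (real \<times> nat list) list"
    where "prods L L' r = concat (map (\<lambda>(c', J'). map (\<lambda>(c, J). (r * c * c', J @ J')) L) L')" for L L' r
  have two: "vf_apply V (vf_apply W f) x * r = (\<Sum>(c, J)\<leftarrow>prods L L' r. c * X_word X J f x)"
    if f: "smooth_on UNIV f" and L: "\<And>c J. (c, J)\<in>set L \<Longrightarrow> set J \<subseteq> {1..m}" "\<And>c J. (c, J)\<in>set L' \<Longrightarrow> set J \<subseteq> {1..m}"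
      "\<And>f x. smooth_on UNIV f \<Longrightarrow> vf_apply V f x = (\<Sum>(c, J)\<leftarrow>L. c * X_word X J f x)"
      "\<And>f x. smooth_on UNIV f \<Longrightarrow> vf_apply W f x = (\<Sum>(c, J)\<leftarrow>L'. c * X_word X J f x)"
    for f x V W L L' r
  proof -
    have sw: "smooth_on UNIV (X_word X J f)" if "(c, J) \<in> set L'" for c J
      by (rule smooth_on_X_word[OF X f L(2)[OF that]])
    have W: "vf_apply W f = (\<lambda>y. \<Sum>(c, J)\<leftarrow>L'. c * X_word X J f y)" using L(4)[OF f] by auto
    have "vf_apply V (vf_apply W f) x = (\<Sum>(c', J')\<leftarrow>L'. c' * vf_apply V (X_word X J' f) x)"
      unfolding W by (rule vf_apply_sum_list) (use sw smooth_on_differentiable in blast)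
    also have "\<dots> = (\<Sum>(c', J')\<leftarrow>L'. c' * (\<Sum>(c, J)\<leftarrow>L. c * X_word X (J @ J') f x))"
      by (intro arg_cong[of _ _ sum_list] map_cong refl) (auto simp: L(3)[OF sw] X_word_append)
    also have "\<dots> * r = (\<Sum>(c, J)\<leftarrow>prods L L' r. c * X_word X J f x)"
      by (simp add: prods_def sum_list_concat o_def case_prod_unfold map_concat sum_list_mult_const[symmetric]
          sum_list_const_mult[symmetric] mult_ac)
    finally show ?thesis .
  qed
  have "vf_apply (lie_bracket V W) f x = (\<Sum>(c, J)\<leftarrow>prods L L' 1 @ prods L' L (-1). c * X_word X J f x)"
    if f: "smooth_on UNIV f" for f x
  proof -
    have "vf_apply (lie_bracket V W) f x = vf_apply V (vf_apply W f) x * 1 + vf_apply W (vf_apply V f) x * (-1)"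
      using vf_apply_lie_bracket[of f V x W] f sm by (simp add: smooth_on_def smooth_on_differentiable)
    then show ?thesis
      by (simp only: two[OF f L] two[OF f L(2,1,4,3)] map_append sum_list_append)
  qed
  moreover have "\<forall>(c, J)\<in>set (prods L L' 1 @ prods L' L (-1)). set J \<subseteq> {1..m}"
    using L(1,2) by (fastforce simp: prods_def)
  ultimately show ?case by blast
qed

section \<open>Local frames from Hormander's condition\<close>

lemma Ck_on_det:
  fixes A :: "'a::real_normed_vector \<Rightarrow> real^'n^'n"
  assumes "open S" "\<And>i j. Ck_on k S (\<lambda>x. A x $ i $ j)"
  shows "Ck_on k S (\<lambda>x. det (A x))"
  unfolding det_def using assms by (intro Ck_on_sum Ck_on_mult Ck_on_const Ck_on_prod) auto

text \<open>Coordinate derivatives are recovered from a frame of Lie algebra elements by Cramer's rule.\<close>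

lemma hormander_local_frame:
  fixes X :: "nat \<Rightarrow> real^'n \<Rightarrow> real^'n"
  assumes X: "\<And>i. i \<in> {1..m} \<Longrightarrow> smooth_on UNIV (X i)" and "hormander m X"
  obtains N and \<Lambda> :: "real^'n \<Rightarrow> ((real^'n \<Rightarrow> real) \<times> nat list) list"
  where "open N" "x0 \<in> N" "\<And>v e J. (e, J) \<in> set (\<Lambda> v) \<Longrightarrow> smooth_on N e \<and> set J \<subseteq> {1..m}"
    "\<And>v f x. smooth_on UNIV f \<Longrightarrow> x \<in> N \<Longrightarrow>
       FD f x v = (\<Sum>(e, J)\<leftarrow>\<Lambda> v. e x * X_word X J f x)"
proof -
  let ?S = "(\<lambda>V. V x0) ` lie_algebra m X"
  have "dim ?S = CARD('n)" using assms(2) by (simp add: hormander_def)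
  then obtain B where B: "B \<subseteq> ?S" "independent B" "?S \<subseteq> span B" "card B = CARD('n)"
    using basis_exists[of ?S] by metis
  have spanB: "span B = UNIV"
    using B(2,4) by (metis DIM_cart DIM_real dim_eq_full dim_eq_card_independent mult.right_neutral)
  have "finite B" using B(2) independent_imp_finite by blast
  then obtain \<beta> where \<beta>: "bij_betw \<beta> (UNIV :: 'n set) B"
    using B(4) by (metis finite_class.finite_UNIV finite_same_card_bij)
  have "\<exists>V. V \<in> lie_algebra m X \<and> V x0 = \<beta> i" for i
  proof -
    have "\<beta> i \<in> ?S" using bij_betwE[OF \<beta>] B(1) by blast
    then show ?thesis by force
  qed
  then obtain Y where Y: "\<And>i. Y i \<in> lie_algebra m X" "\<And>i. Y i x0 = \<beta> i" by metis
  have Ys: "smooth_on UNIV (Y i)" for i using lie_algebra_words[OF X Y(1)] by blast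
  obtain L :: "'n \<Rightarrow> (real \<times> nat list) list" where L: "\<And>i. \<forall>(c, J)\<in>set (L i). set J \<subseteq> {1..m}"
    "\<And>i f x. smooth_on UNIV f \<Longrightarrow> vf_apply (Y i) f x = (\<Sum>(c, J)\<leftarrow>L i. c * X_word X J f x)"
    using lie_algebra_words[OF X Y(1)] by metis
  \<comment> \<open>The columns of \<open>A x\<close> are the fields \<open>Y i\<close> at
    \<open>x\<close>; \<open>A' j v x\<close> has \<open>v\<close> in place of column
    \<open>j\<close>. Quotients of their determinants are the coordinates of \<open>v\<close> in the
    frame, and they inherit the smoothness of the fields.\<close>
  define A :: "real^'n \<Rightarrow> real^'n^'n" where "A x = (\<chi> r i. Y i x $ r)" for x
  define A' :: "'n \<Rightarrow> real^'n \<Rightarrow> real^'n \<Rightarrow> real^'n^'n" where "A' j v x = (\<chi> r i. if i = j then v $ r else Y i x $ r)" for j v x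
  have AY: "Ck_on k UNIV (\<lambda>x. Y i x $ r)" for k i r
    using Ck_on_inner_left[OF _ smooth_on_imp_Ck_on[OF Ys], of k i "axis r 1"] by (simp add: inner_axis)
  have dA: "Ck_on k UNIV (\<lambda>x. det (A x))" for k
    by (rule Ck_on_det) (auto simp: A_def AY)
  have dA': "Ck_on k UNIV (\<lambda>x. det (A' j v x))" for k j v
  proof (rule Ck_on_det)
    show "Ck_on k UNIV (\<lambda>x. A' j v x $ r $ i)" for r i
      by (cases "i = j") (simp_all add: A'_def AY Ck_on_const)
  qed simp
  \<comment> \<open>At \<open>x0\<close> the columns are the chosen basis \<open>B\<close>, so the
    frame survives on this open neighbourhood of \<open>x0\<close>.\<close>
  define N where "N = {x. det (A x) \<noteq> 0}"
  have "open N"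
    unfolding N_def using dA[of 0] by (intro open_Collect_neq) auto
  have "columns (A x0) = B"
    using \<beta> by (auto simp: columns_def column_def A_def Y(2) bij_betw_def vec_eq_iff image_iff full_SetCompr_eq)
  then have "invertible (A x0)"
    using spanB matrix_right_invertible_span_columns[of "A x0"] by (simp add: invertible_right_inverse span_vec_eq)
  then have "x0 \<in> N" by (simp add: N_def invertible_det_nz)
  define d where "d v i x = inverse (det (A x)) * det (A' i v x)" for v i x
  have d: "smooth_on N (d v i)" for v i
    unfolding smooth_on_def d_def
    using \<open>open N\<close> by (auto intro!: Ck_on_mult Ck_on_inverse Ck_on_subset[OF dA] Ck_on_subset[OF dA'] simp: N_def)
  have repr: "v = (\<Sum>i\<in>UNIV. d v i x *\<^sub>R Y i x)" if "x \<in> N" for v x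
  proof -
    have "det (A x) \<noteq> 0" using that by (simp add: N_def)
    from cramer[OF this, of "\<chi> k. d v k x" v]
    have "A x *v (\<chi> k. d v k x) = v"
      by (simp add: d_def A'_def A_def divide_inverse mult.commute cong: if_cong)
    then show ?thesis
      by (auto simp: matrix_vector_mult_def A_def vec_eq_iff mult.commute)
  qed
  obtain ns :: "'n list" where ns: "set ns = UNIV" "distinct ns"
    using finite_distinct_list[of "UNIV :: 'n set"] by auto
  define \<Lambda> where "\<Lambda> v = concat (map (\<lambda>i. map (\<lambda>(c, J). (\<lambda>x. d v i x * c, J)) (L i)) ns)" for v
  show thesis
  proof (rule that[of N \<Lambda>])
    show "smooth_on N e \<and> set J \<subseteq> {1..m}" if "(e, J) \<in> set (\<Lambda> v)" for v e J
    proof -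
      obtain i c where *: "(c, J) \<in> set (L i)" "e = (\<lambda>x. d v i x * c)"
        using \<open>(e, J) \<in> set (\<Lambda> v)\<close> by (auto simp: \<Lambda>_def)
      have "smooth_on N e"
        unfolding smooth_on_def *(2)
        by (intro allI Ck_on_mult Ck_on_const smooth_on_imp_Ck_on[OF d] \<open>open N\<close>)
      moreover have "set J \<subseteq> {1..m}" using bspec[OF L(1) *(1)] by simp
      ultimately show ?thesis ..
    qed
    fix v and f :: "real^'n \<Rightarrow> real" and x assume f: "smooth_on UNIV f" and x: "x \<in> N"
    have lin: "linear (FD f x)"
      by (intro linear_frechet_derivative smooth_on_differentiable[OF f]) simp
    have "FD f x v = FD f x (\<Sum>i\<in>UNIV. d v i x *\<^sub>R Y i x)"
      using repr[OF x, of v] by simp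
    also have "\<dots> = (\<Sum>i\<in>UNIV. d v i x * (\<Sum>(c, J)\<leftarrow>L i. c * X_word X J f x))"
      using L(2)[OF f, of _ x] by (simp add: linear_sum[OF lin] linear_cmul[OF lin] vf_apply_def)
    also have "\<dots> = (\<Sum>i\<leftarrow>ns. d v i x * (\<Sum>(c, J)\<leftarrow>L i. c * X_word X J f x))"
      unfolding sum.distinct_set_conv_list[OF ns(2)] ns(1)[symmetric] ..
    also have "\<dots> = (\<Sum>(e, J)\<leftarrow>\<Lambda> v. e x * X_word X J f x)"
      by (simp add: \<Lambda>_def sum_list_concat o_def case_prod_unfold map_concat sum_list_const_mult mult.assoc)
    finally show "FD f x v = (\<Sum>(e, J)\<leftarrow>\<Lambda> v. e x * X_word X J f x)" .
  qed fact+
qed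

text \<open>A function continuous in one variable and measurable in the other is a limit of
  functions whose first argument is replaced by a simple approximation with finitely many values. An
  approximating value may lie outside \<open>S\<close>; hence the extension \<open>g\<close> by 0,
  harmless since the values enter the open set \<open>S\<close> eventually.\<close>

lemma borel_measurable_caratheodory:
  fixes f :: "'a::{second_countable_topology,metric_space} \<Rightarrow> 'q \<Rightarrow> real"
  assumes "open S" and f: "\<And>a. a \<in> S \<Longrightarrow> f a \<in> borel_measurable M"
    and cont: "\<And>q. q \<in> space M \<Longrightarrow> continuous_on S (\<lambda>a. f a q)"
  shows "(\<lambda>w. indicator S (fst w) * f (fst w) (snd w)) \<in> borel_measurable (borel \<Otimes>\<^sub>M M)"
proof -
  obtain F :: "nat \<Rightarrow> 'a \<Rightarrow> 'a" where F: "\<And>i. simple_function borel (F i)" "\<And>x. (\<lambda>i. F i x) \<longlonglongrightarrow> x"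
    using borel_measurable_implies_sequence_metric[of "\<lambda>x::'a. x" borel undefined] by auto
  define g where "g b q = (if b \<in> S then f b q else 0)" for b q
  have gm: "g b \<in> borel_measurable M" for b
  proof -
    have "g b = (if b \<in> S then f b else (\<lambda>_. 0))" by (auto simp: g_def)
    then show ?thesis using f by auto
  qed
  have *: "(\<lambda>w. g (F i (fst w)) (snd w)) \<in> borel_measurable (borel \<Otimes>\<^sub>M M)" for i
  proof -
    have fin: "finite (range (F i))" using simple_functionD(1)[OF F(1)[of i]] by simp
    then have c: "countable (range (F i))" by (rule countable_finite)
    have "F i \<in> measurable borel (count_space (range (F i)))"
      unfolding measurable_count_space_eq2[OF fin] using simple_functionD(2)[OF F(1)[of i]] by auto
    then have Fm: "(\<lambda>w. F i (fst w)) \<in> measurable (borel \<Otimes>\<^sub>M M) (count_space (range (F i)))"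
      by (rule measurable_compose[OF measurable_fst])
    show ?thesis
      by (rule measurable_compose_countable'[where f = "\<lambda>b w. g b (snd w)", OF _ Fm c])
         (intro measurable_compose[OF measurable_snd gm])
  qed
  show ?thesis
  proof (rule borel_measurable_LIMSEQ_real)
    show "(\<lambda>w. indicator S (fst w) * g (F i (fst w)) (snd w)) \<in> borel_measurable (borel \<Otimes>\<^sub>M M)" for i
      using * \<open>open S\<close>
      by (intro borel_measurable_times measurable_compose[OF measurable_fst borel_measurable_indicator]) auto
    fix w :: "'a \<times> 'q" assume w: "w \<in> space (borel \<Otimes>\<^sub>M M)"
    show "(\<lambda>i. indicator S (fst w) * g (F i (fst w)) (snd w)) \<longlonglongrightarrow> indicator S (fst w) * f (fst w) (snd w)"
    proof (cases "fst w \<in> S")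
      case True
      have q: "snd w \<in> space M" using w by (auto simp: space_pair_measure)
      have "isCont (\<lambda>a. f a (snd w)) (fst w)"
        using cont[OF q] True \<open>open S\<close> by (simp add: continuous_on_eq_continuous_at)
      from isCont_tendsto_compose[OF this F(2)]
      have "(\<lambda>i. f (F i (fst w)) (snd w)) \<longlonglongrightarrow> f (fst w) (snd w)" .
      moreover have "\<forall>\<^sub>F i in sequentially. F i (fst w) \<in> S"
        using F(2)[of "fst w"] \<open>open S\<close> True by (rule topological_tendstoD)
      ultimately have "(\<lambda>i. g (F i (fst w)) (snd w)) \<longlonglongrightarrow> f (fst w) (snd w)"
        by (rule Lim_transform_eventually[OF _ eventually_mono]) (simp add: g_def)
      then show ?thesis using True by simp
    qed simp
  qed
qed

section \<open>Differentiation under the integral with bounds in mean\<close>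

text \<open>No pointwise dominating function is available for the heat kernel derivatives, only bounds on
  their integrals; the fundamental theorem of calculus along segments and Tonelli's theorem suffice.\<close>

definition L1_cont :: "'q measure \<Rightarrow> ('a::metric_space \<Rightarrow> 'q \<Rightarrow> real) \<Rightarrow> 'a \<Rightarrow> bool" where
  "L1_cont M h w \<longleftrightarrow> (\<forall>\<^sub>F w' in nhds w. integrable M (h w')) \<and>
     ((\<lambda>w'. LINT q|M. \<bar>h w' q - h w q\<bar>) \<longlongrightarrow> 0) (nhds w)"

lemma L1_cont_integrable: "L1_cont M h w \<Longrightarrow> integrable M (h w)"
  unfolding L1_cont_def using eventually_nhds_x_imp_x by blast

lemma L1_cont_zero: "L1_cont M (\<lambda>w q. 0) w"
  by (simp add: L1_cont_def)

lemma L1_cont_add: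
  assumes f: "L1_cont M f w" and g: "L1_cont M g w"
  shows "L1_cont M (\<lambda>w q. f w q + g w q) w"
  unfolding L1_cont_def
proof
  have ev: "\<forall>\<^sub>F w' in nhds w. integrable M (f w') \<and> integrable M (g w')"
    using f g by (auto simp: L1_cont_def intro: eventually_conj)
  then show "\<forall>\<^sub>F w' in nhds w. integrable M (\<lambda>q. f w' q + g w' q)"
    by (rule eventually_mono) auto
  have i: "integrable M (f w)" "integrable M (g w)"
    using f g by (auto intro: L1_cont_integrable)
  have lim: "((\<lambda>w'. (LINT q|M. \<bar>f w' q - f w q\<bar>) + (LINT q|M. \<bar>g w' q - g w q\<bar>)) \<longlongrightarrow> 0) (nhds w)"
    by (rule tendsto_add_zero[OF conjunct2[OF f[unfolded L1_cont_def]] conjunct2[OF g[unfolded L1_cont_def]]])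
  show "((\<lambda>w'. LINT q|M. \<bar>f w' q + g w' q - (f w q + g w q)\<bar>) \<longlongrightarrow> 0) (nhds w)"
  proof (rule tendsto_sandwich[OF _ _ tendsto_const lim])
    show "\<forall>\<^sub>F w' in nhds w. (LINT q|M. \<bar>f w' q + g w' q - (f w q + g w q)\<bar>)
        \<le> (LINT q|M. \<bar>f w' q - f w q\<bar>) + (LINT q|M. \<bar>g w' q - g w q\<bar>)"
      using ev
    proof eventually_elim
      case (elim w')
      have "(LINT q|M. \<bar>f w' q + g w' q - (f w q + g w q)\<bar>)
        \<le> (LINT q|M. \<bar>f w' q - f w q\<bar> + \<bar>g w' q - g w q\<bar>)"
        using elim i by (intro integral_mono) auto
      then show ?case using elim i by simp
    qed
  qed simp
qed

lemma L1_cont_mult: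
  assumes f: "L1_cont M f w" and c: "isCont c w"
  shows "L1_cont M (\<lambda>w q. c w * f w q) w"
  unfolding L1_cont_def
proof
  have ev: "\<forall>\<^sub>F w' in nhds w. integrable M (f w')"
    using f by (auto simp: L1_cont_def)
  then show "\<forall>\<^sub>F w' in nhds w. integrable M (\<lambda>q. c w' * f w' q)"
    by (rule eventually_mono) auto
  have i: "integrable M (f w)"
    using f by (rule L1_cont_integrable)
  have "(c \<longlongrightarrow> c w) (nhds w)"
    using c by (simp add: isCont_def tendsto_nhds_iff)
  then have "((\<lambda>w'. \<bar>c w'\<bar> * (LINT q|M. \<bar>f w' q - f w q\<bar>) + \<bar>c w' - c w\<bar> * (LINT q|M. \<bar>f w q\<bar>)) \<longlongrightarrow>
      \<bar>c w\<bar> * 0 + \<bar>c w - c w\<bar> * (LINT q|M. \<bar>f w q\<bar>)) (nhds w)"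
    using f by (intro tendsto_intros) (auto simp: L1_cont_def)
  then have lim: "((\<lambda>w'. \<bar>c w'\<bar> * (LINT q|M. \<bar>f w' q - f w q\<bar>) + \<bar>c w' - c w\<bar> * (LINT q|M. \<bar>f w q\<bar>)) \<longlongrightarrow> 0) (nhds w)"
    by simp
  show "((\<lambda>w'. LINT q|M. \<bar>c w' * f w' q - c w * f w q\<bar>) \<longlongrightarrow> 0) (nhds w)"
  proof (rule tendsto_sandwich[OF _ _ tendsto_const lim])
    show "\<forall>\<^sub>F w' in nhds w. (LINT q|M. \<bar>c w' * f w' q - c w * f w q\<bar>)
        \<le> \<bar>c w'\<bar> * (LINT q|M. \<bar>f w' q - f w q\<bar>) + \<bar>c w' - c w\<bar> * (LINT q|M. \<bar>f w q\<bar>)"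
      using ev
    proof eventually_elim
      case (elim w')
      have "(LINT q|M. \<bar>c w' * f w' q - c w * f w q\<bar>)
        \<le> (LINT q|M. \<bar>c w'\<bar> * \<bar>f w' q - f w q\<bar> + \<bar>c w' - c w\<bar> * \<bar>f w q\<bar>)"
      proof (rule integral_mono)
        fix q
        have "c w' * f w' q - c w * f w q = c w' * (f w' q - f w q) + (c w' - c w) * f w q"
          by (simp add: algebra_simps)
        also have "\<bar>\<dots>\<bar> \<le> \<bar>c w' * (f w' q - f w q)\<bar> + \<bar>(c w' - c w) * f w q\<bar>"
          by (rule abs_triangle_ineq)
        finally show "\<bar>c w' * f w' q - c w * f w q\<bar> \<le> \<bar>c w'\<bar> * \<bar>f w' q - f w q\<bar> + \<bar>c w' - c w\<bar> * \<bar>f w q\<bar>"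
          by (simp add: abs_mult)
      qed (use elim i in auto)
      then show ?case using elim i by simp
    qed
  qed simp
qed

lemma L1_cont_sum_list:
  assumes "\<And>i. i \<in> set L \<Longrightarrow> L1_cont M (f i) w"
  shows "L1_cont M (\<lambda>w q. \<Sum>i\<leftarrow>L. f i w q) w"
  using assms by (induction L) (auto intro: L1_cont_add L1_cont_zero)

lemma L1_cont_cong:
  assumes "open S" "w \<in> S" "\<And>w' q. w' \<in> S \<Longrightarrow> q \<in> space M \<Longrightarrow> f w' q = g w' q" "L1_cont M f w"
  shows "L1_cont M g w"
proof -
  have ev: "\<forall>\<^sub>F w' in nhds w. w' \<in> S"
    using assms(1,2) by (rule eventually_nhds_in_open)
  have "\<forall>\<^sub>F w' in nhds w. integrable M (g w')"
    using ev conjunct1[OF assms(4)[unfolded L1_cont_def]]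
  proof eventually_elim
    case (elim w')
    then show ?case
      using Bochner_Integration.integrable_cong[OF refl, of M "f w'" "g w'"] assms(3)[OF elim(1)] by blast
  qed
  moreover have "\<forall>\<^sub>F w' in nhds w. (LINT q|M. \<bar>f w' q - f w q\<bar>) = (LINT q|M. \<bar>g w' q - g w q\<bar>)"
    using ev
  proof eventually_elim
    case (elim w')
    then show ?case
      using assms(3)[OF elim] assms(3)[OF assms(2)] by (intro Bochner_Integration.integral_cong refl) simp
  qed
  note tendsto_cong[OF this]
  ultimately show ?thesis
    using assms(4) unfolding L1_cont_def by simp
qed

context sigma_finite_measure
begin

lemma nn_integral_difference_le:
  fixes h :: "'b::euclidean_space \<Rightarrow> 'a \<Rightarrow> real"
  assumes "open S"
    and der: "\<And>w q. w \<in> S \<Longrightarrow> q \<in> space M \<Longrightarrow> ((\<lambda>w. h w q) has_derivative h' w q) (at w)"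
    and cont: "\<And>q v. q \<in> space M \<Longrightarrow> continuous_on S (\<lambda>w. h' w q v)"
    and meas: "\<And>w v. w \<in> S \<Longrightarrow> (\<lambda>q. h' w q v) \<in> borel_measurable M"
    and bnd: "\<And>w b. w \<in> S \<Longrightarrow> b \<in> Basis \<Longrightarrow> (\<integral>\<^sup>+q. ennreal \<bar>h' w q b\<bar> \<partial>M) \<le> ennreal C"
    and C: "C \<ge> 0" and seg: "closed_segment w w' \<subseteq> S"
  shows "(\<integral>\<^sup>+q. ennreal \<bar>h w' q - h w q\<bar> \<partial>M) \<le> ennreal (C * (\<Sum>b\<in>Basis. \<bar>(w' - w) \<bullet> b\<bar>))"
proof -
  define v where "v = w' - w"
  \<comment> \<open>An open parameter set around [0,1]: joint measurability in the parameter and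
    \<open>q\<close> is available over open sets, so the integrand is first cut off to
    \<open>T\<close> and then to the interval.\<close>
  define T where "T = {r. w + r *\<^sub>R v \<in> S}"
  have "open T"
    unfolding T_def using \<open>open S\<close> by (intro open_vimage[unfolded vimage_def]) (auto intro!: continuous_intros)
  have T01: "{0..1} \<subseteq> T"
  proof
    fix r :: real assume "r \<in> {0..1}"
    then have "w + r *\<^sub>R v \<in> closed_segment w w'"
      unfolding in_segment by (intro exI[of _ r]) (auto simp: v_def algebra_simps)
    then show "r \<in> T" using seg by (auto simp: T_def)
  qed
  have contT: "continuous_on T (\<lambda>r. h' (w + r *\<^sub>R v) q v)" if "q \<in> space M" for q
    by (rule continuous_on_compose2[OF cont[OF that]]) (auto simp: T_def intro!: continuous_intros)
  have joint: "(\<lambda>x. indicator T (fst x) * h' (w + fst x *\<^sub>R v) (snd x) v) \<in> borel_measurable (borel \<Otimes>\<^sub>M M)"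
    by (rule borel_measurable_caratheodory[OF \<open>open T\<close> _ contT]) (auto simp: T_def intro: meas)
  define k where "k r q = indicator {0..1} r * \<bar>indicator T r * h' (w + r *\<^sub>R v) q v\<bar>" for r :: real and q
  have km: "(\<lambda>(q, r). ennreal (k r q)) \<in> borel_measurable (M \<Otimes>\<^sub>M lborel)"
  proof -
    have "(\<lambda>x. ennreal (k (fst x) (snd x))) \<in> borel_measurable (borel \<Otimes>\<^sub>M M)"
      unfolding k_def using joint by measurable
    then have "(\<lambda>x. ennreal (k (fst x) (snd x))) \<in> borel_measurable (lborel \<Otimes>\<^sub>M M)"
      by (simp cong: measurable_cong_sets sets_pair_measure_cong)
    from measurable_pair_swap[OF this] show ?thesis by (simp add: case_prod_unfold)
  qed
  have one: "ennreal \<bar>h w' q - h w q\<bar> \<le> (\<integral>\<^sup>+r. ennreal (k r q) \<partial>lborel)" if q: "q \<in> space M" for q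
  proof -
    have d: "((\<lambda>r. h (w + r *\<^sub>R v) q) has_vector_derivative h' (w + r *\<^sub>R v) q v) (at r within {0..1})"
      if "r \<in> {0..1}" for r
    proof -
      have "((\<lambda>r. w + r *\<^sub>R v) has_vector_derivative v) (at r within {0..1})"
        by (auto intro!: derivative_eq_intros)
      moreover have "((\<lambda>w. h w q) has_derivative h' (w + r *\<^sub>R v) q) (at (w + r *\<^sub>R v))"
        using that T01 q by (intro der) (auto simp: T_def)
      ultimately show ?thesis
        using vector_derivative_diff_chain_within has_derivative_at_withinI unfolding o_def by blast
    qed
    have ftc: "((\<lambda>r. h' (w + r *\<^sub>R v) q v) has_integral (h w' q - h w q)) {0..1}"
      using fundamental_theorem_of_calculus[OF zero_le_one d] by (simp add: v_def)
    have "continuous_on {0..1} (\<lambda>r. h' (w + r *\<^sub>R v) q v)"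
      using contT[OF q] T01 by (rule continuous_on_subset)
    then have i: "set_integrable lborel {0..1} (\<lambda>r. h' (w + r *\<^sub>R v) q v)"
      by (rule borel_integrable_atLeastAtMost')
    have "h w' q - h w q = (LINT r:{0..1}|lborel. h' (w + r *\<^sub>R v) q v)"
      using set_borel_integral_eq_integral(2)[OF i] integral_unique[OF ftc] by simp
    then have "ennreal \<bar>h w' q - h w q\<bar> \<le> (\<integral>\<^sup>+r. norm (indicator {0..1} r *\<^sub>R h' (w + r *\<^sub>R v) q v) \<partial>lborel)"
      using integral_norm_bound_ennreal[OF i[unfolded set_integrable_def]]
      by (simp add: set_lebesgue_integral_def)
    also have "\<dots> = (\<integral>\<^sup>+r. ennreal (k r q) \<partial>lborel)"
      using T01 by (intro nn_integral_cong) (auto simp: k_def abs_mult split: split_indicator)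
    finally show ?thesis .
  qed
  interpret pair_sigma_finite M lborel
    using sigma_finite_measure_axioms lborel.sigma_finite_measure_axioms by (simp add: pair_sigma_finite_def)
  have "(\<integral>\<^sup>+q. ennreal \<bar>h w' q - h w q\<bar> \<partial>M) \<le> (\<integral>\<^sup>+q. \<integral>\<^sup>+r. ennreal (k r q) \<partial>lborel \<partial>M)"
    by (rule nn_integral_mono) (rule one)
  also have "\<dots> = (\<integral>\<^sup>+r. \<integral>\<^sup>+q. ennreal (k r q) \<partial>M \<partial>lborel)"
    by (rule Fubini'[OF km, symmetric])
  also have "\<dots> \<le> (\<integral>\<^sup>+r. ennreal (C * (\<Sum>b\<in>Basis. \<bar>v \<bullet> b\<bar>)) * indicator {0..1::real} r \<partial>lborel)"
  proof (rule nn_integral_mono)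
    fix r :: real
    show "(\<integral>\<^sup>+q. ennreal (k r q) \<partial>M) \<le> ennreal (C * (\<Sum>b\<in>Basis. \<bar>v \<bullet> b\<bar>)) * indicator {0..1} r"
    proof (cases "r \<in> {0..1}")
      case True
      then have wr: "w + r *\<^sub>R v \<in> S" using T01 by (auto simp: T_def)
      have "(\<integral>\<^sup>+q. ennreal (k r q) \<partial>M) \<le> (\<integral>\<^sup>+q. (\<Sum>b\<in>Basis. ennreal \<bar>v \<bullet> b\<bar> * ennreal \<bar>h' (w + r *\<^sub>R v) q b\<bar>) \<partial>M)"
      proof (rule nn_integral_mono)
        fix q assume q: "q \<in> space M"
        have lin: "linear (h' (w + r *\<^sub>R v) q)"
          using der[OF wr q] by (rule has_derivative_linear)
        have "h' (w + r *\<^sub>R v) q v = h' (w + r *\<^sub>R v) q (\<Sum>b\<in>Basis. (v \<bullet> b) *\<^sub>R b)"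
          by (simp add: euclidean_representation)
        also have "\<dots> = (\<Sum>b\<in>Basis. (v \<bullet> b) * h' (w + r *\<^sub>R v) q b)"
          by (simp add: linear_sum[OF lin] linear_cmul[OF lin])
        finally have "\<bar>h' (w + r *\<^sub>R v) q v\<bar> \<le> (\<Sum>b\<in>Basis. \<bar>v \<bullet> b\<bar> * \<bar>h' (w + r *\<^sub>R v) q b\<bar>)"
          using sum_abs[of "\<lambda>b. (v \<bullet> b) * h' (w + r *\<^sub>R v) q b" Basis] by (simp add: abs_mult)
        then have "ennreal (k r q) \<le> ennreal (\<Sum>b\<in>Basis. \<bar>v \<bullet> b\<bar> * \<bar>h' (w + r *\<^sub>R v) q b\<bar>)"
          using True T01 by (intro ennreal_leI) (auto simp: k_def)
        then show "ennreal (k r q) \<le> (\<Sum>b\<in>Basis. ennreal \<bar>v \<bullet> b\<bar> * ennreal \<bar>h' (w + r *\<^sub>R v) q b\<bar>)"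
          by (simp add: ennreal_mult' sum_ennreal[symmetric] del: sum_ennreal)
      qed
      also have "\<dots> = (\<Sum>b\<in>Basis. ennreal \<bar>v \<bullet> b\<bar> * (\<integral>\<^sup>+q. ennreal \<bar>h' (w + r *\<^sub>R v) q b\<bar> \<partial>M))"
        using meas[OF wr] by (subst nn_integral_sum) (auto simp: nn_integral_cmult)
      also have "\<dots> \<le> (\<Sum>b\<in>Basis. ennreal \<bar>v \<bullet> b\<bar> * ennreal C)"
        by (intro sum_mono mult_left_mono bnd[OF wr]) auto
      also have "\<dots> = ennreal (C * (\<Sum>b\<in>Basis. \<bar>v \<bullet> b\<bar>))"
        using C by (simp add: ennreal_mult'[symmetric] sum_distrib_left mult.commute)
      finally show ?thesis using True by simp
    qed (simp add: k_def)
  qed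
  also have "\<dots> = ennreal (C * (\<Sum>b\<in>Basis. \<bar>v \<bullet> b\<bar>))"
    by (simp add: nn_integral_cmult)
  finally show ?thesis by (simp add: v_def)
qed

lemma integral_difference_le:
  fixes h :: "'b::euclidean_space \<Rightarrow> 'a \<Rightarrow> real"
  assumes "open S"
    and der: "\<And>w q. w \<in> S \<Longrightarrow> q \<in> space M \<Longrightarrow> ((\<lambda>w. h w q) has_derivative h' w q) (at w)"
    and cont: "\<And>q v. q \<in> space M \<Longrightarrow> continuous_on S (\<lambda>w. h' w q v)"
    and int: "\<And>w. w \<in> S \<Longrightarrow> integrable M (h w)"
    and int': "\<And>w v. w \<in> S \<Longrightarrow> integrable M (\<lambda>q. h' w q v)"
    and bnd: "\<And>w b. w \<in> S \<Longrightarrow> b \<in> Basis \<Longrightarrow> (LINT q|M. \<bar>h' w q b\<bar>) \<le> C"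
    and C: "C \<ge> 0" and seg: "closed_segment w w' \<subseteq> S"
  shows "(LINT q|M. \<bar>h w' q - h w q\<bar>) \<le> C * (\<Sum>b\<in>Basis. \<bar>(w' - w) \<bullet> b\<bar>)"
proof -
  have w: "w \<in> S" "w' \<in> S" using seg by auto
  have "ennreal (LINT q|M. \<bar>h w' q - h w q\<bar>) = (\<integral>\<^sup>+q. ennreal \<bar>h w' q - h w q\<bar> \<partial>M)"
    using int w by (intro nn_integral_eq_integral[symmetric]) auto
  also have "\<dots> \<le> ennreal (C * (\<Sum>b\<in>Basis. \<bar>(w' - w) \<bullet> b\<bar>))"
  proof (rule nn_integral_difference_le[OF \<open>open S\<close> der cont _ _ C seg])
    show "(\<integral>\<^sup>+q. ennreal \<bar>h' w q b\<bar> \<partial>M) \<le> ennreal C" if "w \<in> S" "b \<in> Basis" for w b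
      using bnd[OF that] int'[OF that(1), of b] by (subst nn_integral_eq_integral) (auto intro: ennreal_leI)
  qed (use int' in auto)
  finally show ?thesis
    using C by (subst (asm) ennreal_le_iff) (auto intro!: mult_nonneg_nonneg sum_nonneg)
qed

text \<open>A derivative bounded in mean near \<open>w\<close> makes \<open>h\<close> Lipschitz as a
  map into L1. This is how bounds on words of one more letter yield continuity.\<close>

lemma L1_cont_if_bounded_derivative:
  fixes h :: "'b::euclidean_space \<Rightarrow> 'a \<Rightarrow> real"
  assumes "open S" "w \<in> S"
    and der: "\<And>w q. w \<in> S \<Longrightarrow> q \<in> space M \<Longrightarrow> ((\<lambda>w. h w q) has_derivative h' w q) (at w)"
    and cont: "\<And>q v. q \<in> space M \<Longrightarrow> continuous_on S (\<lambda>w. h' w q v)"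
    and int: "\<And>w. w \<in> S \<Longrightarrow> integrable M (h w)"
    and int': "\<And>w v. w \<in> S \<Longrightarrow> integrable M (\<lambda>q. h' w q v)"
    and bnd: "\<And>w b. w \<in> S \<Longrightarrow> b \<in> Basis \<Longrightarrow> (LINT q|M. \<bar>h' w q b\<bar>) \<le> C"
    and C: "C \<ge> 0"
  shows "L1_cont M h w"
  unfolding L1_cont_def
proof
  have ev: "\<forall>\<^sub>F w' in nhds w. w' \<in> S"
    using assms(1,2) by (rule eventually_nhds_in_open)
  then show "\<forall>\<^sub>F w' in nhds w. integrable M (h w')"
    by (rule eventually_mono) (rule int)
  obtain e where e: "e > 0" "ball w e \<subseteq> S"
    using assms(1,2) by (meson openE)
  have "((\<lambda>w'. C * (\<Sum>b\<in>Basis. \<bar>(w' - w) \<bullet> b\<bar>)) \<longlongrightarrow> C * (\<Sum>b\<in>Basis. \<bar>(w - w) \<bullet> b\<bar>)) (nhds w)"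
    by (intro tendsto_intros filterlim_ident)
  then have lim: "((\<lambda>w'. C * (\<Sum>b\<in>Basis. \<bar>(w' - w) \<bullet> b\<bar>)) \<longlongrightarrow> 0) (nhds w)" by simp
  show "((\<lambda>w'. LINT q|M. \<bar>h w' q - h w q\<bar>) \<longlongrightarrow> 0) (nhds w)"
  proof (rule tendsto_sandwich[OF _ _ tendsto_const lim])
    have "\<forall>\<^sub>F w' in nhds w. w' \<in> ball w e"
      using e by (intro eventually_nhds_in_open) auto
    then show "\<forall>\<^sub>F w' in nhds w. (LINT q|M. \<bar>h w' q - h w q\<bar>) \<le> C * (\<Sum>b\<in>Basis. \<bar>(w' - w) \<bullet> b\<bar>)"
    proof eventually_elim
      case (elim w')
      have "closed_segment w w' \<subseteq> S"
        using closed_segment_subset[of w "ball w e" w'] elim e by auto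
      then show ?case
        by (intro integral_difference_le[OF \<open>open S\<close> der cont int int' bnd C])
    qed
  qed simp
qed

text \<open>The mean difference estimate is applied to the remainder
  \<open>h y q - h' w q y\<close>, whose derivative in \<open>y\<close> is the increment of
  \<open>h'\<close> from \<open>w\<close>. On a small ball this increment is small in mean by L1
  continuity, which is the definition of the derivative of the integral.\<close>

lemma has_derivative_integral:
  fixes h :: "'b::euclidean_space \<Rightarrow> 'a \<Rightarrow> real"
  assumes "open S" "w \<in> S"
    and der: "\<And>w q. w \<in> S \<Longrightarrow> q \<in> space M \<Longrightarrow> ((\<lambda>w. h w q) has_derivative h' w q) (at w)"
    and cont: "\<And>q v. q \<in> space M \<Longrightarrow> continuous_on S (\<lambda>w. h' w q v)"
    and int: "\<And>w. w \<in> S \<Longrightarrow> integrable M (h w)"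
    and int': "\<And>w v. w \<in> S \<Longrightarrow> integrable M (\<lambda>q. h' w q v)"
    and L1: "\<And>b. b \<in> Basis \<Longrightarrow> L1_cont M (\<lambda>w q. h' w q b) w"
  shows "((\<lambda>w. LINT q|M. h w q) has_derivative (\<lambda>v. LINT q|M. h' w q v)) (at w)"
proof -
  let ?A = "\<lambda>v. LINT q|M. h' w q v"
  have linq: "linear (h' w q)" if "q \<in> space M" for q
    using der[OF \<open>w \<in> S\<close> that] by (rule has_derivative_linear)
  have "linear ?A"
  proof
    show "?A (x + y) = ?A x + ?A y" for x y
    proof -
      have "?A (x + y) = (LINT q|M. h' w q x + h' w q y)"
        using linq by (intro Bochner_Integration.integral_cong) (auto simp: linear_add)
      then show ?thesis using int'[OF \<open>w \<in> S\<close>] by simp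
    qed
    show "?A (r *\<^sub>R x) = r *\<^sub>R ?A x" for r x
    proof -
      have "?A (r *\<^sub>R x) = (LINT q|M. r * h' w q x)"
        using linq by (intro Bochner_Integration.integral_cong) (auto simp: linear_cmul)
      then show ?thesis by simp
    qed
  qed
  then have bl: "bounded_linear ?A" by (simp add: linear_conv_bounded_linear)
  show ?thesis
    unfolding has_derivative_at_alt
  proof (intro conjI bl allI impI)
    fix e :: real assume e: "e > 0"
    \<comment> \<open>The difference estimate produces a sum of coordinates of \<open>y - w\<close>,
      at most the dimension times its norm.\<close>
    define \<epsilon> where "\<epsilon> = e / real DIM('b)"
    have \<epsilon>: "\<epsilon> > 0" using e by (simp add: \<epsilon>_def)
    have "\<forall>\<^sub>F w' in nhds w. \<forall>b\<in>Basis. (LINT q|M. \<bar>h' w' q b - h' w q b\<bar>) < \<epsilon>"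
      using order_tendstoD(2)[OF conjunct2[OF L1[unfolded L1_cont_def]] \<epsilon>]
      by (simp add: eventually_ball_finite_distrib)
    moreover have "\<forall>\<^sub>F w' in nhds w. w' \<in> S"
      using assms(1,2) by (rule eventually_nhds_in_open)
    ultimately have "\<forall>\<^sub>F w' in nhds w. w' \<in> S \<and> (\<forall>b\<in>Basis. (LINT q|M. \<bar>h' w' q b - h' w q b\<bar>) < \<epsilon>)"
      by eventually_elim auto
    then obtain d where d: "d > 0" "\<And>w'. dist w' w < d \<Longrightarrow>
        w' \<in> S \<and> (\<forall>b\<in>Basis. (LINT q|M. \<bar>h' w' q b - h' w q b\<bar>) < \<epsilon>)"
      by (auto simp: eventually_nhds_metric)
    show "\<exists>d>0. \<forall>y. norm (y - w) < d \<longrightarrow>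
        norm ((LINT q|M. h y q) - (LINT q|M. h w q) - ?A (y - w)) \<le> e * norm (y - w)"
    proof (intro exI[of _ d] conjI allI impI \<open>d > 0\<close>)
      fix y assume y: "norm (y - w) < d"
      have sub: "ball w d \<subseteq> S" using d(2) by (auto simp: dist_commute)
      have yS: "y \<in> S" using y d(2) by (simp add: dist_norm)
      have seg: "closed_segment w y \<subseteq> ball w d"
        by (rule closed_segment_subset) (use y d in \<open>auto simp: dist_norm norm_minus_commute\<close>)
      let ?k = "\<lambda>y q. h y q - h' w q y"
      have "(LINT q|M. \<bar>?k y q - ?k w q\<bar>) \<le> \<epsilon> * (\<Sum>b\<in>Basis. \<bar>(y - w) \<bullet> b\<bar>)"
      proof (rule integral_difference_le[where h' = "\<lambda>y q v. h' y q v - h' w q v", OF open_ball _ _ _ _ _ _ seg])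
        show "((\<lambda>y. ?k y q) has_derivative (\<lambda>v. h' y q v - h' w q v)) (at y)"
          if "y \<in> ball w d" "q \<in> space M" for y q
          using that sub \<open>w \<in> S\<close>
          by (intro has_derivative_diff der bounded_linear_imp_has_derivative has_derivative_bounded_linear[OF der]) auto
        show "continuous_on (ball w d) (\<lambda>y. h' y q v - h' w q v)" if "q \<in> space M" for q v
          using cont[OF that] sub by (intro continuous_intros) (auto intro: continuous_on_subset)
        show "(LINT q|M. \<bar>h' w' q b - h' w q b\<bar>) \<le> \<epsilon>" if "w' \<in> ball w d" "b \<in> Basis" for w' b
          using d(2)[of w'] that by (auto simp: dist_commute less_imp_le)
      qed (use sub int int' \<open>w \<in> S\<close> \<epsilon> in auto)
      also have "\<dots> \<le> \<epsilon> * (\<Sum>b\<in>(Basis::'b set). norm (y - w))"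
        using \<epsilon> by (intro mult_left_mono sum_mono Basis_le_norm) auto
      also have "\<dots> = e * norm (y - w)" by (simp add: \<epsilon>_def)
      finally have b: "(LINT q|M. \<bar>?k y q - ?k w q\<bar>) \<le> e * norm (y - w)" .
      have "(LINT q|M. h y q) - (LINT q|M. h w q) - ?A (y - w) = (LINT q|M. ?k y q - ?k w q)"
        using int int' yS \<open>w \<in> S\<close> linear_diff[OF \<open>linear ?A\<close>, of y w] by simp
      then show "norm ((LINT q|M. h y q) - (LINT q|M. h w q) - ?A (y - w)) \<le> e * norm (y - w)"
        using order_trans[OF integral_norm_bound[of M "\<lambda>q. ?k y q - ?k w q", unfolded real_norm_def] b] by simp
    qed
  qed
qed

end

section \<open>Smooth bump functions\<close>

text \<open>Differentiating P(1/t) exp(-1/t) gives t^(-2) (P - P')(1/t) exp(-1/t); the factor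
  \<open>[:0, 0, 1:]\<close> is t^(-2) as a polynomial in 1/t.\<close>

primrec bump_poly :: "nat \<Rightarrow> real poly" where
  "bump_poly 0 = 1"
| "bump_poly (Suc j) = [:0, 0, 1:] * (bump_poly j - pderiv (bump_poly j))"

text \<open>The \<open>j\<close>-th derivative of the function equal to \<open>exp (- 1 / t)\<close> for \<open>t > 0\<close> and to \<open>0\<close> otherwise.\<close>

definition bump_deriv :: "nat \<Rightarrow> real \<Rightarrow> real" where
  "bump_deriv j t = (if t > 0 then poly (bump_poly j) (inverse t) * exp (- inverse t) else 0)"

lemma poly_times_exp_tendsto_0: "((\<lambda>s::real. poly p s * exp (- s)) \<longlongrightarrow> 0) at_top"
proof -
  have "((\<lambda>s. coeff p i * s ^ i * exp (- s)) \<longlongrightarrow> 0) at_top" for i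
    using tendsto_mult_right_zero[OF tendsto_power_div_exp_0[of i], of "coeff p i"]
    by (simp add: exp_minus divide_inverse mult.assoc)
  then have "((\<lambda>s. \<Sum>i\<le>degree p. coeff p i * s ^ i * exp (- s)) \<longlongrightarrow> 0) at_top"
    by (intro tendsto_null_sum) auto
  then show ?thesis by (simp add: poly_altdef sum_distrib_right)
qed

lemma bump_deriv_has_derivative: "(bump_deriv j has_real_derivative bump_deriv (Suc j) t) (at t)"
proof -
  consider "t > 0" | "t < 0" | "t = 0" by linarith
  then show ?thesis
  proof cases
    case 1
    have "((\<lambda>t. poly (bump_poly j) (inverse t) * exp (- inverse t)) has_real_derivative
        bump_deriv (Suc j) t) (at t)"
      using 1 by (auto intro!: derivative_eq_intros DERIV_chain2[OF poly_DERIV]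
          simp: bump_deriv_def algebra_simps power2_eq_square)
    then show ?thesis
      by (rule has_field_derivative_transform_within_open[of _ _ _ "{0<..}"])
         (use 1 in \<open>auto simp: bump_deriv_def\<close>)
  next
    case 2
    have "((\<lambda>t. 0) has_real_derivative bump_deriv (Suc j) t) (at t)"
      using 2 by (auto simp: bump_deriv_def)
    then show ?thesis
      by (rule has_field_derivative_transform_within_open[of _ _ _ "{..<0}"])
         (use 2 in \<open>auto simp: bump_deriv_def\<close>)
  next
    \<comment> \<open>At 0 the right difference quotient is s P(s) exp(-s) at s = 1/h, which tends
      to 0; \<open>pCons 0\<close> is the multiplication by s. The left quotient is identically
      0.\<close>
    case 3
    have "((\<lambda>h. poly (pCons 0 (bump_poly j)) (inverse h) * exp (- inverse h)) \<longlongrightarrow> 0) (at_right 0)"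
      by (rule filterlim_compose[OF poly_times_exp_tendsto_0 filterlim_inverse_at_top_right])
    then have "((\<lambda>h. (bump_deriv j (0 + h) - bump_deriv j 0) / h) \<longlongrightarrow> 0) (at_right 0)"
      by (rule Lim_transform_eventually)
         (auto simp: bump_deriv_def divide_inverse eventually_at_filter)
    moreover have "((\<lambda>h. (bump_deriv j (0 + h) - bump_deriv j 0) / h) \<longlongrightarrow> 0) (at_left 0)"
      by (rule Lim_transform_eventually[OF tendsto_const])
         (auto simp: bump_deriv_def eventually_at_filter)
    ultimately have "(bump_deriv j has_real_derivative 0) (at 0)"
      by (simp add: DERIV_def filterlim_split_at)
    then show ?thesis using 3 by (simp add: bump_deriv_def)
  qed
qed

lemma Ck_on_ident: "open S \<Longrightarrow> Ck_on k S (\<lambda>x. x)"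
  by (cases k) (auto intro!: Ck_on_SucI[where f' = "\<lambda>_ v. v"] Ck_on_const simp del: Ck_on.simps(2))

text \<open>The function is exp(-1/(r^2 - |w - c|^2)) inside the ball. The squared distance is used
  because it is bilinear, hence smooth also at the centre.\<close>

lemma exists_bump:
  fixes c :: "'a::euclidean_space"
  assumes "r > 0"
  obtains \<phi> where "smooth_on UNIV \<phi>" "\<And>w. 0 \<le> \<phi> w" "\<phi> c > (0::real)" "\<And>w. w \<notin> ball c r \<Longrightarrow> \<phi> w = 0"
proof
  define \<phi> where "\<phi> w = bump_deriv 0 (r\<^sup>2 + (- ((w - c) \<bullet> (w - c))))" for w
  show "smooth_on UNIV \<phi>"
    unfolding smooth_on_def \<phi>_def
  proof
    fix k
    have c: "Ck_on k UNIV (\<lambda>w. w + (- c))"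
      by (intro Ck_on_add Ck_on_ident Ck_on_const) auto
    have "Ck_on k UNIV (\<lambda>w. (w + (- c)) \<bullet> (w + (- c)))"
      by (rule Ck_on_bilinear[OF bounded_bilinear_inner open_UNIV c c])
    from Ck_on_add[OF open_UNIV Ck_on_const[OF open_UNIV]
        Ck_on_bounded_linear[OF bounded_linear_minus[OF bounded_linear_ident] open_UNIV this], of "r\<^sup>2"]
    have "Ck_on k UNIV (\<lambda>w. r\<^sup>2 + (- ((w - c) \<bullet> (w - c))))" by simp
    from Ck_on_compose_real[where \<phi> = bump_deriv and j = 0 and T = UNIV,
        OF bump_deriv_has_derivative open_UNIV UNIV_I this]
    show "Ck_on k UNIV (\<lambda>w. bump_deriv 0 (r\<^sup>2 + (- ((w - c) \<bullet> (w - c)))))" .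
  qed
  show "0 \<le> \<phi> w" for w by (simp add: \<phi>_def bump_deriv_def)
  show "\<phi> c > 0" using assms by (simp add: \<phi>_def bump_deriv_def)
  show "\<phi> w = 0" if "w \<notin> ball c r" for w
  proof -
    have "r\<^sup>2 \<le> (dist c w)\<^sup>2" using that assms by (intro power_mono) auto
    then have "r\<^sup>2 \<le> (w - c) \<bullet> (w - c)"
      by (simp add: dist_norm norm_minus_commute flip: power2_norm_eq_inner)
    then show ?thesis by (simp add: \<phi>_def bump_deriv_def)
  qed
qed

section \<open>The heat equation holds pointwise\<close>

lemma lborel_integral_translation:
  fixes f :: "'a::euclidean_space \<Rightarrow> real"
  assumes "f \<in> borel_measurable borel"
  shows "(LBINT w. f (w + c)) = (LBINT w. f w)" 
proof -
  have "(LBINT w. f w) = (LINT w|distr lborel borel ((+) c). f w)"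
    by (simp add: lborel_distr_plus)
  also have "\<dots> = (LBINT w. f (c + w))"
    by (rule integral_distr) (use assms in auto)
  finally show ?thesis by (simp add: add.commute)
qed

text \<open>Difference quotients have integral 0 by translation invariance of Lebesgue measure, and
  they converge to the derivative under a common bound with common compact support. This takes the
  place of the divergence theorem.\<close>

lemma integral_directional_derivative_eq_0:
  fixes f :: "'a::euclidean_space \<Rightarrow> real"
  assumes f: "Ck_on 1 UNIV f" and K: "compact K" "\<And>w. w \<notin> K \<Longrightarrow> f w = 0"
  shows "(LBINT w. FD f w b) = 0"
proof -
  let ?g = "\<lambda>w. FD f w b"
  have diff: "f differentiable (at w)" for w using f by auto
  have contg: "continuous_on UNIV ?g" and contf: "continuous_on UNIV f"
    using f Ck_on_imp_continuous_on[OF f] by auto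
  obtain R where R: "R > 0" "K \<subseteq> cball 0 R"
    using K(1) compact_imp_bounded bounded_pos by (metis mem_cball_0 subsetI)
  \<comment> \<open>Steps are at most 1, so all difference quotients are supported in the ball of
    radius \<open>R'\<close>. The intermediate points of the mean value theorem may lie another
    \<open>norm b\<close> further out, hence the larger ball on which \<open>B\<close> bounds the
    derivative.\<close>
  define R' where "R' = R + norm b"
  have "bounded (?g ` cball 0 (R' + norm b))"
    using contg by (intro compact_imp_bounded compact_continuous_image) (auto intro: continuous_on_subset)
  then obtain B where B: "\<And>w. w \<in> cball 0 (R' + norm b) \<Longrightarrow> \<bar>?g w\<bar> \<le> B"
    unfolding bounded_iff real_norm_def by blast
  define h where "h k = inverse (real (Suc k))" for k
  have h: "0 < h k" "h k \<le> 1" for k by (auto simp: h_def inverse_le_1_iff)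
  have h0: "h \<longlonglongrightarrow> 0" unfolding h_def by (rule LIMSEQ_inverse_real_of_nat)
  define q where "q k w = (f (w + h k *\<^sub>R b) - f w) / h k" for k w
  have fint: "integrable lborel f"
  proof -
    have "integrable lborel (\<lambda>w. indicator (cball 0 R) w *\<^sub>R f w)"
      by (intro borel_integrable_compact) (auto intro: continuous_on_subset[OF contf])
    moreover have "(\<lambda>w. indicator (cball 0 R) w *\<^sub>R f w) = f"
      using K(2) subsetD[OF R(2)] by (fastforce simp: indicator_def)
    ultimately show ?thesis by simp
  qed
  have fm: "f \<in> borel_measurable borel" using contf by (rule borel_measurable_continuous_onI)
  have qm: "q k \<in> borel_measurable lborel" for k
    unfolding q_def using fm by measurable
  have q0: "(LBINT w. q k w) = 0" for k
  proof -
    have "integrable (distr lborel borel ((+) (h k *\<^sub>R b))) f"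
      using fint by (simp add: lborel_distr_plus)
    then have "integrable lborel (\<lambda>w. f (w + h k *\<^sub>R b))"
      by (subst (asm) integrable_distr_eq) (use fm in \<open>auto simp: add.commute\<close>)
    then show ?thesis
      using fint lborel_integral_translation[OF fm] by (simp add: q_def)
  qed
  have "(\<lambda>k. LBINT w. q k w) \<longlonglongrightarrow> (LBINT w. ?g w)"
  proof (rule integral_dominated_convergence[where w = "\<lambda>w. B * indicator (cball 0 R') w"])
    show "?g \<in> borel_measurable lborel"
      using borel_measurable_continuous_onI[OF contg] by simp
    show "integrable lborel (\<lambda>w. B * indicator (cball 0 R') w)"
      by (intro integrable_mult_right integrable_real_indicator) (use emeasure_lborel_cball_finite[of 0 R'] in auto)
    show "AE w in lborel. (\<lambda>k. q k w) \<longlonglongrightarrow> ?g w"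
    proof (rule AE_I2)
      fix w
      have "((\<lambda>s. (f (w + (0 + s) *\<^sub>R b) - f (w + 0 *\<^sub>R b)) / s) \<longlongrightarrow> ?g (w + 0 *\<^sub>R b)) (at 0)"
        using directional_DERIV[OF diff, where y = w and r = 0 and v = b] by (simp add: DERIV_def)
      moreover have "filterlim h (at 0) sequentially"
        using h0 h(1) by (auto simp: filterlim_at less_imp_neq[symmetric])
      ultimately show "(\<lambda>k. q k w) \<longlonglongrightarrow> ?g w"
        unfolding q_def by (auto dest: filterlim_compose)
    qed
    show "AE w in lborel. norm (q k w) \<le> B * indicator (cball 0 R') w" for k
    proof (rule AE_I2)
      fix w
      show "norm (q k w) \<le> B * indicator (cball 0 R') w"
      proof (cases "w \<in> cball 0 R'")
        case True
        obtain z where z: "0 < z" "z < h k"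
          "f (w + h k *\<^sub>R b) - f (w + 0 *\<^sub>R b) = (h k - 0) * ?g (w + z *\<^sub>R b)"
          using MVT2[where f = "\<lambda>r. f (w + r *\<^sub>R b)" and f' = "\<lambda>r. ?g (w + r *\<^sub>R b)", OF h(1) directional_DERIV[OF diff]]
          by blast
        have "norm (w + z *\<^sub>R b) \<le> norm w + \<bar>z\<bar> * norm b"
          by (metis norm_triangle_ineq norm_scaleR)
        also have "\<dots> \<le> R' + 1 * norm b"
          using True z h(2)[of k] by (intro add_mono mult_right_mono) auto
        finally have "\<bar>?g (w + z *\<^sub>R b)\<bar> \<le> B" by (intro B) simp
        moreover have "q k w = ?g (w + z *\<^sub>R b)"
          using z h(1)[of k] by (simp add: q_def)
        ultimately show ?thesis using True by simp
      next
        case False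
        have "norm w \<le> norm (w + h k *\<^sub>R b) + norm (h k *\<^sub>R b)"
          using norm_triangle_ineq4[of "w + h k *\<^sub>R b" "h k *\<^sub>R b"] by simp
        moreover have "norm (h k *\<^sub>R b) \<le> norm b"
          using h[of k] by (simp add: mult_left_le_one_le)
        ultimately have "w \<notin> K" "w + h k *\<^sub>R b \<notin> K"
          using False subsetD[OF R(2), of w] subsetD[OF R(2), of "w + h k *\<^sub>R b"] norm_ge_zero[of b]
          by (auto simp: R'_def)
        then show ?thesis using K False by (simp add: q_def)
      qed
    qed
  qed (rule qm)
  then have "(\<lambda>k. 0 :: real) \<longlonglongrightarrow> (LBINT w. ?g w)" by (simp only: q0)
  then show ?thesis by (simp add: LIMSEQ_const_iff)
qed

lemma Ck_on_Un:
  assumes "open S" "open T"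
  shows "Ck_on k S f \<Longrightarrow> Ck_on k T f \<Longrightarrow> Ck_on k (S \<union> T) f"
  by (induction k arbitrary: f) (auto intro: continuous_on_open_Un assms)

lemma Ck_on_UNIV_if_compact_support:
  assumes "Ck_on k S f" "open S" "compact K" "K \<subseteq> S" "\<And>w. w \<notin> K \<Longrightarrow> f w = 0"
  shows "Ck_on k UNIV f"
proof -
  have "open (- K)" using assms(3) compact_imp_closed by blast
  then have "Ck_on k (- K) f"
    by (rule Ck_on_cong[of _ "\<lambda>_. 0"]) (auto simp: assms(5) \<open>open (- K)\<close> intro: Ck_on_const)
  then have "Ck_on k (S \<union> - K) f"
    using assms(1,2) \<open>open (- K)\<close> by (intro Ck_on_Un)
  moreover have "S \<union> - K = UNIV" using assms(4) by auto
  ultimately show ?thesis by simp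
qed

section \<open>Slices of space-time functions and the divergence form\<close>

lemma frechet_derivative_slice_fst:
  assumes "g differentiable (at (x, t))"
  shows "((\<lambda>y. g (y, t)) has_derivative (\<lambda>v. FD g (x, t) (v, 0))) (at x)"
proof -
  have "((\<lambda>y. (y, t)) has_derivative (\<lambda>v. (v, 0))) (at x)"
    by (auto intro!: derivative_eq_intros)
  from has_derivative_compose[OF this has_derivative_frechet[OF assms]] show ?thesis .
qed

lemma frechet_derivative_slice_snd:
  fixes g :: "'a::real_normed_vector \<times> real \<Rightarrow> real"
  assumes "g differentiable (at (x, t))"
  shows "((\<lambda>s. g (x, s)) has_real_derivative FD g (x, t) (0, 1)) (at t)"
proof -
  have "((\<lambda>s. (x, s)) has_derivative (\<lambda>s. (0, s))) (at t)"
    by (auto intro!: derivative_eq_intros)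
  from has_derivative_compose[OF this has_derivative_frechet[OF assms]]
  have "((\<lambda>s. g (x, s)) has_derivative (\<lambda>s. FD g (x, t) (0, s))) (at t)" .
  moreover have "(\<lambda>s. FD g (x, t) (0, s)) = (*) (FD g (x, t) (0, 1))"
  proof
    show "FD g (x, t) (0, s) = FD g (x, t) (0, 1) * s" for s
      using linear_cmul[OF linear_frechet_derivative[OF assms], of s "(0, 1)"] by (simp add: mult.commute)
  qed
  ultimately show ?thesis by (simp add: has_field_derivative_def)
qed

text \<open>The component along \<open>b\<close> of the field \<open>(V g) V\<close>, with
  \<open>V\<close> acting in the space variable. Since the two signs in the sub-Laplacian cancel, it
  is the sum over \<open>i\<close> of the spatial divergence of these fluxes; treating them as
  functions of space and time permits integration by parts in all variables together.\<close>

definition horizontal_flux ::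
  "('a::euclidean_space \<Rightarrow> 'a) \<Rightarrow> ('a \<times> real \<Rightarrow> real) \<Rightarrow> 'a \<Rightarrow> 'a \<times> real \<Rightarrow> real" where
  "horizontal_flux V g b w = (V (fst w) \<bullet> b) * FD g w (V (fst w), 0)"

lemma horizontal_flux_Ck:
  fixes V :: "'a::euclidean_space \<Rightarrow> 'a"
  assumes "smooth_on UNIV V" "open T" "Ck_on (Suc k) (UNIV \<times> T) g"
  shows "Ck_on k (UNIV \<times> T) (horizontal_flux V g b)"
proof -
  have o: "open (UNIV \<times> T :: ('a \<times> real) set)" using assms(2) by (simp add: open_Times)
  have V: "Ck_on k (UNIV \<times> T) (\<lambda>w. V (fst w))"
    by (rule Ck_on_fst[OF smooth_on_imp_Ck_on[OF assms(1)]]) (use assms in auto)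
  have V': "Ck_on k (UNIV \<times> T) (\<lambda>w. (V (fst w), 0::real))"
    using Ck_on_bounded_linear[OF bounded_linear_Pair[OF bounded_linear_ident bounded_linear_zero] o V] .
  show ?thesis
    unfolding horizontal_flux_def
    by (intro Ck_on_mult o Ck_on_inner_left V Ck_on_directional[OF o assms(3) V'])
qed

lemma sub_laplacian_slice:
  fixes X :: "nat \<Rightarrow> 'a::euclidean_space \<Rightarrow> 'a"
  assumes X: "\<And>i. i \<in> {1..m} \<Longrightarrow> smooth_on UNIV (X i)" and T: "open T" "t \<in> T"
    and g: "Ck_on 2 (UNIV \<times> T) g"
  shows "sub_laplacian m X (\<lambda>y. g (y, t)) x =
    (\<Sum>i=1..m. \<Sum>b\<in>Basis. FD (horizontal_flux (X i) g b) (x, t) (b, 0))"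
proof -
  have g': "g differentiable (at (y, t))" for y
    using g T by (auto simp: numeral_2_eq_2)
  have "partial b (\<lambda>y. (X i y \<bullet> b) * vf_apply (X i) (\<lambda>y. g (y, t)) y) x =
      FD (horizontal_flux (X i) g b) (x, t) (b, 0)" if i: "i \<in> {1..m}" for i b
  proof -
    have "vf_apply (X i) (\<lambda>y. g (y, t)) y = FD g (y, t) (X i y, 0)" for y
      using frechet_derivative_at[OF frechet_derivative_slice_fst[OF g'], symmetric]
      by (simp add: vf_apply_def)
    then have eq: "(\<lambda>y. (X i y \<bullet> b) * vf_apply (X i) (\<lambda>y. g (y, t)) y) = (\<lambda>y. horizontal_flux (X i) g b (y, t))"
      by (simp add: horizontal_flux_def)
    have "Ck_on (Suc 0) (UNIV \<times> T) (horizontal_flux (X i) g b)"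
      using horizontal_flux_Ck[OF X[OF i] T(1), of 1 g b] g by (simp add: numeral_2_eq_2)
    then have "horizontal_flux (X i) g b differentiable (at (x, t))"
      using T by auto
    from frechet_derivative_at[OF frechet_derivative_slice_fst[OF this], symmetric]
    show ?thesis unfolding partial_def eq by (simp add: vf_apply_def)
  qed
  then show ?thesis
    unfolding sub_laplacian_def formal_adjoint_def sum_negf by simp
qed

text \<open>The fundamental lemma of the calculus of variations: where \<open>h\<close> keeps the
  sign of \<open>h w0\<close>, a bump function would give a nonnegative integrand with zero integral
  that is positive on a nonempty open set.\<close>

lemma open_continuous_integral_zero:
  fixes h :: "'a::euclidean_space \<Rightarrow> real"
  assumes O: "open S" "continuous_on S h" "w0 \<in> S"
    and zero: "\<And>\<phi> K. smooth_on UNIV \<phi> \<Longrightarrow> compact K \<Longrightarrow> K \<subseteq> S \<Longrightarrow> (\<And>w. w \<notin> K \<Longrightarrow> \<phi> w = 0) \<Longrightarrow>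
      (LBINT w. \<phi> w * h w) = 0"
  shows "h w0 = 0"
proof (rule ccontr)
  assume ne: "h w0 \<noteq> 0"
  define \<sigma> where "\<sigma> = sgn (h w0)"
  have "open (S \<inter> {w. 0 < \<sigma> * h w})"
  proof -
    have "continuous_on S (\<lambda>w. \<sigma> * h w)" using O by (intro continuous_intros)
    from continuous_open_preimage[OF this \<open>open S\<close> open_greaterThan, of 0]
    show ?thesis by (simp add: vimage_def Collect_conj_eq[symmetric] Int_def)
  qed
  moreover have "w0 \<in> S \<inter> {w. 0 < \<sigma> * h w}" using O ne by (auto simp: \<sigma>_def sgn_if)
  ultimately obtain r where r: "r > 0" "cball w0 r \<subseteq> S \<inter> {w. 0 < \<sigma> * h w}"
    by (meson open_contains_cball)
  obtain \<phi> where \<phi>: "smooth_on UNIV \<phi>" "\<And>w. 0 \<le> \<phi> w" "\<phi> w0 > (0::real)" "\<And>w. w \<notin> ball w0 r \<Longrightarrow> \<phi> w = 0"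
    using exists_bump[OF r(1), of w0] by blast
  have z: "(LBINT w. \<phi> w * h w) = 0"
    by (rule zero[OF \<phi>(1), of "cball w0 r"]) (use r \<phi>(4) in auto)
  have cont\<phi>: "continuous_on UNIV \<phi>" using \<phi>(1) by (intro Ck_on_imp_continuous_on smooth_on_imp_Ck_on)
  have "integrable lborel (\<lambda>w. indicator (cball w0 r) w *\<^sub>R (\<phi> w * (\<sigma> * h w)))"
    using r(2) by (intro borel_integrable_compact continuous_intros continuous_on_subset[OF cont\<phi>]
        continuous_on_subset[OF O(2)]) auto
  moreover have "(\<lambda>w. indicator (cball w0 r) w *\<^sub>R (\<phi> w * (\<sigma> * h w))) = (\<lambda>w. \<phi> w * (\<sigma> * h w))"
    using \<phi>(4) by (auto simp: fun_eq_iff indicator_def)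
  ultimately have int: "integrable lborel (\<lambda>w. \<phi> w * (\<sigma> * h w))" by simp
  have nonneg: "0 \<le> \<phi> w * (\<sigma> * h w)" for w
  proof (cases "w \<in> ball w0 r")
    case True
    then have "w \<in> cball w0 r" by simp
    then have "0 < \<sigma> * h w" using r(2) by blast
    then show ?thesis using \<phi>(2) by simp
  qed (use \<phi>(4) in simp)
  have "(LBINT w. \<phi> w * (\<sigma> * h w)) = 0"
    using z by (simp add: mult.left_commute[of _ \<sigma>])
  then have "AE w in lborel. \<phi> w * (\<sigma> * h w) = 0"
    using integral_nonneg_eq_0_iff_AE[OF int] nonneg by simp
  then have "AE w in lebesgue. \<phi> w * (\<sigma> * h w) = 0" by (rule AE_completion)
  then have "negligible {w. \<phi> w * (\<sigma> * h w) \<noteq> 0}"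
    by (simp add: negligible_iff_null_sets AE_iff_null_sets eventually_ae_filter) (metis (mono_tags, lifting) Collect_mono_iff completion.complete2 mem_Collect_eq)
  moreover have "open (ball w0 r \<inter> {w. 0 < \<phi> w})"
    using cont\<phi> by (intro open_Int open_ball open_Collect_less) auto
  moreover have "ball w0 r \<inter> {w. 0 < \<phi> w} \<subseteq> {w. \<phi> w * (\<sigma> * h w) \<noteq> 0}"
  proof
    fix w assume w: "w \<in> ball w0 r \<inter> {w. 0 < \<phi> w}"
    then have "w \<in> cball w0 r" by simp
    then have "0 < \<sigma> * h w" using r(2) by blast
    then show "w \<in> {w. \<phi> w * (\<sigma> * h w) \<noteq> 0}" using w by auto
  qed
  moreover have "w0 \<in> ball w0 r \<inter> {w. 0 < \<phi> w}" using r(1) \<phi>(3) by simp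
  ultimately show False using open_not_negligible negligible_subset by blast
qed

text \<open>For t > 0 the kernel is smooth, so the distributional equation can be integrated by
  parts back onto it. The pole of the chosen fundamental solution is \<open>(\<xi>, 0)\<close>, out
  of reach of test functions supported in t > 0, and what remains is that the continuous function
  \<open>h\<close>, the heat operator applied to \<open>P\<close>, is orthogonal to all of
  them.\<close>

lemma heat_equation:
  fixes X :: "nat \<Rightarrow> 'a::euclidean_space \<Rightarrow> 'a"
  assumes X: "\<And>i. i \<in> {1..m} \<Longrightarrow> smooth_on UNIV (X i)" and hfs: "heat_fundamental_solution m X p"
    and "t > 0"
  shows "((\<lambda>s. p x \<xi> s) has_real_derivative sub_laplacian m X (\<lambda>y. p y \<xi> t) x) (at t)"
proof -
  define S :: "('a \<times> real) set" where "S = UNIV \<times> {0<..}"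
  have oS: "open S" by (simp add: S_def open_Times)
  define P where "P w = p (fst w) \<xi> (snd w)" for w
  have "smooth_on (UNIV - {(\<xi>, 0)}) (\<lambda>(x, t). p x \<xi> (t - 0))"
    using hfs unfolding heat_fundamental_solution_def by blast
  then have "smooth_on (UNIV - {(\<xi>, 0)}) P"
    by (simp add: P_def[abs_def] case_prod_unfold)
  then have P: "Ck_on k S P" for k
    unfolding smooth_on_def by (auto intro: Ck_on_subset simp: S_def)
  let ?D = "\<lambda>g w v. FD g w v"
  define h where "h w = ?D P w (0, 1) - (\<Sum>i=1..m. \<Sum>b\<in>Basis. ?D (horizontal_flux (X i) P b) w (b, 0))" for w
  have hf: "Ck_on k (UNIV \<times> T) (horizontal_flux (X i) g b)"
    if "i \<in> {1..m}" "Ck_on (Suc k) (UNIV \<times> T) g" "open T" for i b g k T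
    by (rule horizontal_flux_Ck[OF X[OF that(1)] that(3,2)])
  have diffP: "P differentiable (at w)" if "w \<in> S" for w
    using P[of 1] that by auto
  have hfP: "Ck_on k S (horizontal_flux (X i) P b)" if "i \<in> {1..m}" for i b k
    using hf[OF that, of k "{0<..}" P b] P by (simp add: S_def del: Ck_on.simps)
  have conth: "continuous_on S h"
  proof -
    have "continuous_on S (\<lambda>w. ?D P w (0, 1))" using P[of 1] by simp
    moreover have "continuous_on S (\<lambda>w. ?D (horizontal_flux (X i) P b) w (b, 0))" if "i \<in> {1..m}" for i b
      using hfP[OF that, of 1] by simp
    ultimately show ?thesis unfolding h_def by (intro continuous_intros) auto
  qed
  have "h (x, t) = 0"
  proof (rule open_continuous_integral_zero[OF oS conth])
    show "(x, t) \<in> S" using \<open>t > 0\<close> by (simp add: S_def)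
    fix \<phi> :: "'a \<times> real \<Rightarrow> real" and K
    assume \<phi>: "smooth_on UNIV \<phi>" and K: "compact K" "K \<subseteq> S" and supp: "\<And>w. w \<notin> K \<Longrightarrow> \<phi> w = 0"
    have oK: "open (- K)" using K(1) compact_imp_closed by blast
    have \<phi>': "Ck_on k T \<phi>" for k T using \<phi> by (auto simp: smooth_on_def intro: Ck_on_subset)
    have diff\<phi>: "\<phi> differentiable (at w)" for w by (rule Ck_on_imp_differentiable[OF \<phi>' UNIV_I])
    have hf\<phi>: "Ck_on k UNIV (horizontal_flux (X i) \<phi> b)" if "i \<in> {1..m}" for i b k
      using hf[OF that \<phi>' open_UNIV] by simp
    have zeroD: "?D f w v = 0" if "w \<notin> K" "\<And>w. w \<notin> K \<Longrightarrow> f w = 0" for f :: "'a \<times> real \<Rightarrow> real" and w v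
      using frechet_derivative_cong_open(2)[OF oK, of w "\<lambda>_. 0" f] that by simp
    have flux0: "horizontal_flux (X i) \<phi> b w = 0" if "w \<notin> K" for i b w
      using zeroD[OF that supp] by (simp add: horizontal_flux_def)
    have "test_function \<phi>"
    proof -
      have "closure {w. \<phi> w \<noteq> 0} \<subseteq> K"
        using supp K(1) by (intro closure_minimal compact_imp_closed) auto
      then show ?thesis
        using \<phi> bounded_subset[OF compact_imp_bounded[OF K(1)]]
        by (simp add: test_function_def compact_eq_bounded_closed)
    qed
    \<comment> \<open>\<open>K\<close> lies in t > 0, so the Dirac mass contributes nothing.\<close>
    moreover have "(\<xi>, 0) \<notin> K" using K(2) by (auto simp: S_def)
    then have "\<phi> (\<xi>, 0) = 0" by (rule supp)
    moreover have "\<forall>\<xi> \<tau> \<phi>. test_function \<phi> \<longrightarrow>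
        (LBINT w. p (fst w) \<xi> (snd w - \<tau>) * heat_adjoint m X \<phi> w) = \<phi> (\<xi>, \<tau>)"
      using hfs unfolding heat_fundamental_solution_def by (elim conjE)
    ultimately have "(LBINT w. p (fst w) \<xi> (snd w - 0) * heat_adjoint m X \<phi> w) = 0"
      by metis
    then have weak: "(LBINT w. P w * heat_adjoint m X \<phi> w) = 0"
      by (simp add: P_def)
    \<comment> \<open>Green's identity: \<open>\<phi>\<close> times the heat operator of
      \<open>P\<close> differs from \<open>P\<close> times the adjoint operator of
      \<open>\<phi>\<close> by the divergence with time component \<open>G\<close> and with spatial
      components summed from \<open>F\<close>.\<close>
    define F where "F i b w = P w * horizontal_flux (X i) \<phi> b w - \<phi> w * horizontal_flux (X i) P b w" for i b w
    define G where "G w = P w * \<phi> w" for w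
    have GS: "Ck_on 1 S G"
      unfolding G_def by (intro Ck_on_mult oS P \<phi>')
    have G1: "Ck_on 1 UNIV G"
      by (rule Ck_on_UNIV_if_compact_support[OF GS oS K]) (simp add: G_def supp)
    have FS: "Ck_on 1 S (F i b)" if "i \<in> {1..m}" for i b
    proof -
      have "Ck_on 1 S (\<lambda>w. P w * horizontal_flux (X i) \<phi> b w + (- 1) * (\<phi> w * horizontal_flux (X i) P b w))"
        by (intro Ck_on_add Ck_on_mult Ck_on_const oS P \<phi>' hfP that Ck_on_subset[OF hf\<phi>]) auto
      then show ?thesis unfolding F_def by simp
    qed
    have F1: "Ck_on 1 UNIV (F i b)" if "i \<in> {1..m}" for i b
      by (rule Ck_on_UNIV_if_compact_support[OF FS[OF that] oS K]) (simp add: F_def supp flux0)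
    have ptw: "\<phi> w * h w = P w * heat_adjoint m X \<phi> w + ?D G w (0, 1) + (\<Sum>i=1..m. \<Sum>b\<in>Basis. ?D (F i b) w (b, 0))" for w
    proof -
      have "heat_adjoint m X \<phi> w = - ?D \<phi> w (0, 1) - sub_laplacian m X (\<lambda>y. \<phi> (y, snd w)) (fst w)"
        using DERIV_imp_deriv[OF frechet_derivative_slice_snd[of \<phi> "fst w" "snd w"]] diff\<phi>
        by (simp add: heat_adjoint_def case_prod_unfold)
      also have "sub_laplacian m X (\<lambda>y. \<phi> (y, snd w)) (fst w) =
          (\<Sum>i=1..m. \<Sum>b\<in>Basis. ?D (horizontal_flux (X i) \<phi> b) w (b, 0))"
        using sub_laplacian_slice[where X = X and m = m and t = "snd w" and x = "fst w",
            OF X open_UNIV UNIV_I \<phi>'] by simp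
      finally have ha: "heat_adjoint m X \<phi> w = - ?D \<phi> w (0, 1) - (\<Sum>i=1..m. \<Sum>b\<in>Basis. ?D (horizontal_flux (X i) \<phi> b) w (b, 0))" .
      show ?thesis
      proof (cases "w \<in> S")
        \<comment> \<open>For t \<le> 0 the kernel may fail to be differentiable. Off
          \<open>K\<close>, however, \<open>\<phi>\<close> vanishes on an open set, and with it
          \<open>G\<close>, \<open>F\<close> and all derivatives that occur.\<close>
        case False
        then have w: "w \<notin> K" using K by auto
        have "?D G w v = 0" for v by (rule zeroD[OF w]) (simp add: G_def supp)
        moreover have "?D (F i b) w v = 0" for i b v by (rule zeroD[OF w]) (simp add: F_def supp flux0)
        moreover have "?D \<phi> w v = 0" for v by (rule zeroD[OF w supp])
        moreover have "?D (horizontal_flux (X i) \<phi> b) w v = 0" for i b v by (rule zeroD[OF w flux0])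
        ultimately show ?thesis using ha supp[OF w] by simp
      next
        case True
        have DG: "?D G w v = P w * ?D \<phi> w v + ?D P w v * \<phi> w" for v
          using frechet_derivative_at[OF has_derivative_mult[OF has_derivative_frechet[OF diffP[OF True]] has_derivative_frechet[OF diff\<phi>]], symmetric]
          by (simp add: G_def[abs_def])
        have DF: "?D (F i b) w v = P w * ?D (horizontal_flux (X i) \<phi> b) w v + ?D P w v * horizontal_flux (X i) \<phi> b w
            - (\<phi> w * ?D (horizontal_flux (X i) P b) w v + ?D \<phi> w v * horizontal_flux (X i) P b w)"
          if i: "i \<in> {1..m}" for i b v
        proof -
          have d: "horizontal_flux (X i) \<phi> b differentiable (at w)" "horizontal_flux (X i) P b differentiable (at w)"
            by (rule Ck_on_imp_differentiable[OF hf\<phi>[OF i] UNIV_I])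
               (rule Ck_on_imp_differentiable[OF hfP[OF i] True])
          have "(F i b has_derivative (\<lambda>v. (P w * ?D (horizontal_flux (X i) \<phi> b) w v + ?D P w v * horizontal_flux (X i) \<phi> b w)
            - (\<phi> w * ?D (horizontal_flux (X i) P b) w v + ?D \<phi> w v * horizontal_flux (X i) P b w))) (at w)"
            unfolding F_def
            by (intro has_derivative_diff has_derivative_mult has_derivative_frechet d diffP[OF True] diff\<phi>)
          from frechet_derivative_at[OF this, symmetric] show ?thesis by simp
        qed
        \<comment> \<open>The gradient of \<open>g\<close> paired with the flux of \<open>g'\<close>
          is the product of their derivatives along \<open>X i\<close>, symmetric in the two
          functions. So the cross terms in the divergence of \<open>F i\<close> cancel.\<close>
        have lin: "(\<Sum>b\<in>Basis. ?D g w (b, 0) * horizontal_flux (X i) g' b w) =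
            ?D g w (X i (fst w), 0) * ?D g' w (X i (fst w), 0)"
          if "g differentiable (at w)" for g g' :: "'a \<times> real \<Rightarrow> real" and i
        proof -
          have l: "linear (?D g w)" using that by (rule linear_frechet_derivative)
          have l0: "linear (\<lambda>v. ?D g w (v, 0))"
            by (rule linear_compose[of "\<lambda>v. (v, 0)", OF _ l, unfolded o_def])
               (intro bounded_linear.linear bounded_linear_Pair bounded_linear_ident bounded_linear_zero)
          have "?D g w (X i (fst w), 0) = (\<lambda>v. ?D g w (v, 0)) (\<Sum>b\<in>Basis. (X i (fst w) \<bullet> b) *\<^sub>R b)"
            by (simp add: euclidean_representation)
          also have "\<dots> = (\<Sum>b\<in>Basis. (X i (fst w) \<bullet> b) * ?D g w (b, 0))"
            by (simp only: linear_sum[OF l0] linear_cmul[OF l0] real_scaleR_def)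
          finally have *: "?D g w (X i (fst w), 0) = (\<Sum>b\<in>Basis. (X i (fst w) \<bullet> b) * ?D g w (b, 0))" .
          show ?thesis
            unfolding * sum_distrib_right by (simp add: horizontal_flux_def mult_ac)
        qed
        have "(\<Sum>b\<in>Basis. ?D (F i b) w (b, 0)) =
            P w * (\<Sum>b\<in>Basis. ?D (horizontal_flux (X i) \<phi> b) w (b, 0)) - \<phi> w * (\<Sum>b\<in>Basis. ?D (horizontal_flux (X i) P b) w (b, 0))"
          if "i \<in> {1..m}" for i
        proof -
          have "(\<Sum>b\<in>Basis. ?D (F i b) w (b, 0)) =
            P w * (\<Sum>b\<in>Basis. ?D (horizontal_flux (X i) \<phi> b) w (b, 0)) + (\<Sum>b\<in>Basis. ?D P w (b, 0) * horizontal_flux (X i) \<phi> b w)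
            - (\<phi> w * (\<Sum>b\<in>Basis. ?D (horizontal_flux (X i) P b) w (b, 0)) + (\<Sum>b\<in>Basis. ?D \<phi> w (b, 0) * horizontal_flux (X i) P b w))"
            by (simp add: DF[OF that] sum.distrib sum_subtractf sum_distrib_left)
          then show ?thesis
            by (simp only: lin[OF diffP[OF True]] lin[OF diff\<phi>]) (simp add: mult.commute)
        qed
        then have "(\<Sum>i=1..m. \<Sum>b\<in>Basis. ?D (F i b) w (b, 0)) =
            P w * (\<Sum>i=1..m. \<Sum>b\<in>Basis. ?D (horizontal_flux (X i) \<phi> b) w (b, 0)) - \<phi> w * (\<Sum>i=1..m. \<Sum>b\<in>Basis. ?D (horizontal_flux (X i) P b) w (b, 0))"
          by (simp add: sum_subtractf sum_distrib_left)
        then show ?thesis unfolding ha h_def DG by (simp add: algebra_simps)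
      qed
    qed
    have intK: "integrable lborel f" if "continuous_on S f" "\<And>w. w \<notin> K \<Longrightarrow> f w = 0" for f :: "'a \<times> real \<Rightarrow> real"
    proof -
      have "integrable lborel (\<lambda>w. indicator K w *\<^sub>R f w)"
        using K by (intro borel_integrable_compact continuous_on_subset[OF that(1)])
      moreover have "(\<lambda>w. indicator K w *\<^sub>R f w) = f"
        using that(2) by (auto simp: fun_eq_iff indicator_def)
      ultimately show ?thesis by simp
    qed
    have iG: "integrable lborel (\<lambda>w. ?D G w (0, 1))"
      using GS by (intro intK zeroD) (auto simp: G_def supp)
    have iF: "integrable lborel (\<lambda>w. ?D (F i b) w (b, 0))" if "i \<in> {1..m}" for i b
      using FS[OF that, of b] by (intro intK zeroD) (auto simp: F_def supp flux0)
    have iphih: "integrable lborel (\<lambda>w. \<phi> w * h w)"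
      by (intro intK continuous_intros conth Ck_on_imp_continuous_on[OF \<phi>']) (simp add: supp)
    have iF': "integrable lborel (\<lambda>w. \<Sum>i=1..m. \<Sum>b\<in>Basis. ?D (F i b) w (b, 0))"
      using iF by (intro Bochner_Integration.integrable_sum) auto
    have "(\<lambda>w. P w * heat_adjoint m X \<phi> w) = (\<lambda>w. \<phi> w * h w - ?D G w (0, 1) - (\<Sum>i=1..m. \<Sum>b\<in>Basis. ?D (F i b) w (b, 0)))"
      by (auto simp: ptw)
    then have "0 = (LBINT w. \<phi> w * h w - ?D G w (0, 1) - (\<Sum>i=1..m. \<Sum>b\<in>Basis. ?D (F i b) w (b, 0)))"
      using weak by simp
    also have "\<dots> = (LBINT w. \<phi> w * h w) - (LBINT w. ?D G w (0, 1)) -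
        (\<Sum>i=1..m. \<Sum>b\<in>Basis. LBINT w. ?D (F i b) w (b, 0))"
      using iG iF iF' iphih by (simp add: Bochner_Integration.integral_sum Bochner_Integration.integrable_sum)
    also have "(LBINT w. ?D G w (0, 1)) = 0"
      by (rule integral_directional_derivative_eq_0[OF G1 K(1)]) (simp add: G_def supp)
    also have "(\<Sum>i=1..m. \<Sum>b\<in>Basis. LBINT w. ?D (F i b) w (b, 0)) = 0"
      by (intro sum.neutral ballI integral_directional_derivative_eq_0[OF F1 K(1)])
         (auto simp: F_def supp flux0)
    finally show "(LBINT w. \<phi> w * h w) = 0" by simp
  qed
  then have "?D P (x, t) (0, 1) = (\<Sum>i=1..m. \<Sum>b\<in>Basis. ?D (horizontal_flux (X i) P b) (x, t) (b, 0))"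
    by (simp add: h_def)
  also have "\<dots> = sub_laplacian m X (\<lambda>y. P (y, t)) x"
    using sub_laplacian_slice[where X = X and m = m and t = t and x = x and T = "{0<..}" and g = P, OF X]
      P[of 2] \<open>t > 0\<close> by (simp add: S_def)
  finally show ?thesis
    using frechet_derivative_slice_snd[OF diffP[of "(x, t)"]] \<open>t > 0\<close> by (simp add: P_def S_def)
qed

section \<open>Carnot-Caratheodory balls\<close>

text \<open>Controls have total size at most 1, so admissible speeds are bounded by \<open>R\<close>
  as long as the curve stays in the ball of radius \<open>1 + \<delta>\<close> around
  \<open>x0\<close>. Starting within distance 1 of \<open>x0\<close>, it stays there until it is
  \<open>\<delta>\<close> away from its start, which costs at least time
  \<open>\<delta> / R\<close>.\<close>

lemma cc_dist_lower_bound: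
  fixes X :: "nat \<Rightarrow> 'a::euclidean_space \<Rightarrow> 'a"
  assumes X: "\<And>i. i \<in> {1..m} \<Longrightarrow> continuous_on UNIV (X i)" and "\<delta> > 0"
  obtains \<eta> where "\<eta> > 0" "\<And>x y. dist x x0 \<le> 1 \<Longrightarrow> \<delta> \<le> dist x y \<Longrightarrow> ereal \<eta> \<le> cc_dist m X x y"
proof -
  have "bounded (\<Union>i\<in>{1..m}. X i ` cball x0 (1 + \<delta>))"
    using X by (intro bounded_UN) (auto intro!: compact_imp_bounded compact_continuous_image continuous_on_subset[OF X])
  then obtain R where R: "R > 0" "\<And>i x. i \<in> {1..m} \<Longrightarrow> x \<in> cball x0 (1 + \<delta>) \<Longrightarrow> norm (X i x) \<le> R"
    unfolding bounded_pos by blast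
  show thesis
  proof (rule that[of "\<delta> / R"])
    show "\<delta> / R > 0" using R \<open>\<delta> > 0\<close> by simp
    fix x y assume x: "dist x x0 \<le> 1" and y: "\<delta> \<le> dist x y"
    show "ereal (\<delta> / R) \<le> cc_dist m X x y"
      unfolding cc_dist_def
    proof (rule Inf_greatest, clarify)
      fix T \<gamma> assume adm: "admissible_curve m X T \<gamma>" and xy: "x = \<gamma> 0" "y = \<gamma> T"
      obtain a F where T: "0 \<le> T" and pc: "\<gamma> piecewise_C1_differentiable_on {0..T}"
        and a: "\<And>t. t \<in> {0..T} \<Longrightarrow> (\<Sum>i=1..m. \<bar>a i t\<bar>) \<le> 1" and F: "finite F"
        and der: "\<And>t. t \<in> {0..T} - F \<Longrightarrow> (\<gamma> has_vector_derivative (\<Sum>i=1..m. a i t *\<^sub>R X i (\<gamma> t))) (at t)"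
        using adm unfolding admissible_curve_def by blast
      have cont: "continuous_on {0..T} \<gamma>" using pc by (simp add: piecewise_C1_differentiable_on_def)
      define S where "S = {t \<in> {0..T}. \<delta> \<le> dist x (\<gamma> t)}"
      have "compact S"
      proof -
        have "continuous_on {0..T} (\<lambda>t. dist x (\<gamma> t))" by (intro continuous_intros cont)
        from continuous_closed_preimage[OF this closed_atLeastAtMost closed_atLeast, of \<delta>]
        have "closed S" by (simp add: S_def vimage_def Int_def)
        moreover have "bounded S" by (rule bounded_subset[of "{0..T}"]) (auto simp: S_def)
        ultimately show ?thesis by (simp add: compact_eq_bounded_closed)
      qed
      moreover have "S \<noteq> {}" using y T xy by (auto simp: S_def)
      \<comment> \<open>The first time at Euclidean distance at least \<open>\<delta>\<close> from
        the start; the speed bound is available strictly before it.\<close>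
      ultimately obtain \<tau> where \<tau>: "\<tau> \<in> S" "\<And>t. t \<in> S \<Longrightarrow> \<tau> \<le> t"
        using compact_attains_inf[of S] by metis
      \<comment> \<open>The control equation is given off the finite set \<open>F\<close> and the
        speed bound is derived inside the time interval; the value 0 at the finitely many other
        times does not change the integral.\<close>
      define g where "g t = (if t \<in> F \<union> {0, \<tau>} then 0 else \<Sum>i=1..m. a i t *\<^sub>R X i (\<gamma> t))" for t
      have "(g has_integral (\<gamma> \<tau> - \<gamma> 0)) {0..\<tau>}"
      proof (rule fundamental_theorem_of_calculus_interior_strong[of "F \<union> {0, \<tau>}"])
        show "continuous_on {0..\<tau>} \<gamma>"
          using \<tau>(1) by (intro continuous_on_subset[OF cont]) (auto simp: S_def)
        show "(\<gamma> has_vector_derivative g t) (at t)" if "t \<in> {0<..<\<tau>} - (F \<union> {0, \<tau>})" for t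
          using der[of t] that \<tau>(1) by (simp add: g_def S_def)
      qed (use F \<tau>(1) in \<open>auto simp: S_def\<close>)
      then have "norm (\<gamma> \<tau> - \<gamma> 0) \<le> R * measure lborel (cbox 0 \<tau>)"
      proof (intro has_integral_bound)
        fix t assume t: "t \<in> cbox 0 \<tau>"
        show "norm (g t) \<le> R"
        proof (cases "t \<in> F \<union> {0, \<tau>}")
          case False
          then have t': "t \<in> {0..T}" "t < \<tau>" using t \<tau>(1) by (auto simp: S_def)
          then have "dist x (\<gamma> t) < \<delta>" using \<tau>(2)[of t] by (force simp: S_def)
          then have "\<gamma> t \<in> cball x0 (1 + \<delta>)"
            using x dist_triangle[of x0 "\<gamma> t" x] by (auto simp: dist_commute)
          then have "norm (\<Sum>i=1..m. a i t *\<^sub>R X i (\<gamma> t)) \<le> (\<Sum>i=1..m. \<bar>a i t\<bar> * R)"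
            by (intro sum_norm_le) (auto intro!: mult_left_mono R(2))
          also have "\<dots> \<le> 1 * R"
            unfolding sum_distrib_right[symmetric] using a[OF t'(1)] R(1) by (intro mult_right_mono) auto
          finally show ?thesis using False by (simp add: g_def)
        qed (use R(1) in \<open>auto simp: g_def\<close>)
      qed (use R in auto)
      also have "\<dots> \<le> R * T" using \<tau>(1) R(1) by (auto simp: S_def)
      finally have "\<delta> \<le> R * T"
        using \<tau>(1) xy by (auto simp: S_def dist_norm norm_minus_commute)
      then show "ereal (\<delta> / R) \<le> ereal T" using R(1) by (simp add: field_simps)
    qed
  qed
qed

lemma gauss_nonneg: "0 \<le> gauss c d"
  by (simp add: gauss_def)

lemma gauss_le_1: "0 \<le> c \<Longrightarrow> gauss c d \<le> 1"
  by (simp add: gauss_def)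

lemma gauss_add: "gauss (c + c') d = gauss c d * gauss c' d"
  by (simp add: gauss_def ring_distribs flip: exp_add)

lemma gauss_le_exp: "0 \<le> c \<Longrightarrow> 0 \<le> \<eta> \<Longrightarrow> ereal \<eta> \<le> d \<Longrightarrow> gauss c d \<le> exp (- c * \<eta>\<^sup>2)"
  by (cases d) (auto simp: gauss_def intro!: mult_left_mono power_mono)

section \<open>Bounds for the heat kernel\<close>

locale heat_kernel =
  fixes m :: nat and X :: "nat \<Rightarrow> real^'n \<Rightarrow> real^'n" and p :: "real^'n \<Rightarrow> real^'n \<Rightarrow> real \<Rightarrow> real"
  assumes smooth_X: "\<And>i. i \<in> {1..m} \<Longrightarrow> smooth_on UNIV (X i)"
    and hormander: "hormander m X"
    and fundamental: "heat_fundamental_solution m X p"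
    and gaussian: "gaussian_bounds m X p"
    and mass: "\<And>x t. t > 0 \<Longrightarrow> (LBINT y. p x y t) = 1"
    and doubling: "doubling m X"
begin

abbreviation gauss_ratio :: "real \<Rightarrow> real^'n \<Rightarrow> real^'n \<Rightarrow> real \<Rightarrow> real" where
  "gauss_ratio c x y t \<equiv> gauss (c / t) (cc_dist m X x y) / cc_vol m X x (sqrt t)"

lemma p_pos: "t > 0 \<Longrightarrow> p x y t > 0"
  using conjunct1[OF fundamental[unfolded heat_fundamental_solution_def]] by simp

text \<open>The Bochner integral of a non-integrable function is 0 by convention, so an integral
  equal to 1 already contains integrability.\<close>

lemma p_integrable: "t > 0 \<Longrightarrow> integrable lborel (\<lambda>y. p x y t)"
  using mass[of t x] not_integrable_integral_eq[of lborel "\<lambda>y. p x y t"] by fastforce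

lemma p_nn_integral: "t > 0 \<Longrightarrow> (\<integral>\<^sup>+y. ennreal (p x y t) \<partial>lborel) = 1"
  using mass[of t x] nn_integral_eq_integral[OF p_integrable, of t x] p_pos[of t x] by (simp add: less_imp_le)

text \<open>Fixes the order of the quantifiers: \<open>M\<close> and \<open>C'\<close> are shared by
  all words, only the factor \<open>C\<close> may depend on \<open>J\<close>. Hence one rescaling of
  time will serve for every word.\<close>

lemma gaussian_constants:
  obtains M C' where "M > 0" "C' > 0"
    "\<And>J. set J \<subseteq> {1..m} \<Longrightarrow> \<exists>C>0. \<forall>x y t. t > 0 \<longrightarrow> \<bar>X_word X J (\<lambda>x'. p x' y t) x\<bar>
      \<le> C * t powr (- real (length J) / 2) * (gauss_ratio M x y t)"
    "\<And>x y t. t > 0 \<Longrightarrow> gauss_ratio (inverse M) x y t \<le> C' * p x y t"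
proof -
  obtain M where M: "M > 0" and
    u: "\<And>k l. \<exists>C>0. \<forall>js x y t. set js \<subseteq> {1..m} \<longrightarrow> length js = l \<longrightarrow> t > 0 \<longrightarrow>
        \<bar>(deriv ^^ k) (\<lambda>r. X_word X js (\<lambda>x'. p x' y r) x) t\<bar>
          \<le> C / (t powr (real k + real l / 2) * cc_vol m X x (sqrt t))
              * gauss (M / t) (cc_dist m X x y)"
    and low: "\<exists>C>0. \<forall>x y t. t > 0 \<longrightarrow>
        p x y t \<ge> inverse C / cc_vol m X x (sqrt t) * gauss (inverse M / t) (cc_dist m X x y)"
    using gaussian unfolding gaussian_bounds_def by blast
  obtain C' where C': "C' > 0" "\<And>x y t. t > 0 \<Longrightarrow>
        p x y t \<ge> inverse C' / cc_vol m X x (sqrt t) * gauss (inverse M / t) (cc_dist m X x y)"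
    using low by blast
  show thesis
  proof (rule that[OF M C'(1)])
    fix J assume J: "set J \<subseteq> {1..m}"
    obtain C where C: "C > 0" "\<forall>js x y t. set js \<subseteq> {1..m} \<longrightarrow> length js = length J \<longrightarrow> t > 0 \<longrightarrow>
        \<bar>X_word X js (\<lambda>x'. p x' y t) x\<bar>
          \<le> C / (t powr (real (length J) / 2) * cc_vol m X x (sqrt t)) * gauss (M / t) (cc_dist m X x y)"
      using u[where k = 0 and l = "length J"] by auto
    have eq: "C / (t powr (real (length J) / 2) * cc_vol m X x (sqrt t)) * gauss (M / t) (cc_dist m X x y) =
        C * t powr (- real (length J) / 2) * (gauss_ratio M x y t)" for x y t
      by (simp add: powr_minus divide_simps)
    show "\<exists>C>0. \<forall>x y t. t > 0 \<longrightarrow> \<bar>X_word X J (\<lambda>x'. p x' y t) x\<bar>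
      \<le> C * t powr (- real (length J) / 2) * (gauss_ratio M x y t)"
      using C(1) C(2)[rule_format, OF J refl, unfolded eq] by blast
  next
    fix x y and t :: real assume "t > 0"
    have "gauss_ratio (inverse M) x y t =
        C' * (inverse C' / cc_vol m X x (sqrt t) * gauss (inverse M / t) (cc_dist m X x y))"
      using C'(1) by simp
    also have "\<dots> \<le> C' * p x y t"
      using C'(1) C'(2)[OF \<open>t > 0\<close>] by (intro mult_left_mono) auto
    finally show "gauss_ratio (inverse M) x y t \<le> C' * p x y t" .
  qed
qed

lemma gaussian_upper_lower:
  obtains M C C' where "M > 0" "C > 0" "C' > 0"
    "\<And>x y t. t > 0 \<Longrightarrow> p x y t \<le> C * (gauss_ratio M x y t)"
    "\<And>x y t. t > 0 \<Longrightarrow> gauss_ratio (inverse M) x y t \<le> C' * p x y t"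
proof (rule gaussian_constants)
  fix M C' :: real
  assume M: "M > 0" "C' > 0" and u: "\<And>J. set J \<subseteq> {1..m} \<Longrightarrow> \<exists>C>0. \<forall>x y t. t > 0 \<longrightarrow> \<bar>X_word X J (\<lambda>x'. p x' y t) x\<bar>
      \<le> C * t powr (- real (length J) / 2) * (gauss_ratio M x y t)"
    and low: "\<And>x y t. t > 0 \<Longrightarrow> gauss_ratio (inverse M) x y t \<le> C' * p x y t"
  obtain C where "C > 0" "\<forall>x y t. t > 0 \<longrightarrow> \<bar>p x y t\<bar> \<le> C * (gauss_ratio M x y t)"
    using u[of "[]"] by auto
  then show thesis using that[OF M(1) _ M(2) _ low, of C] by (metis abs_le_D1)
qed

text \<open>If the volume were 0, the quotient in the upper Gaussian bound would be 0 by the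
  convention for division, contradicting \<open>p > 0\<close>.\<close>

lemma vol_pos:
  assumes "r > 0"
  shows "cc_vol m X x r > 0"
proof -
  obtain M C where "\<And>x y t. t > 0 \<Longrightarrow> p x y t \<le> C * (gauss_ratio M x y t)"
    by (rule gaussian_upper_lower) blast
  from this[of "r\<^sup>2" x x] have "cc_vol m X x r \<noteq> 0"
    using p_pos[of "r\<^sup>2" x x] assms by auto
  then show ?thesis by (simp add: cc_vol_def zero_less_measure_iff)
qed

text \<open>\<open>measure\<close> is 0 on non-measurable sets and on sets of infinite measure.
  Positive volume therefore makes the balls measurable and of finite measure, and inclusion gives
  monotonicity.\<close>

lemma vol_mono:
  assumes "0 < r" "r \<le> r'"
  shows "cc_vol m X x r \<le> cc_vol m X x r'"
proof -
  have meas: "{y. cc_dist m X x y < ereal r} \<in> fmeasurable lebesgue" if "r > 0" for r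
  proof (rule fmeasurableI)
    have pos: "measure lebesgue {y. cc_dist m X x y < ereal r} > 0"
      using vol_pos[OF that, of x] by (simp add: cc_vol_def)
    then show "{y. cc_dist m X x y < ereal r} \<in> sets lebesgue"
      using measure_notin_sets by fastforce
    show "emeasure lebesgue {y. cc_dist m X x y < ereal r} < \<infinity>"
      using pos by (auto simp: measure_def less_top[symmetric])
  qed
  show ?thesis
    unfolding cc_vol_def
    using assms meas[of r] meas[of r']
    by (intro measure_mono_fmeasurable) (auto intro: less_le_trans simp: fmeasurableD)
qed

lemma vol_doubling_iterated:
  obtains D where "D \<ge> 1" "\<And>x r k. r > 0 \<Longrightarrow> cc_vol m X x (2 ^ k * r) \<le> D ^ k * cc_vol m X x r"
proof -
  obtain C where C: "\<And>x r. r > 0 \<Longrightarrow> cc_vol m X x (2 * r) \<le> C * cc_vol m X x r"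
    using doubling unfolding doubling_def by blast
  \<comment> \<open>With \<open>D \<ge> 1\<close> the exponent \<open>log 2 D\<close>, which later
    measures volume growth, is nonnegative.\<close>
  define D where "D = max 1 C"
  have D: "cc_vol m X x (2 * r) \<le> D * cc_vol m X x r" if "r > 0" for x r
    using C[OF that, of x] vol_pos[OF that, of x]
    by (smt (verit) D_def mult_right_mono)
  show thesis
  proof (rule that[of D])
    show "D \<ge> 1" by (simp add: D_def)
    show "cc_vol m X x (2 ^ k * r) \<le> D ^ k * cc_vol m X x r" if r: "r > 0" for x r k
    proof (induction k)
      case (Suc k)
      have "cc_vol m X x (2 ^ Suc k * r) \<le> D * cc_vol m X x (2 ^ k * r)"
        using D[of "2 ^ k * r" x] r by (simp add: mult.assoc)
      also have "\<dots> \<le> D * (D ^ k * cc_vol m X x r)"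
        using Suc \<open>D \<ge> 1\<close> by (intro mult_left_mono) auto
      finally show ?case by (simp add: mult.assoc)
    qed simp
  qed
qed

lemma vol_scale:
  assumes "c > 0"
  obtains C where "C > 0" "\<And>x r. r > 0 \<Longrightarrow> cc_vol m X x (c * r) \<le> C * cc_vol m X x r"
proof -
  obtain D where D: "D \<ge> 1" "\<And>x r k. r > 0 \<Longrightarrow> cc_vol m X x (2 ^ k * r) \<le> D ^ k * cc_vol m X x r"
    by (rule vol_doubling_iterated) blast
  obtain k :: nat where k: "c < 2 ^ k" using real_arch_pow[of 2 c] by auto
  show thesis
  proof (rule that[of "D ^ k"])
    show "D ^ k > 0" using D(1) by simp
    fix x and r :: real assume r: "r > 0"
    have "cc_vol m X x (c * r) \<le> cc_vol m X x (2 ^ k * r)"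
      using assms k r by (intro vol_mono) auto
    also have "\<dots> \<le> D ^ k * cc_vol m X x r" using D(2)[OF r] .
    finally show "cc_vol m X x (c * r) \<le> D ^ k * cc_vol m X x r" .
  qed
qed

text \<open>Upper and lower Gaussian bounds combine to a bound by the kernel itself at a comparable time,
  which has unit mass; this replaces any further information on the distance.\<close>

lemma gauss_over_vol_le:
  assumes "M > 0" "C' > 0" "e > 0"
    and low: "\<And>x y t. t > 0 \<Longrightarrow> gauss_ratio (inverse M) x y t \<le> C' * p x y t"
  obtains C where "C > 0" "\<And>x y t. t > 0 \<Longrightarrow>
    gauss_ratio e x y t \<le> C * p x y (inverse (e * M) * t)"
proof -
  have eM: "inverse (e * M) > 0" using assms by simp
  define c where "c = sqrt (inverse (e * M))"
  have c: "c > 0" using eM by (simp add: c_def)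
  obtain D where D: "D > 0" "\<And>x r. r > 0 \<Longrightarrow> cc_vol m X x (c * r) \<le> D * cc_vol m X x r"
    using vol_scale[OF c] by blast
  show thesis
  proof (rule that[of "C' * D"])
    show "C' * D > 0" using assms D by simp
    fix x y and t :: real assume t: "t > 0"
    let ?t = "inverse (e * M) * t"
    have s: "sqrt ?t = c * sqrt t" by (simp add: c_def real_sqrt_mult)
    have t': "?t > 0" using eM t by simp
    have v: "cc_vol m X x (sqrt t) > 0" "cc_vol m X x (c * sqrt t) > 0"
      using t c by (auto intro!: vol_pos)
    \<comment> \<open>The comparison time is chosen for this equality: the exponent of the lower
      bound at \<open>?t\<close> is the prescribed \<open>e / t\<close>. The change of radius from
      \<open>sqrt t\<close> to \<open>c * sqrt t\<close> is paid for by doubling.\<close>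
    have e: "inverse M / ?t = e / t" using assms t by (simp add: field_simps)
    have "gauss (e / t) (cc_dist m X x y) \<le> C' * p x y ?t * cc_vol m X x (c * sqrt t)"
      using low[OF t', of x y] v(2) unfolding e s by (simp only: pos_divide_le_eq)
    then have "gauss (e / t) (cc_dist m X x y) \<le> C' * cc_vol m X x (c * sqrt t) * p x y ?t"
      by (simp only: mult_ac)
    also have "\<dots> \<le> C' * (D * cc_vol m X x (sqrt t)) * p x y ?t"
      using assms D t p_pos[OF t', of x y] by (intro mult_right_mono mult_left_mono D(2)) auto
    finally show "gauss_ratio e x y t \<le> C' * D * p x y ?t"
      using v by (simp add: field_simps)
  qed
qed

text \<open>The preceding comparison with \<open>e = M\<close>, which produces the time factor
  \<open>inverse (M * M)\<close> for all words simultaneously.\<close>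

lemma X_word_bound:
  obtains c where "c > 0" "\<And>J. set J \<subseteq> {1..m} \<Longrightarrow> \<exists>C>0. \<forall>x y t. t > 0 \<longrightarrow>
    \<bar>X_word X J (\<lambda>x'. p x' y t) x\<bar> \<le> C * t powr (- real (length J) / 2) * p x y (c * t)"
proof (rule gaussian_constants)
  fix M C' :: real
  assume M: "M > 0" "C' > 0" and u: "\<And>J. set J \<subseteq> {1..m} \<Longrightarrow> \<exists>C>0. \<forall>x y t. t > 0 \<longrightarrow> \<bar>X_word X J (\<lambda>x'. p x' y t) x\<bar>
      \<le> C * t powr (- real (length J) / 2) * (gauss_ratio M x y t)"
    and low: "\<And>x y t. t > 0 \<Longrightarrow> gauss_ratio (inverse M) x y t \<le> C' * p x y t"
  obtain D where D: "D > 0" "\<And>x y t. t > 0 \<Longrightarrow>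
    gauss_ratio M x y t \<le> D * p x y (inverse (M * M) * t)"
    using gauss_over_vol_le[OF M(1,2) M(1) low] by blast
  show thesis
  proof (rule that[of "inverse (M * M)"])
    show "inverse (M * M) > 0" using M by simp
    fix J assume "set J \<subseteq> {1..m}"
    then obtain C where C: "C > 0" "\<And>x y t. t > 0 \<Longrightarrow> \<bar>X_word X J (\<lambda>x'. p x' y t) x\<bar>
      \<le> C * t powr (- real (length J) / 2) * (gauss_ratio M x y t)"
      using u by blast
    have "\<bar>X_word X J (\<lambda>x'. p x' y t) x\<bar>
      \<le> C * D * t powr (- real (length J) / 2) * p x y (inverse (M * M) * t)" if t: "t > 0" for x y t
    proof -
      have "\<bar>X_word X J (\<lambda>x'. p x' y t) x\<bar> \<le> C * t powr (- real (length J) / 2) * (D * p x y (inverse (M * M) * t))"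
        using C(1) t by (intro order_trans[OF C(2)[OF t] mult_left_mono[OF D(2)]]) auto
      then show ?thesis by (simp add: mult_ac)
    qed
    then show "\<exists>C>0. \<forall>x y t. t > 0 \<longrightarrow> \<bar>X_word X J (\<lambda>x'. p x' y t) x\<bar>
      \<le> C * t powr (- real (length J) / 2) * p x y (inverse (M * M) * t)"
      using C(1) D(1) by (intro exI[of _ "C * D"]) simp
  qed
qed

text \<open>The Gaussian exponent is split into two halves. One becomes explicit decay through the
  lower bound on the distance, the other is kept for the comparison with the kernel, so that the
  result can still be integrated over \<open>y\<close>.\<close>

lemma p_off_diagonal_bound:
  obtains c e C where "c > 0" "e > 0" "C > 0"
    "\<And>x y t \<eta>. t > 0 \<Longrightarrow> 0 \<le> \<eta> \<Longrightarrow> ereal \<eta> \<le> cc_dist m X x y \<Longrightarrow> p x y t \<le> C * exp (- e / t * \<eta>\<^sup>2) * p x y (c * t)"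
proof -
  obtain M C C' where M: "M > 0" and C: "C > 0" "C' > 0"
    and up: "\<And>x y t. t > 0 \<Longrightarrow> p x y t \<le> C * (gauss_ratio M x y t)"
    and low: "\<And>x y t. t > 0 \<Longrightarrow> gauss_ratio (inverse M) x y t \<le> C' * p x y t"
    by (rule gaussian_upper_lower) blast
  define e where "e = M / 2"
  have e: "e > 0" using M by (simp add: e_def)
  obtain D where D: "D > 0" "\<And>x y t. t > 0 \<Longrightarrow>
    gauss_ratio e x y t \<le> D * p x y (inverse (e * M) * t)"
    using gauss_over_vol_le[OF M C(2) e low] by blast
  show thesis
  proof (rule that[of "inverse (e * M)" e "C * D"])
    show "inverse (e * M) > 0" "C * D > 0" using M e C D by simp_all
    fix x y and t \<eta> :: real assume t: "t > 0" and \<eta>: "0 \<le> \<eta>" "ereal \<eta> \<le> cc_dist m X x y"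
    have v: "cc_vol m X x (sqrt t) > 0" using t by (intro vol_pos) simp
    have "M / t = e / t + e / t" by (simp add: e_def)
    then have "p x y t \<le> C * gauss (e / t) (cc_dist m X x y) * (gauss_ratio e x y t)"
      using up[OF t, of x y] by (simp only: gauss_add) (simp add: mult_ac)
    also have "\<dots> \<le> C * exp (- (e / t) * \<eta>\<^sup>2) * (D * p x y (inverse (e * M) * t))"
      using C(1) D(2)[OF t, of x y] e t \<eta> v gauss_le_exp[of "e / t" \<eta> "cc_dist m X x y"]
      by (intro mult_mono) (auto simp: gauss_nonneg)
    finally show "p x y t \<le> C * D * exp (- e / t * \<eta>\<^sup>2) * p x y (inverse (e * M) * t)"
      by (simp add: mult_ac)
  qed (rule e)
qed

text \<open>Bounds in mean say nothing for a single \<open>y\<close>; this one is for the time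
  integrals at fixed \<open>x\<close> and \<open>y\<close>. Iterated doubling down from radius 1
  bounds small volumes below by a power of the radius, so \<open>Q\<close> is half of
  \<open>log 2 D\<close>; \<open>C\<close> depends on \<open>x\<close> through the volume of the
  unit ball.\<close>

lemma p_pointwise_bound:
  obtains C Q where "C > 0" "Q \<ge> 0" "\<And>y t. t > 0 \<Longrightarrow> p x y t \<le> C * (1 + t powr (- Q))"
proof -
  obtain M C where M: "M > 0" and C: "C > 0"
    and up: "\<And>x y t. t > 0 \<Longrightarrow> p x y t \<le> C * (gauss_ratio M x y t)"
    by (rule gaussian_upper_lower) blast
  obtain D where D: "D \<ge> 1" "\<And>x r k. r > 0 \<Longrightarrow> cc_vol m X x (2 ^ k * r) \<le> D ^ k * cc_vol m X x r"
    by (rule vol_doubling_iterated) blast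
  define q where "q = log 2 D"
  have q: "q \<ge> 0" "D = 2 powr q" using D(1) by (auto simp: q_def)
  define v where "v = cc_vol m X x 1"
  have v: "v > 0" by (simp add: v_def vol_pos)
  have low: "v \<le> D * (1 + t powr (- (q / 2))) * cc_vol m X x (sqrt t)" if t: "t > 0" for t
  proof (cases "t \<ge> 1")
    case True
    have "v \<le> cc_vol m X x (sqrt t)" unfolding v_def using True by (intro vol_mono) auto
    moreover have "1 \<le> D * (1 + t powr (- (q / 2)))"
      using D(1) mult_mono[of 1 D 1 "1 + t powr (- (q / 2))"] by auto
    ultimately show ?thesis
      using mult_mono[of 1 "D * (1 + t powr (- (q / 2)))" v "cc_vol m X x (sqrt t)"] v by simp
  next
    case False
    define r where "r = sqrt t"
    have r: "0 < r" "r < 1" using t False by (auto simp: r_def)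
    \<comment> \<open>The number of doublings that bring the radius \<open>r < 1\<close> up to at
      least 1; rounding up costs one extra factor \<open>D\<close>.\<close>
    define k where "k = nat \<lceil>log 2 (1 / r)\<rceil>"
    have l0: "log 2 (1 / r) > 0" using r by (simp add: zero_less_log_cancel_iff)
    have k: "log 2 (1 / r) \<le> real k" "real k \<le> 1 + log 2 (1 / r)"
      unfolding k_def using l0 by linarith+
    have "1 / r \<le> 2 ^ k"
      using k(1) r by (simp add: log_le_iff powr_realpow)
    then have "1 \<le> 2 ^ k * r" using r by (simp add: field_simps)
    then have "v \<le> cc_vol m X x (2 ^ k * r)" unfolding v_def by (intro vol_mono) auto
    also have "\<dots> \<le> D ^ k * cc_vol m X x r" using r by (intro D(2)) auto
    also have "D ^ k \<le> D * r powr (- q)"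
    proof -
      have "D ^ k = 2 powr (q * real k)" using q(2) by (simp add: powr_realpow[symmetric] powr_powr)
      also have "\<dots> \<le> 2 powr (q * (1 + log 2 (1 / r)))"
        using k(2) q(1) by (intro powr_mono mult_left_mono) auto
      also have "\<dots> = D * (2 powr log 2 (1 / r)) powr q"
        by (simp add: q(2) distrib_left powr_add powr_powr mult.commute)
      also have "2 powr log 2 (1 / r) = 1 / r" using r by (intro powr_log_cancel) auto
      also have "(1 / r) powr q = r powr (- q)" using r by (simp add: powr_divide powr_minus_divide)
      finally show ?thesis .
    qed
    also have "r powr (- q) = t powr (- (q / 2))"
      unfolding r_def using t by (simp add: powr_half_sqrt[symmetric] powr_powr)
    finally have "v \<le> D * t powr (- (q / 2)) * cc_vol m X x r"
      using vol_pos[OF r(1), of x] by simp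
    also have "\<dots> \<le> D * (1 + t powr (- (q / 2))) * cc_vol m X x r"
      using vol_pos[OF r(1), of x] D(1) by (intro mult_right_mono mult_left_mono) auto
    finally show ?thesis by (simp add: r_def)
  qed
  show thesis
  proof (rule that[of "C * D / v" "q / 2"])
    show "C * D / v > 0" "q / 2 \<ge> 0" using C D v q by auto
    fix y and t :: real assume t: "t > 0"
    have V: "cc_vol m X x (sqrt t) > 0" using t by (intro vol_pos) simp
    have "p x y t \<le> C / cc_vol m X x (sqrt t) * gauss (M / t) (cc_dist m X x y)"
      using up[OF t, of x y] by simp
    also have "\<dots> \<le> C / cc_vol m X x (sqrt t) * 1"
      using C V M t by (intro mult_left_mono gauss_le_1) auto
    also have "\<dots> \<le> C * D / v * (1 + t powr (- (q / 2)))"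
      using mult_left_mono[OF low[OF t], of C] C v V by (simp add: field_simps)
    finally show "p x y t \<le> C * D / v * (1 + t powr (- (q / 2)))" .
  qed
qed

text \<open>As the mass is 1, the error is the mean of \<open>u y - u x0\<close>. Points near
  \<open>x\<close> are handled by continuity of \<open>u\<close>; points at Euclidean distance at
  least \<open>\<delta>\<close> carry the factor \<open>exp (- e / t * \<eta>^2)\<close> times a
  kernel of unit mass. All bounds are uniform in \<open>x\<close> near \<open>x0\<close>, hence the
  limit is joint.\<close>

lemma heat_semigroup_tendsto:
  assumes u: "continuous_on UNIV u" and B: "\<And>y. \<bar>u y\<bar> \<le> B"
  shows "((\<lambda>(x, t). LBINT y. p x y t * u y) \<longlongrightarrow> u x0) (at (x0, 0) within UNIV \<times> {0<..})"
proof (rule tendstoI)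
  fix \<epsilon> :: real assume \<epsilon>: "\<epsilon> > 0"
  have "B \<ge> 0" using B[of 0] by linarith
  obtain \<delta>' where \<delta>': "\<delta>' > 0" "\<And>y. dist y x0 < \<delta>' \<Longrightarrow> dist (u y) (u x0) < \<epsilon> / 2"
    using u \<epsilon> unfolding continuous_on_iff by (metis UNIV_I half_gt_zero)
  \<comment> \<open>Half is kept for the displacement of \<open>x\<close> from \<open>x0\<close>,
    the other half for that of \<open>y\<close> from \<open>x\<close>.\<close>
  define \<delta> where "\<delta> = \<delta>' / 2"
  have \<delta>: "\<delta> > 0" using \<delta>' by (simp add: \<delta>_def)
  have cX: "continuous_on UNIV (X i)" if "i \<in> {1..m}" for i
    by (rule Ck_on_imp_continuous_on[OF smooth_on_imp_Ck_on[OF smooth_X[OF that]]])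
  obtain \<eta> where \<eta>: "\<eta> > 0" "\<And>x y. dist x x0 \<le> 1 \<Longrightarrow> \<delta> \<le> dist x y \<Longrightarrow> ereal \<eta> \<le> cc_dist m X x y"
    using cc_dist_lower_bound[where m = m and X = X and ?x0.0 = x0, OF cX \<delta>] by blast
  obtain c e C where c: "c > 0" "e > 0" "C > 0" and
    off: "\<And>x y t \<eta>. t > 0 \<Longrightarrow> 0 \<le> \<eta> \<Longrightarrow> ereal \<eta> \<le> cc_dist m X x y \<Longrightarrow>
      p x y t \<le> C * exp (- e / t * \<eta>\<^sup>2) * p x y (c * t)"
    by (rule p_off_diagonal_bound) blast
  have um: "u \<in> borel_measurable borel" using u by (rule borel_measurable_continuous_onI)
  have ipu: "integrable lborel (\<lambda>y. p x y t * u y)" if "t > 0" for x t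
  proof (rule Bochner_Integration.integrable_bound[of _ "\<lambda>y. p x y t * B"])
    show "AE y in lborel. norm (p x y t * u y) \<le> norm (p x y t * B)"
      using B \<open>B \<ge> 0\<close> by (auto simp: abs_mult intro!: mult_left_mono)
  qed (use p_integrable[OF that, of x] um in auto)
  have main: "\<bar>(LBINT y. p x y t * u y) - u x0\<bar> \<le> \<epsilon> / 2 + 2 * B * C * exp (- e / t * \<eta>\<^sup>2)"
    if t: "t > 0" and x: "dist x x0 < min 1 \<delta>" for x t
  proof -
    have ct: "c * t > 0" using c t by simp
    have "(LBINT y. p x y t * u y) - u x0 = (LBINT y. p x y t * u y - u x0 * p x y t)"
      using ipu[OF t, of x] p_integrable[OF t, of x] by (simp add: mass[OF t])
    also have "\<bar>\<dots>\<bar> \<le> (LBINT y. \<bar>p x y t * u y - u x0 * p x y t\<bar>)"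
      using integral_norm_bound[of lborel "\<lambda>y. p x y t * u y - u x0 * p x y t"] by simp
    also have "\<dots> \<le> (LBINT y. \<epsilon> / 2 * p x y t + 2 * B * C * exp (- e / t * \<eta>\<^sup>2) * p x y (c * t))"
    proof (rule integral_mono)
      fix y
      have pos: "p x y t > 0" "p x y (c * t) > 0" using p_pos t ct by auto
      have "\<bar>p x y t * u y - u x0 * p x y t\<bar> = p x y t * \<bar>u y - u x0\<bar>"
      proof -
        have "p x y t * u y - u x0 * p x y t = p x y t * (u y - u x0)" by (simp add: algebra_simps)
        then show ?thesis using pos by (simp add: abs_mult)
      qed
      also have "\<dots> \<le> \<epsilon> / 2 * p x y t + 2 * B * C * exp (- e / t * \<eta>\<^sup>2) * p x y (c * t)"
      proof (cases "\<delta> \<le> dist x y")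
        case True
        have "p x y t * \<bar>u y - u x0\<bar> \<le> C * exp (- e / t * \<eta>\<^sup>2) * p x y (c * t) * (2 * B)"
          using off[OF t less_imp_le[OF \<eta>(1)] \<eta>(2)[of x y]] x True B[of y] B[of x0] pos c
          by (intro mult_mono) auto
        then show ?thesis using \<epsilon> pos by (simp add: mult_ac add_increasing)
      next
        case False
        then have "dist y x0 < \<delta>'"
          using x dist_triangle[of y x0 x] by (simp add: \<delta>_def dist_commute)
        then have "\<bar>u y - u x0\<bar> \<le> \<epsilon> / 2" using \<delta>'(2)[of y] by (simp add: dist_real_def)
        then have "p x y t * \<bar>u y - u x0\<bar> \<le> p x y t * (\<epsilon> / 2)"
          using pos by (intro mult_left_mono) auto
        then show ?thesis using \<open>B \<ge> 0\<close> c pos by (simp add: mult.commute add_increasing2)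
      qed
      finally show "\<bar>p x y t * u y - u x0 * p x y t\<bar> \<le>
        \<epsilon> / 2 * p x y t + 2 * B * C * exp (- e / t * \<eta>\<^sup>2) * p x y (c * t)" .
    qed (use ipu[OF t, of x] p_integrable[OF t, of x] p_integrable[OF ct, of x] in auto)
    also have "\<dots> = \<epsilon> / 2 + 2 * B * C * exp (- e / t * \<eta>\<^sup>2)"
      using p_integrable[OF t, of x] p_integrable[OF ct, of x] mass[OF t, of x] mass[OF ct, of x] by simp
    finally show ?thesis .
  qed
  have "((\<lambda>t. 2 * B * C * exp (- e / t * \<eta>\<^sup>2)) \<longlongrightarrow> 0) (at_right 0)"
  proof -
    have "filterlim (\<lambda>t. - (e * \<eta>\<^sup>2) * inverse t) at_bot (at_right (0::real))"
      by (rule filterlim_tendsto_neg_mult_at_bot[OF tendsto_const])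
         (use c \<eta> in \<open>auto simp: filterlim_inverse_at_top_right\<close>)
    from tendsto_mult_right_zero[OF filterlim_compose[OF exp_at_bot this], of "2 * B * C"]
    show ?thesis by (simp add: divide_inverse mult_ac)
  qed
  then have "\<forall>\<^sub>F t in at_right 0. 2 * B * C * exp (- e / t * \<eta>\<^sup>2) < \<epsilon> / 2"
    using \<epsilon> by (intro order_tendstoD) auto
  then obtain b where b: "b > 0" "\<And>t. 0 < t \<Longrightarrow> t < b \<Longrightarrow> 2 * B * C * exp (- e / t * \<eta>\<^sup>2) < \<epsilon> / 2"
    unfolding eventually_at_right_field by auto
  show "\<forall>\<^sub>F w in at (x0, 0) within UNIV \<times> {0<..}. dist (case w of (x, t) \<Rightarrow> LBINT y. p x y t * u y) (u x0) < \<epsilon>"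
    unfolding eventually_at
  proof (intro exI[of _ "min b (min 1 \<delta>)"] conjI ballI impI)
    show "min b (min 1 \<delta>) > 0" using b \<delta> by simp
    fix w :: "(real^'n) \<times> real"
    assume w: "w \<in> UNIV \<times> {0<..}" "w \<noteq> (x0, 0) \<and> dist w (x0, 0) < min b (min 1 \<delta>)"
    obtain x t where wt: "w = (x, t)" by (cases w)
    have "dist x x0 < min 1 \<delta>" "\<bar>t\<bar> < b"
      using w(2) dist_fst_le[of w "(x0, 0)"] dist_snd_le[of w "(x0, 0)"] by (auto simp: wt dist_real_def)
    moreover have "t > 0" using w(1) wt by simp
    ultimately show "dist (case w of (x, t) \<Rightarrow> LBINT y. p x y t * u y) (u x0) < \<epsilon>"
      using main[of t x] b(2)[of t] by (simp add: wt dist_real_def)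
  qed
qed

end

section \<open>The time weight\<close>

text \<open>The substitution \<open>t = \<kappa> / v\<close> turns the integral into Euler's
  integral for the Gamma function. It is carried out for absolute integrability, so that existence
  and value are transported together.\<close>

lemma inverse_Gamma_integral:
  fixes \<gamma> \<kappa> :: real
  assumes "\<gamma> > 0" "\<kappa> > 0"
  shows "set_integrable lborel {0<..} (\<lambda>t. t powr (- \<gamma> - 1) * exp (- \<kappa> / t))"
    and "(LINT t:{0<..}|lborel. t powr (- \<gamma> - 1) * exp (- \<kappa> / t)) = \<kappa> powr (- \<gamma>) * Gamma \<gamma>"
proof -
  let ?f = "\<lambda>t. t powr (- \<gamma> - 1) * exp (- \<kappa> / t)"
  let ?G = "\<lambda>v. v powr (\<gamma> - 1) / exp v"
  have G: "(?G has_integral Gamma \<gamma>) {0<..}"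
    using Gamma_integral_real[OF assms(1)]
    by (subst has_integral_spike_set_eq[of _ "{0..}"])
       (auto intro: empty_imp_negligible negligible_subset[of "{0}"])
  have "?G absolutely_integrable_on {0<..}"
    using G by (intro nonnegative_absolutely_integrable_1) (auto simp: has_integral_iff)
  then have abs: "(\<lambda>v. \<kappa> powr (- \<gamma>) * ?G v) absolutely_integrable_on {0<..}"
    by (rule set_integrable_mult_right)
  have val: "integral {0<..} (\<lambda>v. \<kappa> powr (- \<gamma>) * ?G v) = \<kappa> powr (- \<gamma>) * Gamma \<gamma>"
    using has_integral_mult_right[OF G] by (rule integral_unique)
  have eq: "\<kappa> powr (- \<gamma>) * ?G v = \<bar>- \<kappa> / v\<^sup>2\<bar> * ?f (\<kappa> / v)" if "v \<in> {0<..}" for v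
  proof -
    have v: "v > 0" using that by simp
    have "(\<kappa> / v) powr (- \<gamma> - 1) = \<kappa> powr (- \<gamma> - 1) * v powr (\<gamma> + 1)"
    proof -
      have "(\<kappa> / v) powr (- \<gamma> - 1) = \<kappa> powr (- \<gamma> - 1) / v powr (- (\<gamma> + 1))"
        using v assms by (simp add: powr_divide)
      then show ?thesis by (simp only: powr_minus) (simp add: divide_inverse)
    qed
    then have "\<bar>- \<kappa> / v\<^sup>2\<bar> * ?f (\<kappa> / v) =
        (\<kappa> powr 1 * \<kappa> powr (- \<gamma> - 1)) * (v powr (\<gamma> + 1) / v powr 2) * exp (- v)"
      using v assms by (simp add: powr_numeral)
    also have "\<kappa> powr 1 * \<kappa> powr (- \<gamma> - 1) = \<kappa> powr (- \<gamma>)"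
      by (subst powr_add[symmetric]) simp
    also have "v powr (\<gamma> + 1) / v powr 2 = v powr (\<gamma> - 1)"
      by (simp flip: powr_diff)
    finally show ?thesis by (simp add: exp_minus divide_inverse)
  qed
  have "(\<lambda>v. \<bar>- \<kappa> / v\<^sup>2\<bar> * ?f (\<kappa> / v)) absolutely_integrable_on {0<..} \<and>
      integral {0<..} (\<lambda>v. \<bar>- \<kappa> / v\<^sup>2\<bar> * ?f (\<kappa> / v)) = \<kappa> powr (- \<gamma>) * Gamma \<gamma>"
    using iffD1[OF set_integrable_cong[OF refl refl eq] abs]
      trans[OF Henstock_Kurzweil_Integration.integral_cong[OF eq, symmetric] val] by (rule conjI)
  moreover have "((\<lambda>v. \<kappa> / v) has_field_derivative - \<kappa> / v\<^sup>2) (at v within {0<..})" if "v \<in> {0<..}" for v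
    using that by (auto intro!: derivative_eq_intros simp: power2_eq_square)
  moreover have "inj_on (\<lambda>v. \<kappa> / v) {0<..}" using assms by (auto simp: inj_on_def)
  moreover have "(\<lambda>v. \<kappa> / v) ` {0<..} = {0<..}"
  proof safe
    fix t :: real assume "t > 0"
    then show "t \<in> (\<lambda>v. \<kappa> / v) ` {0<..}"
      using assms by (intro image_eqI[of _ _ "\<kappa> / t"]) auto
  qed (use assms in auto)
  ultimately have f: "?f absolutely_integrable_on {0<..}" "integral {0<..} ?f = \<kappa> powr (- \<gamma>) * Gamma \<gamma>"
    using has_absolute_integral_change_of_variables_1'[where S = "{0<..}" and g = "\<lambda>v. \<kappa> / v"
        and g' = "\<lambda>v. - \<kappa> / v\<^sup>2" and f = ?f and b = "\<kappa> powr (- \<gamma>) * Gamma \<gamma>"] by auto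
  have m: "(\<lambda>t. indicator {0<..} t *\<^sub>R ?f t) \<in> borel_measurable lborel" by measurable
  show *: "set_integrable lborel {0<..} ?f"
    using f(1) integrable_completion[OF m] by (simp add: set_integrable_def)
  show "(LINT t:{0<..}|lborel. ?f t) = \<kappa> powr (- \<gamma>) * Gamma \<gamma>"
    using set_borel_integral_eq_integral(2)[OF *] f(2) by simp
qed

text \<open>With \<open>\<alpha> = 2 * s\<close> and \<open>\<beta> = - 1 - s\<close> this is the
  unnormalized weight of the Poisson kernel. General exponents are kept because derivatives in z and
  t only shift them; the value 0 for t \<le> 0 allows integration over the whole space.\<close>

definition time_weight :: "real \<Rightarrow> real \<Rightarrow> real \<Rightarrow> real \<Rightarrow> real" where
  "time_weight \<alpha> \<beta> z t = (if t > 0 then z powr \<alpha> * t powr \<beta> * exp (- z\<^sup>2 / (4 * t)) else 0)"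

lemma time_weight_nonneg: "0 \<le> time_weight \<alpha> \<beta> z t"
  by (simp add: time_weight_def)

lemma time_weight_measurable [measurable]: "time_weight \<alpha> \<beta> z \<in> borel_measurable borel"
  unfolding time_weight_def[abs_def] by measurable

lemma time_weight_integrable:
  assumes "\<beta> < -1" "z > 0"
  shows "integrable lborel (time_weight \<alpha> \<beta> z)"
    and "(LBINT t. time_weight \<alpha> \<beta> z t) = z powr \<alpha> * ((z\<^sup>2 / 4) powr (\<beta> + 1) * Gamma (- \<beta> - 1))"
proof -
  have "- \<beta> - 1 > 0" "z\<^sup>2 / 4 > 0" using assms by auto
  note I = inverse_Gamma_integral[OF this]
  have eq: "time_weight \<alpha> \<beta> z = (\<lambda>t. z powr \<alpha> * (indicator {0<..} t *\<^sub>R (t powr (- (- \<beta> - 1) - 1) * exp (- (z\<^sup>2 / 4) / t))))"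
    by (auto simp: time_weight_def fun_eq_iff)
  show "integrable lborel (time_weight \<alpha> \<beta> z)"
    unfolding eq using I(1) by (intro integrable_mult_right) (simp add: set_integrable_def)
  show "(LBINT t. time_weight \<alpha> \<beta> z t) = z powr \<alpha> * ((z\<^sup>2 / 4) powr (\<beta> + 1) * Gamma (- \<beta> - 1))"
    unfolding eq using I(2) by (simp add: set_lebesgue_integral_def add.commute)
qed

lemma time_weight_DERIV_z:
  assumes "z > 0"
  shows "((\<lambda>z. time_weight \<alpha> \<beta> z t) has_real_derivative
    \<alpha> * time_weight (\<alpha> - 1) \<beta> z t - time_weight (\<alpha> + 1) (\<beta> - 1) z t / 2) (at z)"
proof (cases "t > 0")
  case True
  have D: "((\<lambda>z. z powr \<alpha> * t powr \<beta> * exp (- z\<^sup>2 / (4 * t))) has_real_derivative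
    \<alpha> * z powr (\<alpha> - 1) * t powr \<beta> * exp (- z\<^sup>2 / (4 * t)) +
      z powr \<alpha> * t powr \<beta> * (exp (- z\<^sup>2 / (4 * t)) * (- (2 * z) / (4 * t)))) (at z)"
    using assms True by (auto intro!: derivative_eq_intros simp: powr_diff)
  have *: "z powr (\<alpha> + 1) = z powr \<alpha> * z" "t powr (\<beta> - 1) = t powr \<beta> / t"
    using assms True by (auto simp: powr_add powr_diff)
  have E: "\<alpha> * z powr (\<alpha> - 1) * t powr \<beta> * exp (- z\<^sup>2 / (4 * t)) +
      z powr \<alpha> * t powr \<beta> * (exp (- z\<^sup>2 / (4 * t)) * (- (2 * z) / (4 * t))) =
      \<alpha> * time_weight (\<alpha> - 1) \<beta> z t - time_weight (\<alpha> + 1) (\<beta> - 1) z t / 2"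
    using True by (simp add: time_weight_def * mult_ac)
  have "(\<lambda>z. time_weight \<alpha> \<beta> z t) = (\<lambda>z. z powr \<alpha> * t powr \<beta> * exp (- z\<^sup>2 / (4 * t)))"
    using True by (simp add: time_weight_def)
  then show ?thesis using D unfolding E by (simp only:)
qed (simp add: time_weight_def)

lemma time_weight_DERIV_t:
  assumes "t > 0"
  shows "((\<lambda>t. time_weight \<alpha> \<beta> z t) has_real_derivative
    \<beta> * time_weight \<alpha> (\<beta> - 1) z t + z\<^sup>2 / 4 * time_weight \<alpha> (\<beta> - 2) z t) (at t)"
proof -
  have "((\<lambda>t. z powr \<alpha> * t powr \<beta> * exp (- z\<^sup>2 / (4 * t))) has_real_derivative
     z powr \<alpha> * (\<beta> * t powr (\<beta> - 1)) * exp (- z\<^sup>2 / (4 * t)) +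
      z powr \<alpha> * t powr \<beta> * (exp (- z\<^sup>2 / (4 * t)) * (z\<^sup>2 / (4 * t\<^sup>2)))) (at t)"
    using assms by (auto intro!: derivative_eq_intros simp: powr_diff power2_eq_square field_simps)
  moreover have *: "t powr (\<beta> - 2) = t powr \<beta> / t\<^sup>2"
    using assms by (simp add: powr_diff power2_eq_square)
  have "z powr \<alpha> * (\<beta> * t powr (\<beta> - 1)) * exp (- z\<^sup>2 / (4 * t)) +
      z powr \<alpha> * t powr \<beta> * (exp (- z\<^sup>2 / (4 * t)) * (z\<^sup>2 / (4 * t\<^sup>2))) =
      \<beta> * time_weight \<alpha> (\<beta> - 1) z t + z\<^sup>2 / 4 * time_weight \<alpha> (\<beta> - 2) z t"
    using assms by (simp add: time_weight_def *)
  ultimately have "((\<lambda>t. z powr \<alpha> * t powr \<beta> * exp (- z\<^sup>2 / (4 * t))) has_real_derivative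
    \<beta> * time_weight \<alpha> (\<beta> - 1) z t + z\<^sup>2 / 4 * time_weight \<alpha> (\<beta> - 2) z t) (at t)"
    by simp
  then show ?thesis
    by (rule has_field_derivative_transform_within_open[of _ _ _ "{0<..}"])
       (use assms in \<open>auto simp: time_weight_def\<close>)
qed

lemma powr_le_add_powr:
  assumes "0 < l" "l \<le> z" "z \<le> (r::real)"
  shows "z powr \<alpha> \<le> l powr \<alpha> + r powr \<alpha>"
proof (cases "\<alpha> \<ge> 0")
  case True
  then show ?thesis using assms powr_mono2[of \<alpha> z r] by (simp add: add_increasing)
next
  case False
  then show ?thesis using assms powr_mono2'[of \<alpha> l z] by (simp add: add_increasing2)
qed

text \<open>Supplies a majorant in t that is uniform for z in [l, r]: the exponential grows with z
  decreasing, and the sum of two powers covers both signs of \<open>\<alpha>\<close>.\<close>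

lemma time_weight_mono:
  assumes "0 < l" "l \<le> z" "z \<le> r"
  shows "time_weight \<alpha> \<beta> z t \<le> (l powr \<alpha> + r powr \<alpha>) * time_weight 0 \<beta> l t"
proof (cases "t > 0")
  case True
  have "exp (- z\<^sup>2 / (4 * t)) \<le> exp (- l\<^sup>2 / (4 * t))"
    using assms True by (auto intro!: divide_right_mono power_mono)
  then show ?thesis
    using True assms powr_le_add_powr[OF assms, of \<alpha>]
    by (simp add: time_weight_def) (intro mult_mono mult_right_mono; auto)
qed (simp add: time_weight_def)

section \<open>Smoothness and measurability of the kernel\<close>

context heat_kernel
begin

lemma p_joint_Ck: "Ck_on k (UNIV \<times> {0<..}) (\<lambda>w. p (fst w) y (snd w))"
proof -
  have "\<forall>\<xi> \<tau>. smooth_on (UNIV - {(\<xi>, \<tau>)}) (\<lambda>(x, t). p x \<xi> (t - \<tau>))"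
    using fundamental unfolding heat_fundamental_solution_def by (elim conjE)
  then have "smooth_on (UNIV - {(y, 0)}) (\<lambda>(x, t). p x y (t - 0))" by blast
  then have "smooth_on (UNIV - {(y, 0)}) (\<lambda>w. p (fst w) y (snd w))"
    by (simp add: case_prod_unfold)
  then show ?thesis unfolding smooth_on_def by (auto intro: Ck_on_subset)
qed

definition XP :: "nat list \<Rightarrow> real^'n \<Rightarrow> real^'n \<Rightarrow> real \<Rightarrow> real" where
  "XP J x y t = X_word X J (\<lambda>x'. p x' y t) x"

lemma XP_Nil [simp]: "XP [] x y t = p x y t"
  by (simp add: XP_def)

lemma p_smooth: "t > 0 \<Longrightarrow> smooth_on UNIV (\<lambda>x. p x y t)"
  unfolding smooth_on_def using Ck_on_slice[OF p_joint_Ck, of t] by simp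

lemma XP_smooth: "set J \<subseteq> {1..m} \<Longrightarrow> t > 0 \<Longrightarrow> smooth_on UNIV (\<lambda>x. XP J x y t)"
  unfolding XP_def using smooth_on_X_word[OF smooth_X p_smooth] by simp

lemma XP_differentiable: "set J \<subseteq> {1..m} \<Longrightarrow> t > 0 \<Longrightarrow> (\<lambda>x. XP J x y t) differentiable (at x)"
  using smooth_on_differentiable[OF XP_smooth] by simp

lemma XP_Cons: "XP (j # J) x y t = FD (\<lambda>x. XP J x y t) x (X j x)"
  by (simp add: XP_def X_word_Cons vf_apply_def)

lemma XP_joint_Ck: "set J \<subseteq> {1..m} \<Longrightarrow> Ck_on k (UNIV \<times> {0<..}) (\<lambda>w. XP J (fst w) y (snd w))"
proof (induction J arbitrary: k)
  case Nil
  then show ?case using p_joint_Ck by simp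
next
  case (Cons j J)
  let ?S = "UNIV \<times> {0<..} :: ((real^'n) \<times> real) set" and ?f = "\<lambda>w. XP J (fst w) y (snd w)"
  have o: "open ?S" by (simp add: open_Times)
  have IH: "Ck_on (Suc k) ?S ?f" using Cons by simp
  have "Ck_on k ?S (\<lambda>w. X j (fst w))"
    using Cons.prems by (intro Ck_on_fst smooth_on_imp_Ck_on smooth_X) auto
  then have V: "Ck_on k ?S (\<lambda>w. (X j (fst w), 0::real))"
    using Ck_on_bounded_linear[OF bounded_linear_Pair[OF bounded_linear_ident bounded_linear_zero] o] by blast
  have eq: "FD ?f w (X j (fst w), 0) = XP (j # J) (fst w) y (snd w)" if w: "w \<in> ?S" for w
  proof -
    have "?f differentiable (at (fst w, snd w))" using IH w by auto
    from frechet_derivative_at[OF frechet_derivative_slice_fst[OF this], symmetric]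
    show ?thesis by (simp add: XP_Cons)
  qed
  show ?case
    by (rule Ck_on_cong[OF o eq Ck_on_directional[OF o IH V]])
qed

lemma XP_continuous_t: "set J \<subseteq> {1..m} \<Longrightarrow> continuous_on {0<..} (\<lambda>t. XP J x y t)"
  by (rule continuous_on_compose2[OF Ck_on_imp_continuous_on[OF XP_joint_Ck], of J _ "\<lambda>t. (x, t)" y, simplified])
     (auto intro!: continuous_intros)

text \<open>Regularity of \<open>p\<close> is given in (x, t) for each fixed pole. Measurability in
  the pole is inherited by derivatives in \<open>x\<close> because they are limits of difference
  quotients in which \<open>x\<close> and the direction \<open>X j x\<close> do not depend on
  \<open>y\<close>.\<close>

lemma XP_measurable_y:
  assumes "t > 0"
  shows "set J \<subseteq> {1..m} \<Longrightarrow> (\<lambda>y. XP J x y t) \<in> borel_measurable borel"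
proof (induction J arbitrary: x)
  case Nil
  then show ?case using borel_measurable_integrable[OF p_integrable[OF assms]] by simp
next
  case (Cons j J)
  have J: "set J \<subseteq> {1..m}" using Cons by simp
  define h where "h k = inverse (real (Suc k))" for k
  have "filterlim h (at 0) sequentially"
    using LIMSEQ_inverse_real_of_nat by (auto simp: filterlim_at h_def[abs_def])
  then have lim: "(\<lambda>k. (XP J (x + (0 + h k) *\<^sub>R X j x) y t - XP J (x + 0 *\<^sub>R X j x) y t) / h k) \<longlonglongrightarrow> XP (j # J) x y t" for y
    using directional_DERIV[of "\<lambda>x. XP J x y t" x 0 "X j x"] XP_differentiable[OF J assms]
    by (auto simp: DERIV_def XP_Cons dest: filterlim_compose)
  show ?case
    by (rule borel_measurable_LIMSEQ_real[OF lim]) (intro borel_measurable_divide borel_measurable_diff Cons.IH J borel_measurable_const)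
qed

text \<open>Continuity in t and measurability in y combine through the Caratheodory criterion, with
  t as the continuous variable.\<close>

lemma XP_measurable:
  assumes J: "set J \<subseteq> {1..m}"
  shows "(\<lambda>q. indicator {0<..} (snd q) * XP J x (fst q) (snd q)) \<in> borel_measurable (borel :: ((real^'n) \<times> real) measure)"
proof -
  have "(\<lambda>w. indicator {0<..} (fst w) * XP J x (snd w) (fst w)) \<in> borel_measurable (borel \<Otimes>\<^sub>M borel)"
    by (rule borel_measurable_caratheodory[OF open_greaterThan, of 0 "\<lambda>t y. XP J x y t"])
       (auto intro!: XP_measurable_y XP_continuous_t J)
  then have *: "(\<lambda>w. indicator {0<..} (fst w) * XP J x (snd w) (fst w)) \<in> borel_measurable borel"
    by (simp add: borel_prod)
  have "(\<lambda>q. (snd q, fst q)) \<in> borel_measurable (borel :: ((real^'n) \<times> real) measure)"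
    by (intro borel_measurable_continuous_onI continuous_intros)
  from measurable_compose[OF this *] show ?thesis by simp
qed

text \<open>The same neighbourhood and coefficients serve for all words, all poles \<open>y\<close>
  and all times. So the coefficients leave the integral over (y, t), and an x-derivative of an
  integral becomes a combination of integrals with longer words.\<close>

definition frame :: "(real^'n) set \<Rightarrow> (real^'n \<Rightarrow> ((real^'n \<Rightarrow> real) \<times> nat list) list) \<Rightarrow> bool" where
  "frame N \<Lambda> \<longleftrightarrow> open N \<and> (\<forall>v. \<forall>e\<in>set (\<Lambda> v). smooth_on N (fst e) \<and> set (snd e) \<subseteq> {1..m}) \<and>
    (\<forall>J v y t x. set J \<subseteq> {1..m} \<longrightarrow> t > 0 \<longrightarrow> x \<in> N \<longrightarrow>
       FD (\<lambda>x. XP J x y t) x v = (\<Sum>e\<leftarrow>\<Lambda> v. fst e x * XP (snd e @ J) x y t))"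

lemma frame_exists: "\<exists>N \<Lambda>. frame N \<Lambda> \<and> x0 \<in> N"
proof -
  obtain N and \<Lambda> :: "real^'n \<Rightarrow> ((real^'n \<Rightarrow> real) \<times> nat list) list"
    where N: "open N" "x0 \<in> N" and L: "\<And>v e J. (e, J) \<in> set (\<Lambda> v) \<Longrightarrow> smooth_on N e \<and> set J \<subseteq> {1..m}"
    and F: "\<And>v f x. smooth_on UNIV f \<Longrightarrow> x \<in> N \<Longrightarrow>
       FD f x v = (\<Sum>(e, J)\<leftarrow>\<Lambda> v. e x * X_word X J f x)"
    using hormander_local_frame[OF smooth_X hormander, where ?x0.0 = x0] by blast
  have "FD (\<lambda>x. XP J x y t) x v = (\<Sum>e\<leftarrow>\<Lambda> v. fst e x * XP (snd e @ J) x y t)"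
    if "set J \<subseteq> {1..m}" "t > 0" "x \<in> N" for J v y t x
    using F[OF XP_smooth, OF that, of y v] by (simp add: XP_def X_word_append case_prod_unfold)
  moreover have "smooth_on N (fst e) \<and> set (snd e) \<subseteq> {1..m}" if "e \<in> set (\<Lambda> v)" for e v
    using L[of "fst e" "snd e" v] that by simp
  ultimately have "frame N \<Lambda>" using N(1) unfolding frame_def by blast
  then show ?thesis using N(2) by blast
qed

lemma frame_open: "frame N \<Lambda> \<Longrightarrow> open N"
  by (simp add: frame_def)

lemma frame_smooth: "frame N \<Lambda> \<Longrightarrow> e \<in> set (\<Lambda> v) \<Longrightarrow> smooth_on N (fst e)"
  and frame_words: "frame N \<Lambda> \<Longrightarrow> e \<in> set (\<Lambda> v) \<Longrightarrow> set (snd e) \<subseteq> {1..m}"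
  unfolding frame_def by blast+

lemma frame_derivative:
  "frame N \<Lambda> \<Longrightarrow> set J \<subseteq> {1..m} \<Longrightarrow> t > 0 \<Longrightarrow> x \<in> N \<Longrightarrow>
    FD (\<lambda>x. XP J x y t) x v = (\<Sum>e\<leftarrow>\<Lambda> v. fst e x * XP (snd e @ J) x y t)"
  unfolding frame_def by blast

end

section \<open>Smoothness of the extension\<close>

lemma Ck_on_locally:
  assumes "\<And>w. w \<in> S \<Longrightarrow> \<exists>T. open T \<and> w \<in> T \<and> Ck_on k T f"
  shows "Ck_on k S f"
  using assms
proof (induction k arbitrary: f)
  case 0
  then show ?case
    by (metis Ck_on.simps(1) continuous_at_imp_continuous_on continuous_on_eq_continuous_at)
next
  case (Suc k)
  then show ?case by (auto simp: Suc.IH) (metis Ck_on.simps(2) Suc.IH Suc.prems)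
qed

lemma has_derivative_Pair_linear:
  "(f has_derivative f') (at (fst w)) \<Longrightarrow> ((\<lambda>w. f (fst w)) has_derivative (\<lambda>v. f' (fst v))) (at w)"
  by (rule has_derivative_compose[OF has_derivative_fst[OF has_derivative_ident]])

locale heat_extension = heat_kernel m X p
  for m :: nat and X :: "nat \<Rightarrow> real^'n \<Rightarrow> real^'n" and p :: "real^'n \<Rightarrow> real^'n \<Rightarrow> real \<Rightarrow> real" +
  fixes u :: "real^'n \<Rightarrow> real" and B :: real
  assumes u_cont: "continuous_on UNIV u" and u_bound: "\<And>y. \<bar>u y\<bar> \<le> B"
begin

lemma u_measurable [measurable]: "u \<in> borel_measurable borel"
  using u_cont by (rule borel_measurable_continuous_onI)

lemma B_nonneg: "0 \<le> B"
  using u_bound[of 0] by linarith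

text \<open>Here \<open>w = (x, z)\<close> is the point of the half space and
  \<open>q = (y, t)\<close> the integration variable. Space and time are integrated together, so
  that a single measure space carries all L1 estimates.\<close>

definition H :: "real \<Rightarrow> real \<Rightarrow> nat list \<Rightarrow> (real^'n) \<times> real \<Rightarrow> (real^'n) \<times> real \<Rightarrow> real" where
  "H \<alpha> \<beta> J w q = time_weight \<alpha> \<beta> (snd w) (snd q) * XP J (fst w) (fst q) (snd q) * u (fst q)"

definition H' :: "real \<Rightarrow> real \<Rightarrow> nat list \<Rightarrow> (real^'n) \<times> real \<Rightarrow> (real^'n) \<times> real \<Rightarrow> (real^'n) \<times> real \<Rightarrow> real" where
  "H' \<alpha> \<beta> J w q v =
     time_weight \<alpha> \<beta> (snd w) (snd q) * FD (\<lambda>x. XP J x (fst q) (snd q)) (fst w) (fst v) * u (fst q)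
     + snd v * (\<alpha> * H (\<alpha> - 1) \<beta> J w q - H (\<alpha> + 1) (\<beta> - 1) J w q / 2)"

definition F :: "real \<Rightarrow> real \<Rightarrow> nat list \<Rightarrow> (real^'n) \<times> real \<Rightarrow> real" where
  "F \<alpha> \<beta> J w = (LBINT q. H \<alpha> \<beta> J w q)"

lemma H_eq_0: "snd q \<le> 0 \<Longrightarrow> H \<alpha> \<beta> J w q = 0"
  by (simp add: H_def time_weight_def)

lemma H'_eq_0: "snd q \<le> 0 \<Longrightarrow> H' \<alpha> \<beta> J w q v = 0"
  by (simp add: H'_def H_eq_0 time_weight_def)

lemma measurable_fst_borel [measurable]: "fst \<in> borel_measurable (borel :: ((real^'n) \<times> real) measure)"
  and measurable_snd_borel [measurable]: "snd \<in> borel_measurable (borel :: ((real^'n) \<times> real) measure)"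
  by (auto intro!: borel_measurable_continuous_onI continuous_intros)

lemma H_measurable:
  assumes "set J \<subseteq> {1..m}"
  shows "H \<alpha> \<beta> J w \<in> borel_measurable borel"
proof -
  have "H \<alpha> \<beta> J w = (\<lambda>q. time_weight \<alpha> \<beta> (snd w) (snd q) * (indicator {0<..} (snd q) * XP J (fst w) (fst q) (snd q)) * u (fst q))"
    by (auto simp: H_def time_weight_def fun_eq_iff)
  then show ?thesis using XP_measurable[OF assms, of "fst w"] by simp
qed

text \<open>Integrate in y first: the kernel at time \<open>c * t\<close> has mass 1 whatever
  \<open>x\<close> is. What is left is a time weight with exponent lowered by half the length of the
  word, still less than -1. This gives one constant for all \<open>x\<close> and for all z in
  [l, r].\<close>

lemma H_bound:
  assumes J: "set J \<subseteq> {1..m}" and \<beta>: "\<beta> < -1" and l: "0 < l"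
  obtains K where "K \<ge> 0" "\<And>x z. l \<le> z \<Longrightarrow> z \<le> r \<Longrightarrow> integrable lborel (H \<alpha> \<beta> J (x, z))"
    "\<And>x z. l \<le> z \<Longrightarrow> z \<le> r \<Longrightarrow> (LBINT q. \<bar>H \<alpha> \<beta> J (x, z) q\<bar>) \<le> K"
proof -
  obtain c where c: "c > 0" and ex: "\<And>J. set J \<subseteq> {1..m} \<Longrightarrow> \<exists>C>0. \<forall>x y t. t > 0 \<longrightarrow>
    \<bar>X_word X J (\<lambda>x'. p x' y t) x\<bar> \<le> C * t powr (- real (length J) / 2) * p x y (c * t)"
    by (rule X_word_bound) blast
  obtain C where C: "C > 0" "\<And>x y t. t > 0 \<Longrightarrow>
      \<bar>XP J x y t\<bar> \<le> C * t powr (- real (length J) / 2) * p x y (c * t)"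
    using ex[OF J] unfolding XP_def by blast
  define \<beta>' where "\<beta>' = \<beta> - real (length J) / 2"
  have \<beta>': "\<beta>' < -1" using \<beta> by (simp add: \<beta>'_def)
  define A where "A = (l powr \<alpha> + r powr \<alpha>) * C * B"
  have A: "A \<ge> 0" using C B_nonneg by (simp add: A_def)
  define I where "I = (LBINT t. time_weight 0 \<beta>' l t)"
  have I0: "I \<ge> 0" unfolding I_def by (intro Bochner_Integration.integral_nonneg time_weight_nonneg)
  \<comment> \<open>The majorant depends on \<open>x\<close>; its integral \<open>A * I\<close> does
    not. It vanishes for t \<le> 0 by its indicator, as \<open>H\<close> does.\<close>
  define D where "D x q = A * time_weight 0 \<beta>' l (snd q) * (indicator {0<..} (c * snd q) * p x (fst q) (c * snd q))" for x and q :: "(real^'n) \<times> real"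
  have D0: "D x q \<ge> 0" for x q
    using A p_pos[of "c * snd q" x "fst q"] by (auto simp: D_def time_weight_nonneg indicator_def less_imp_le)
  have pm: "(\<lambda>q. indicator {0<..} (c * snd q) * p x (fst q) (c * snd q)) \<in> borel_measurable (borel :: ((real^'n) \<times> real) measure)" for x
  proof -
    have s: "(\<lambda>q. (fst q, c * snd q)) \<in> borel_measurable (borel :: ((real^'n) \<times> real) measure)"
      by (intro borel_measurable_continuous_onI continuous_intros)
    show ?thesis using measurable_compose[OF s XP_measurable[of "[]" x]] by simp
  qed
  have Dm: "D x \<in> borel_measurable borel" for x
    unfolding D_def[abs_def] using pm[of x] by measurable
  have nnD: "(\<integral>\<^sup>+q. ennreal (D x q) \<partial>lborel) = ennreal (A * I)" for x
  proof -
    have "(\<integral>\<^sup>+q. ennreal (D x q) \<partial>lborel) = (\<integral>\<^sup>+q. ennreal (D x q) \<partial>(lborel \<Otimes>\<^sub>M lborel))"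
      by (simp add: lborel_prod)
    also have "\<dots> = (\<integral>\<^sup>+t. (\<integral>\<^sup>+y. ennreal (D x (y, t)) \<partial>lborel) \<partial>lborel)"
      by (rule lborel_pair.nn_integral_snd[symmetric]) (use Dm[of x] in \<open>simp add: lborel_prod\<close>)
    also have "\<dots> = (\<integral>\<^sup>+t. ennreal (A * time_weight 0 \<beta>' l t) \<partial>lborel)"
    proof (rule nn_integral_cong)
      fix t :: real
      show "(\<integral>\<^sup>+y. ennreal (D x (y, t)) \<partial>lborel) = ennreal (A * time_weight 0 \<beta>' l t)"
      proof (cases "t > 0")
        case True
        have ct: "c * t > 0" using c True by simp
        have "(\<integral>\<^sup>+y. ennreal (D x (y, t)) \<partial>lborel) =
            (\<integral>\<^sup>+y. ennreal (A * time_weight 0 \<beta>' l t) * ennreal (p x y (c * t)) \<partial>lborel)"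
          using ct A p_pos[OF ct, of x]
          by (intro nn_integral_cong) (simp add: D_def ennreal_mult less_imp_le time_weight_nonneg)
        also have "\<dots> = ennreal (A * time_weight 0 \<beta>' l t) * 1"
          using borel_measurable_integrable[OF p_integrable[OF ct, of x]]
          by (subst nn_integral_cmult) (auto simp: p_nn_integral[OF ct])
        finally show ?thesis by simp
      qed (simp add: D_def time_weight_def)
    qed
    also have "\<dots> = ennreal (A * I)"
      unfolding I_def using A time_weight_integrable(1)[OF \<beta>' l, of 0]
      by (subst nn_integral_eq_integral) (auto simp: time_weight_nonneg)
    finally show ?thesis .
  qed
  have HD: "\<bar>H \<alpha> \<beta> J (x, z) q\<bar> \<le> D x q" if z: "l \<le> z" "z \<le> r" for x z q
  proof (cases "snd q > 0")
    case True
    have "\<bar>H \<alpha> \<beta> J (x, z) q\<bar> = time_weight \<alpha> \<beta> z (snd q) * \<bar>XP J x (fst q) (snd q)\<bar> * \<bar>u (fst q)\<bar>"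
      by (simp add: H_def abs_mult time_weight_nonneg)
    also have "\<dots> \<le> ((l powr \<alpha> + r powr \<alpha>) * time_weight 0 \<beta> l (snd q)) *
        (C * (snd q) powr (- real (length J) / 2) * p x (fst q) (c * snd q)) * B"
      using True z l C c p_pos[of "c * snd q" x "fst q"]
      by (intro mult_mono time_weight_mono C(2) u_bound) (auto simp: time_weight_nonneg intro!: mult_nonneg_nonneg add_nonneg_nonneg)
    also have "\<dots> = A * (time_weight 0 \<beta> l (snd q) * (snd q) powr (- real (length J) / 2)) * p x (fst q) (c * snd q)"
      by (simp add: A_def mult_ac)
    also have "time_weight 0 \<beta> l (snd q) * (snd q) powr (- real (length J) / 2) = time_weight 0 \<beta>' l (snd q)"
      using True by (simp add: time_weight_def \<beta>'_def powr_diff powr_minus_divide)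
    also have "A * time_weight 0 \<beta>' l (snd q) * p x (fst q) (c * snd q) = D x q"
      using True c by (simp add: D_def)
    finally show ?thesis .
  qed (use D0 H_eq_0 in auto)
  have nnH: "(\<integral>\<^sup>+q. ennreal \<bar>H \<alpha> \<beta> J (x, z) q\<bar> \<partial>lborel) \<le> ennreal (A * I)" if "l \<le> z" "z \<le> r" for x z
    unfolding nnD[of x, symmetric] by (intro nn_integral_mono ennreal_leI HD that)
  have int: "integrable lborel (H \<alpha> \<beta> J (x, z))" if "l \<le> z" "z \<le> r" for x z
  proof (rule integrableI_bounded)
    show "(\<integral>\<^sup>+q. ennreal (norm (H \<alpha> \<beta> J (x, z) q)) \<partial>lborel) < \<infinity>"
      using le_less_trans[OF nnH[OF that, of x]] by simp
  qed (use H_measurable[OF J] in simp)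
  show thesis
  proof (rule that[of "A * I"])
    show "A * I \<ge> 0" using A I0 by simp
    show "integrable lborel (H \<alpha> \<beta> J (x, z))" if "l \<le> z" "z \<le> r" for x z by (rule int[OF that])
    show "(LBINT q. \<bar>H \<alpha> \<beta> J (x, z) q\<bar>) \<le> A * I" if "l \<le> z" "z \<le> r" for x z
      using nnH[OF that, of x] int[OF that, of x] A I0
      by (subst (asm) nn_integral_eq_integral) (auto simp: ennreal_le_iff)
  qed
qed

lemma H_integrable:
  assumes "set J \<subseteq> {1..m}" "\<beta> < -1" "snd w > 0"
  shows "integrable lborel (H \<alpha> \<beta> J w)"
  using H_bound[OF assms, of "snd w" \<alpha>] by (metis order_refl prod.collapse)

lemma H_has_derivative:
  assumes J: "set J \<subseteq> {1..m}" and z: "snd w > 0"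
  shows "((\<lambda>w. H \<alpha> \<beta> J w q) has_derivative H' \<alpha> \<beta> J w q) (at w)"
proof (cases "snd q > 0")
  case True
  let ?T = "\<lambda>\<alpha> \<beta>. time_weight \<alpha> \<beta> (snd w) (snd q)"
  have "((\<lambda>z. time_weight \<alpha> \<beta> z (snd q)) has_derivative (\<lambda>h. (\<alpha> * ?T (\<alpha> - 1) \<beta> - ?T (\<alpha> + 1) (\<beta> - 1) / 2) * h)) (at (snd w))"
    using time_weight_DERIV_z[OF z, of \<alpha> \<beta> "snd q"] by (simp add: has_field_derivative_def)
  from has_derivative_compose[OF has_derivative_snd[OF has_derivative_ident] this]
  have "((\<lambda>w. time_weight \<alpha> \<beta> (snd w) (snd q)) has_derivative
      (\<lambda>v. (\<alpha> * ?T (\<alpha> - 1) \<beta> - ?T (\<alpha> + 1) (\<beta> - 1) / 2) * snd v)) (at w)" .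
  moreover have "((\<lambda>w. XP J (fst w) (fst q) (snd q)) has_derivative
      (\<lambda>v. FD (\<lambda>x. XP J x (fst q) (snd q)) (fst w) (fst v))) (at w)"
    by (rule has_derivative_Pair_linear[OF has_derivative_frechet[OF XP_differentiable[OF J True]]])
  ultimately show ?thesis
    unfolding H_def
    by (rule has_derivative_eq_rhs[OF has_derivative_mult_left[OF has_derivative_mult]])
       (simp add: H'_def H_def fun_eq_iff algebra_simps)
next
  case False
  then have "(\<lambda>w. H \<alpha> \<beta> J w q) = (\<lambda>w. 0)" "H' \<alpha> \<beta> J w q = (\<lambda>v. 0)"
    by (auto simp: fun_eq_iff H_eq_0 H'_eq_0)
  then show ?thesis by simp
qed

lemma H'_continuous:
  assumes J: "set J \<subseteq> {1..m}"
  shows "continuous_on (UNIV \<times> {0<..}) (\<lambda>w. H' \<alpha> \<beta> J w q v)"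
proof (cases "snd q > 0")
  case True
  have "continuous_on UNIV (\<lambda>x. FD (\<lambda>x. XP J x (fst q) (snd q)) x (fst v))"
    using smooth_on_imp_Ck_on[OF XP_smooth[OF J True], of 1] by simp
  then have "continuous_on (UNIV \<times> {0<..}) (\<lambda>w. FD (\<lambda>x. XP J x (fst q) (snd q)) (fst w) (fst v))"
    by (rule continuous_on_compose2) (auto intro!: continuous_intros)
  moreover have "continuous_on (UNIV \<times> {0<..}) (\<lambda>w. H \<alpha> \<beta> J w q)" for \<alpha> \<beta>
  proof (intro continuous_at_imp_continuous_on ballI)
    fix w :: "(real^'n) \<times> real" assume "w \<in> UNIV \<times> {0<..}"
    then show "isCont (\<lambda>w. H \<alpha> \<beta> J w q) w"
      by (intro has_derivative_continuous[OF H_has_derivative[OF J]]) auto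
  qed
  moreover have "continuous_on (UNIV \<times> {0<..}) (\<lambda>w :: (real^'n) \<times> real. time_weight \<alpha> \<beta> (snd w) (snd q))"
    unfolding time_weight_def using True by (auto intro!: continuous_intros)
  ultimately show ?thesis
    unfolding H'_def by (intro continuous_intros) auto
qed (simp add: H'_eq_0)

text \<open>Writes the derivative as a finite combination of functions \<open>H\<close> with
  coefficients depending on \<open>w\<close> alone. Integrability, bounds in mean and L1 continuity
  of \<open>H'\<close> are thereby reduced to those of \<open>H\<close>.\<close>

lemma H'_frame:
  assumes fr: "frame N \<Lambda>" and J: "set J \<subseteq> {1..m}" and x: "fst w \<in> N"
  shows "H' \<alpha> \<beta> J w q v = (\<Sum>e\<leftarrow>\<Lambda> (fst v). fst e (fst w) * H \<alpha> \<beta> (snd e @ J) w q)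
    + snd v * (\<alpha> * H (\<alpha> - 1) \<beta> J w q - H (\<alpha> + 1) (\<beta> - 1) J w q / 2)"
proof (cases "snd q > 0")
  case True
  show ?thesis
    unfolding H'_def frame_derivative[OF fr J True x]
    by (simp add: H_def[of \<alpha> \<beta> "_ @ _"] case_prod_unfold sum_list_const_mult[symmetric] sum_list_mult_const[symmetric] mult_ac)
next
  case False
  have "(\<Sum>e\<leftarrow>\<Lambda> (fst v). fst e (fst w) * H \<alpha> \<beta> (snd e @ J) w q) = (\<Sum>e\<leftarrow>\<Lambda> (fst v). 0)"
    using False by (intro arg_cong[of _ _ sum_list] map_cong refl) (simp add: H_eq_0)
  then show ?thesis using False by (simp add: H'_eq_0 H_eq_0)
qed

lemma integrable_sum_list:
  assumes "\<And>i. i \<in> set L \<Longrightarrow> integrable M (f i)"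
  shows "integrable M (\<lambda>q. \<Sum>i\<leftarrow>L. (f i q :: real))" "(LINT q|M. (\<Sum>i\<leftarrow>L. f i q)) = (\<Sum>i\<leftarrow>L. (LINT q|M. f i q))"
proof -
  have "integrable M (\<lambda>q. \<Sum>i\<leftarrow>L. (f i q :: real)) \<and> (LINT q|M. (\<Sum>i\<leftarrow>L. f i q)) = (\<Sum>i\<leftarrow>L. (LINT q|M. f i q))"
    using assms by (induction L) auto
  then show "integrable M (\<lambda>q. \<Sum>i\<leftarrow>L. (f i q :: real))" "(LINT q|M. (\<Sum>i\<leftarrow>L. f i q)) = (\<Sum>i\<leftarrow>L. (LINT q|M. f i q))"
    by auto
qed

lemma H'_integrable:
  assumes J: "set J \<subseteq> {1..m}" and \<beta>: "\<beta> < -1" and z: "snd w > 0"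
  shows "integrable lborel (\<lambda>q. H' \<alpha> \<beta> J w q v)"
proof -
  obtain N \<Lambda> where fr: "frame N \<Lambda>" and N: "fst w \<in> N"
    using frame_exists by blast
  have "integrable lborel (\<lambda>q. \<Sum>e\<leftarrow>\<Lambda> (fst v). fst e (fst w) * H \<alpha> \<beta> (snd e @ J) w q)"
    using frame_words[OF fr] J by (intro integrable_sum_list integrable_mult_right H_integrable \<beta> z) auto
  then show ?thesis
    unfolding H'_frame[OF fr J N]
    using \<beta> z J by (intro Bochner_Integration.integrable_add Bochner_Integration.integrable_diff integrable_mult_right integrable_divide H_integrable) auto
qed

text \<open>By the Lipschitz criterion it is enough to bound \<open>H'\<close> in mean on a box
  around \<open>w\<close>. The frame coefficients are bounded on a closed ball inside the frame's
  domain, the factors \<open>H\<close> by the uniform estimate.\<close>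

lemma H_L1_cont:
  assumes J: "set J \<subseteq> {1..m}" and \<beta>: "\<beta> < -1" and z: "snd w > 0"
  shows "L1_cont lborel (H \<alpha> \<beta> J) w"
proof -
  obtain N \<Lambda> where fr: "frame N \<Lambda>" and N: "fst w \<in> N"
      using frame_exists by blast
  obtain \<rho> where \<rho>: "\<rho> > 0" "cball (fst w) \<rho> \<subseteq> N" using N frame_open[OF fr] by (meson open_contains_cball)
  \<comment> \<open>An interval around z bounded away from 0, as the uniform estimate
    requires.\<close>
  define l r where "l = snd w / 2" and "r = 2 * snd w"
  define S where "S = ball (fst w) \<rho> \<times> {l<..<r}"
  have l: "l > 0" using z by (simp add: l_def)
  have S: "open S" "w \<in> S" "\<And>w'. w' \<in> S \<Longrightarrow> fst w' \<in> cball (fst w) \<rho> \<and> l \<le> snd w' \<and> snd w' \<le> r"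
    using z \<rho> by (auto simp: S_def open_Times l_def r_def mem_Times_iff)
  have SN: "fst w' \<in> N" "snd w' > 0" if "w' \<in> S" for w' using S(3)[OF that] \<rho> l by auto
  have bH: "\<exists>K\<ge>0. \<forall>w'\<in>S. (LBINT q. \<bar>H \<alpha> \<beta> J w' q\<bar>) \<le> K"
    if "set J \<subseteq> {1..m}" "\<beta> < -1" for \<alpha> \<beta> J
    by (rule H_bound[OF that l, where r = r and \<alpha> = \<alpha>]) (metis S(3) prod.collapse)
  have bprod: "\<exists>K\<ge>0. \<forall>w'\<in>S. (LBINT q. \<bar>e (fst w') * H \<alpha> \<beta> J' w' q\<bar>) \<le> K"
    if e: "smooth_on N e" and J': "set J' \<subseteq> {1..m}" for e J'
  proof -
    have "compact (e ` cball (fst w) \<rho>)"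
      by (intro compact_continuous_image continuous_on_subset[OF Ck_on_imp_continuous_on[OF smooth_on_imp_Ck_on[OF e]] \<rho>(2)]) simp
    then obtain E where E: "E > 0" "\<And>x. x \<in> cball (fst w) \<rho> \<Longrightarrow> \<bar>e x\<bar> \<le> E"
      using compact_imp_bounded[of "e ` cball (fst w) \<rho>"] unfolding bounded_pos by fastforce
    obtain K where K: "K \<ge> 0" "\<And>w'. w' \<in> S \<Longrightarrow> (LBINT q. \<bar>H \<alpha> \<beta> J' w' q\<bar>) \<le> K"
      using bH[OF J' \<beta>] by blast
    have "(LBINT q. \<bar>e (fst w') * H \<alpha> \<beta> J' w' q\<bar>) \<le> E * K" if "w' \<in> S" for w'
      using mult_mono[OF E(2) K(2)[OF that]] S(3)[OF that] E(1) K(1) by (simp add: abs_mult)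
    then show ?thesis using E K by (intro exI[of _ "E * K"]) auto
  qed
  have badd: "\<exists>K\<ge>0. \<forall>w'\<in>S. (LBINT q. \<bar>f w' q + g w' q\<bar>) \<le> K"
    if b: "\<exists>K\<ge>0. \<forall>w'\<in>S. (LBINT q. \<bar>f w' q\<bar>) \<le> K" "\<exists>K\<ge>0. \<forall>w'\<in>S. (LBINT q. \<bar>g w' q\<bar>) \<le> K"
      and i: "\<And>w'. w' \<in> S \<Longrightarrow> integrable lborel (f w')" "\<And>w'. w' \<in> S \<Longrightarrow> integrable lborel (g w')"
    for f g :: "(real^'n) \<times> real \<Rightarrow> (real^'n) \<times> real \<Rightarrow> real"
  proof -
    obtain K1 K2 where K: "K1 \<ge> 0" "K2 \<ge> 0" "\<And>w'. w' \<in> S \<Longrightarrow> (LBINT q. \<bar>f w' q\<bar>) \<le> K1"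
      "\<And>w'. w' \<in> S \<Longrightarrow> (LBINT q. \<bar>g w' q\<bar>) \<le> K2" using b by blast
    have "(LBINT q. \<bar>f w' q + g w' q\<bar>) \<le> K1 + K2" if "w' \<in> S" for w'
    proof -
      have "(LBINT q. \<bar>f w' q + g w' q\<bar>) \<le> (LBINT q. \<bar>f w' q\<bar> + \<bar>g w' q\<bar>)"
        using i(1)[OF that] i(2)[OF that]
        by (intro integral_mono) auto
      then show ?thesis
        using K(3,4)[OF that] i(1)[OF that] i(2)[OF that] by simp
    qed
    then show ?thesis using K by (intro exI[of _ "K1 + K2"]) auto
  qed
  have bsum: "\<exists>K\<ge>0. \<forall>w'\<in>S. (LBINT q. \<bar>\<Sum>e\<leftarrow>L. fst e (fst w') * H \<alpha> \<beta> (snd e @ J) w' q\<bar>) \<le> K"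
    if "\<And>e. e \<in> set L \<Longrightarrow> smooth_on N (fst e) \<and> set (snd e) \<subseteq> {1..m}" for L
    using that
  proof (induction L)
    case (Cons a L)
    have a: "smooth_on N (fst a)" "set (snd a @ J) \<subseteq> {1..m}"
      using Cons.prems[of a] J by auto
    have "\<exists>K\<ge>0. \<forall>w'\<in>S. (LBINT q. \<bar>\<Sum>e\<leftarrow>L. fst e (fst w') * H \<alpha> \<beta> (snd e @ J) w' q\<bar>) \<le> K"
      using Cons by simp
    moreover have "integrable lborel (\<lambda>q. \<Sum>e\<leftarrow>L. fst e (fst w') * H \<alpha> \<beta> (snd e @ J) w' q)" if "w' \<in> S" for w'
      using Cons.prems J SN[OF that] by (intro integrable_sum_list integrable_mult_right H_integrable \<beta>) auto
    ultimately show ?case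
      using bprod[OF a] H_integrable[OF a(2) \<beta> SN(2)] by (simp add: badd)
  qed auto
  have bH': "\<exists>K\<ge>0. \<forall>w'\<in>S. (LBINT q. \<bar>H' \<alpha> \<beta> J w' q v\<bar>) \<le> K" for v
  proof -
    have i: "integrable lborel (H \<alpha> \<beta> J w')" if "\<beta> < -1" "w' \<in> S" for \<alpha> \<beta> w'
      by (intro H_integrable J that SN)
    have "\<exists>K\<ge>0. \<forall>w'\<in>S. (LBINT q. \<bar>c * H \<alpha> \<beta> J w' q\<bar>) \<le> K" if \<beta>: "\<beta> < -1" for c \<alpha> \<beta>
    proof -
      obtain K where "K \<ge> 0" "\<And>w'. w' \<in> S \<Longrightarrow> (LBINT q. \<bar>H \<alpha> \<beta> J w' q\<bar>) \<le> K"
        using bH[OF J \<beta>] by blast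
      then show ?thesis
        by (intro exI[of _ "\<bar>c\<bar> * K"]) (auto simp: abs_mult intro!: mult_left_mono)
    qed
    note bc = this
    have B1: "\<exists>K\<ge>0. \<forall>w'\<in>S. (LBINT q. \<bar>(snd v * \<alpha>) * H (\<alpha> - 1) \<beta> J w' q + (- snd v / 2) * H (\<alpha> + 1) (\<beta> - 1) J w' q\<bar>) \<le> K"
      using \<beta> by (intro badd bc integrable_mult_right i) auto
    have I1: "integrable lborel (\<lambda>q. (snd v * \<alpha>) * H (\<alpha> - 1) \<beta> J w' q + (- snd v / 2) * H (\<alpha> + 1) (\<beta> - 1) J w' q)" if "w' \<in> S" for w'
      using \<beta> i that by (intro Bochner_Integration.integrable_add integrable_mult_right) auto
    have I2: "integrable lborel (\<lambda>q. \<Sum>e\<leftarrow>\<Lambda> (fst v). fst e (fst w') * H \<alpha> \<beta> (snd e @ J) w' q)" if "w' \<in> S" for w'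
      using frame_words[OF fr] J SN[OF that] by (intro integrable_sum_list integrable_mult_right H_integrable \<beta>) auto
    have B2: "\<exists>K\<ge>0. \<forall>w'\<in>S. (LBINT q. \<bar>\<Sum>e\<leftarrow>\<Lambda> (fst v). fst e (fst w') * H \<alpha> \<beta> (snd e @ J) w' q\<bar>) \<le> K"
      by (rule bsum) (use frame_smooth[OF fr] frame_words[OF fr] in blast)
    note badd[OF B2 B1 I2 I1]
    moreover have "H' \<alpha> \<beta> J w' q v = (\<Sum>e\<leftarrow>\<Lambda> (fst v). fst e (fst w') * H \<alpha> \<beta> (snd e @ J) w' q) +
        ((snd v * \<alpha>) * H (\<alpha> - 1) \<beta> J w' q + (- snd v / 2) * H (\<alpha> + 1) (\<beta> - 1) J w' q)" if "w' \<in> S" for w' q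
      unfolding H'_frame[OF fr J SN(1)[OF that]] by (simp add: algebra_simps)
    ultimately show ?thesis by simp
  qed
  then obtain K where K: "\<And>v. K v \<ge> 0" "\<And>v w'. w' \<in> S \<Longrightarrow> (LBINT q. \<bar>H' \<alpha> \<beta> J w' q v\<bar>) \<le> K v"
    by metis
  show ?thesis
  proof (rule lborel.L1_cont_if_bounded_derivative[where h' = "H' \<alpha> \<beta> J" and C = "\<Sum>b\<in>Basis. K b", OF S(1,2)])
    show "((\<lambda>w. H \<alpha> \<beta> J w q) has_derivative H' \<alpha> \<beta> J w' q) (at w')" if "w' \<in> S" for w' q
      by (rule H_has_derivative[OF J SN(2)[OF that]])
    show "continuous_on S (\<lambda>w. H' \<alpha> \<beta> J w q v)" for q v
      by (rule continuous_on_subset[OF H'_continuous[OF J]]) (use SN in \<open>auto simp: mem_Times_iff\<close>)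
    show "integrable lborel (H \<alpha> \<beta> J w')" if "w' \<in> S" for w'
      by (rule H_integrable[OF J \<beta> SN(2)[OF that]])
    show "integrable lborel (\<lambda>q. H' \<alpha> \<beta> J w' q v)" if "w' \<in> S" for w' v
      by (rule H'_integrable[OF J \<beta> SN(2)[OF that]])
    show "(LBINT q. \<bar>H' \<alpha> \<beta> J w' q b\<bar>) \<le> (\<Sum>b\<in>Basis. K b)" if "w' \<in> S" "b \<in> Basis" for w' b
      using K(2)[OF that(1), of b] member_le_sum[of b Basis K] that(2) K(1) by force
  qed (use K(1) in \<open>auto intro: sum_nonneg\<close>)
qed

text \<open>Differentiation under the integral needs L1 continuity of \<open>H'\<close>, thus bounds
  in mean for words up to the length needed for second derivatives. Words of every length are
  controlled, so nothing is lost at later stages.\<close>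

lemma F_has_derivative:
  assumes J: "set J \<subseteq> {1..m}" and \<beta>: "\<beta> < -1" and z: "snd w > 0"
  shows "(F \<alpha> \<beta> J has_derivative (\<lambda>v. LBINT q. H' \<alpha> \<beta> J w q v)) (at w)"
proof -
  obtain N \<Lambda> where fr: "frame N \<Lambda>" and N: "fst w \<in> N"
      using frame_exists by blast
  define S where "S = N \<times> {0::real<..}"
  have S: "open S" "w \<in> S" using N z frame_open[OF fr] by (auto simp: S_def open_Times mem_Times_iff)
  have SN: "fst w' \<in> N" "snd w' > 0" if "w' \<in> S" for w' using that by (auto simp: S_def)
  have L1: "L1_cont lborel (\<lambda>w q. H' \<alpha> \<beta> J w q v) w" for v
  proof (rule L1_cont_cong[OF S])
    show "(\<Sum>e\<leftarrow>\<Lambda> (fst v). fst e (fst w') * H \<alpha> \<beta> (snd e @ J) w' q) +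
      ((snd v * \<alpha>) * H (\<alpha> - 1) \<beta> J w' q + (- snd v / 2) * H (\<alpha> + 1) (\<beta> - 1) J w' q) = H' \<alpha> \<beta> J w' q v"
      if "w' \<in> S" for w' q
      unfolding H'_frame[OF fr J SN(1)[OF that]] by (simp add: algebra_simps)
    have "L1_cont lborel (\<lambda>w q. fst e (fst w) * H \<alpha> \<beta> (snd e @ J) w q) w" if e: "e \<in> set (\<Lambda> (fst v))" for e
    proof (rule L1_cont_mult)
      have e': "smooth_on N (fst e)" "set (snd e @ J) \<subseteq> {1..m}"
        using frame_smooth[OF fr e] frame_words[OF fr e] J by auto
      then show "L1_cont lborel (H \<alpha> \<beta> (snd e @ J)) w" by (intro H_L1_cont \<beta> z)
      have "isCont (fst e) (fst w)"
        using Ck_on_imp_continuous_on[OF smooth_on_imp_Ck_on[OF e'(1)]] N frame_open[OF fr] by (simp add: continuous_on_eq_continuous_at)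
      then show "isCont (\<lambda>w. fst e (fst w)) w"
        by (intro isCont_o2[OF isCont_fst[OF continuous_ident]])
    qed
    then show "L1_cont lborel (\<lambda>w q. (\<Sum>e\<leftarrow>\<Lambda> (fst v). fst e (fst w) * H \<alpha> \<beta> (snd e @ J) w q) +
      ((snd v * \<alpha>) * H (\<alpha> - 1) \<beta> J w q + (- snd v / 2) * H (\<alpha> + 1) (\<beta> - 1) J w q)) w"
      using \<beta> z J
      by (intro L1_cont_add L1_cont_sum_list L1_cont_mult[where c = "\<lambda>_. _"] H_L1_cont) auto
  qed
  have "((\<lambda>w. LBINT q. H \<alpha> \<beta> J w q) has_derivative (\<lambda>v. LBINT q. H' \<alpha> \<beta> J w q v)) (at w)"
  proof (rule lborel.has_derivative_integral[where S = S and h' = "H' \<alpha> \<beta> J", OF S])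
    show "((\<lambda>w. H \<alpha> \<beta> J w q) has_derivative H' \<alpha> \<beta> J w' q) (at w')" if "w' \<in> S" for w' q
      by (rule H_has_derivative[OF J SN(2)[OF that]])
    show "continuous_on S (\<lambda>w. H' \<alpha> \<beta> J w q v)" for q v
      by (rule continuous_on_subset[OF H'_continuous[OF J]]) (use SN in \<open>auto simp: mem_Times_iff\<close>)
    show "integrable lborel (H \<alpha> \<beta> J w')" if "w' \<in> S" for w'
      by (rule H_integrable[OF J \<beta> SN(2)[OF that]])
    show "integrable lborel (\<lambda>q. H' \<alpha> \<beta> J w' q v)" if "w' \<in> S" for w' v
      by (rule H'_integrable[OF J \<beta> SN(2)[OF that]])
  qed (rule L1)
  then show ?thesis by (simp add: F_def[abs_def])
qed

text \<open>The induction on \<open>k\<close> runs over all exponents and words at once, since each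
  derivative of a member of the family is a combination, with smooth local coefficients, of other
  members.\<close>

lemma F_Ck: "set J \<subseteq> {1..m} \<Longrightarrow> \<beta> < -1 \<Longrightarrow> Ck_on k (UNIV \<times> {0<..}) (F \<alpha> \<beta> J)"
proof (induction k arbitrary: \<alpha> \<beta> J)
  case 0
  have "isCont (F \<alpha> \<beta> J) w" if "snd w > 0" for w
    using has_derivative_continuous[OF F_has_derivative[OF 0 that]] .
  then show ?case by (auto intro!: continuous_at_imp_continuous_on)
next
  case (Suc k)
  show ?case
  proof (rule Ck_on_locally)
    fix w :: "(real^'n) \<times> real" assume "w \<in> UNIV \<times> {0<..}"
    then have z: "snd w > 0" by auto
    obtain N \<Lambda> where fr: "frame N \<Lambda>" and N: "fst w \<in> N"
      using frame_exists by blast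
    define S where "S = N \<times> {0::real<..}"
    have S: "open S" "w \<in> S" using N z frame_open[OF fr] by (auto simp: S_def open_Times mem_Times_iff)
    have SN: "fst w' \<in> N" "snd w' > 0" if "w' \<in> S" for w' using that by (auto simp: S_def)
    have IH: "Ck_on k S (F \<alpha> \<beta> J)" if "set J \<subseteq> {1..m}" "\<beta> < -1" for \<alpha> \<beta> J
      by (rule Ck_on_subset[OF Suc.IH[OF that]]) (auto simp: S_def)
    have "Ck_on (Suc k) S (F \<alpha> \<beta> J)"
    proof (rule Ck_on_SucI[OF S(1)])
      show "(F \<alpha> \<beta> J has_derivative (\<lambda>v. LBINT q. H' \<alpha> \<beta> J w' q v)) (at w')" if "w' \<in> S" for w'
        by (rule F_has_derivative[OF Suc.prems SN(2)[OF that]])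
      fix v :: "(real^'n) \<times> real"
      have LJ: "set (snd e @ J) \<subseteq> {1..m}" "smooth_on N (fst e)" if "e \<in> set (\<Lambda> (fst v))" for e
        using frame_smooth[OF fr that] frame_words[OF fr that] Suc.prems by auto
      have "Ck_on k S (\<lambda>w. fst e (fst w) * F \<alpha> \<beta> (snd e @ J) w)" if "e \<in> set (\<Lambda> (fst v))" for e
        using LJ[OF that] Suc.prems N Ck_on_fst[OF smooth_on_imp_Ck_on[OF LJ(2)[OF that]] frame_open[OF fr] open_greaterThan, of k 0]
        by (intro Ck_on_mult S IH) (auto simp: S_def)
      note sumk = Ck_on_sum_list[where L = "\<Lambda> (fst v)", OF S(1) this]
      have "Ck_on k S (\<lambda>w. (snd v * \<alpha>) * F (\<alpha> - 1) \<beta> J w + (- snd v / 2) * F (\<alpha> + 1) (\<beta> - 1) J w)"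
        using Suc.prems by (intro Ck_on_add Ck_on_mult Ck_on_const S IH) auto
      note Ck_on_add[OF S(1) sumk this]
      moreover have "(\<Sum>e\<leftarrow>\<Lambda> (fst v). fst e (fst w) * F \<alpha> \<beta> (snd e @ J) w) +
          ((snd v * \<alpha>) * F (\<alpha> - 1) \<beta> J w + (- snd v / 2) * F (\<alpha> + 1) (\<beta> - 1) J w) =
          (LBINT q. H' \<alpha> \<beta> J w q v)" if w: "w \<in> S" for w
      proof -
        have i: "integrable lborel (\<lambda>q. fst e (fst w) * H \<alpha> \<beta> (snd e @ J) w q)" if "e \<in> set (\<Lambda> (fst v))" for e
          by (intro integrable_mult_right H_integrable LJ[OF that] Suc.prems SN w)
        have i1: "integrable lborel (H (\<alpha> - 1) \<beta> J w)" "integrable lborel (H (\<alpha> + 1) (\<beta> - 1) J w)"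
          using Suc.prems SN[OF w] by (auto intro!: H_integrable)
        show ?thesis
          unfolding H'_frame[OF fr Suc.prems(1) SN(1)[OF w]]
          using i1 integrable_sum_list[OF i, of "\<Lambda> (fst v)"] by (simp add: F_def algebra_simps)
      qed
      ultimately show "Ck_on k S (\<lambda>w. LBINT q. H' \<alpha> \<beta> J w q v)"
        by (rule Ck_on_cong[OF S(1), rotated])
    qed
    then show "\<exists>T. open T \<and> w \<in> T \<and> Ck_on (Suc k) T (F \<alpha> \<beta> J)" using S by blast
  qed
qed

end

section \<open>The extension problem\<close>

text \<open>The product rule turns the divergence form into words: each field contributes its
  divergence times the one-letter word plus the two-letter word. In this form the sub-Laplacian can
  be passed through the integrals.\<close>

lemma sub_laplacian_expand:
  fixes X :: "nat \<Rightarrow> 'a::euclidean_space \<Rightarrow> 'a"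
  assumes "\<And>i. i \<in> {1..m} \<Longrightarrow> X i differentiable (at x)"
    and "\<And>i. i \<in> {1..m} \<Longrightarrow> vf_apply (X i) f differentiable (at x)"
  shows "sub_laplacian m X f x =
    (\<Sum>i=1..m. (\<Sum>b\<in>Basis. FD (X i) x b \<bullet> b) * vf_apply (X i) f x
      + vf_apply (X i) (vf_apply (X i) f) x)"
proof -
  have "(\<Sum>b\<in>Basis. partial b (\<lambda>y. (X i y \<bullet> b) * vf_apply (X i) f y) x) =
      (\<Sum>b\<in>Basis. FD (X i) x b \<bullet> b) * vf_apply (X i) f x + vf_apply (X i) (vf_apply (X i) f) x"
    if i: "i \<in> {1..m}" for i
  proof -
    let ?g = "vf_apply (X i) f"
    have "partial b (\<lambda>y. (X i y \<bullet> b) * ?g y) x =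
        (X i x \<bullet> b) * FD ?g x b + (FD (X i) x b \<bullet> b) * ?g x" for b
    proof -
      have "((\<lambda>y. (X i y \<bullet> b) * ?g y) has_derivative
        (\<lambda>v. (X i x \<bullet> b) * FD ?g x v + (FD (X i) x v \<bullet> b) * ?g x)) (at x)"
        by (intro has_derivative_mult has_derivative_inner_left has_derivative_frechet assms i)
      from frechet_derivative_at[OF this, symmetric] show ?thesis
        by (simp add: partial_def vf_apply_def)
    qed
    moreover have "vf_apply (X i) ?g x = (\<Sum>b\<in>Basis. (X i x \<bullet> b) * FD ?g x b)"
      unfolding vf_apply_def[of "X i" ?g]
      using frechet_derivative_eq_sum_Basis[OF assms(2)[OF i], of "X i x"] by simp
    ultimately show ?thesis by (simp add: sum.distrib sum_distrib_right)
  qed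
  then show ?thesis
    unfolding sub_laplacian_def formal_adjoint_def sum_negf minus_minus by (intro sum.cong refl) simp
qed

lemma time_weight_tendsto_at_top:
  assumes "\<beta> < 0"
  shows "(time_weight \<alpha> \<beta> z \<longlongrightarrow> 0) at_top"
proof (rule tendsto_sandwich[OF _ _ tendsto_const])
  show "((\<lambda>t. z powr \<alpha> * t powr \<beta>) \<longlongrightarrow> 0) at_top"
    by (intro tendsto_mult_right_zero tendsto_neg_powr assms filterlim_ident)
  show "\<forall>\<^sub>F t in at_top. time_weight \<alpha> \<beta> z t \<le> z powr \<alpha> * t powr \<beta>"
    using eventually_gt_at_top[of 0]
    by eventually_elim (auto simp: time_weight_def intro!: mult_left_le)
qed (simp add: time_weight_nonneg)

lemma powr_times_exp_tendsto_0:
  assumes "\<kappa> > 0"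
  shows "((\<lambda>s::real. s powr b * exp (- \<kappa> * s)) \<longlongrightarrow> 0) at_top"
proof -
  obtain n :: nat where n: "b \<le> real n" using real_arch_simple by blast
  have "filterlim (\<lambda>s. \<kappa> * s) at_top at_top"
    by (rule filterlim_tendsto_pos_mult_at_top[OF tendsto_const assms filterlim_ident])
  from filterlim_compose[OF tendsto_power_div_exp_0[of n] this]
  have "((\<lambda>s. (\<kappa> * s) ^ n / exp (\<kappa> * s)) \<longlongrightarrow> 0) at_top" .
  from tendsto_mult_right_zero[OF this, of "inverse (\<kappa> ^ n)"]
  have lim: "((\<lambda>s. s ^ n * exp (- \<kappa> * s)) \<longlongrightarrow> 0) at_top"
    using assms by (simp add: power_mult_distrib exp_minus divide_inverse mult.assoc[symmetric])
  show ?thesis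
  proof (rule tendsto_sandwich[OF _ _ tendsto_const lim])
    show "\<forall>\<^sub>F s in at_top. s powr b * exp (- \<kappa> * s) \<le> s ^ n * exp (- \<kappa> * s)"
      using eventually_ge_at_top[of 1]
    proof eventually_elim
      case (elim s)
      then show ?case using powr_mono[OF n, of s] by (simp add: powr_realpow)
    qed
  qed simp
qed

text \<open>In the variable 1/t the exponential factor outweighs every power, so no condition on
  \<open>\<beta>\<close> appears.\<close>

lemma time_weight_tendsto_at_0:
  assumes "z > 0"
  shows "(time_weight \<alpha> \<beta> z \<longlongrightarrow> 0) (at_right 0)"
proof -
  have "((\<lambda>t. inverse t powr (- \<beta>) * exp (- (z\<^sup>2 / 4) * inverse t)) \<longlongrightarrow> 0) (at_right 0)"
    by (rule filterlim_compose[OF powr_times_exp_tendsto_0 filterlim_inverse_at_top_right]) (use assms in simp)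
  from tendsto_mult_right_zero[OF this, of "z powr \<alpha>"] show ?thesis
  proof (rule Lim_transform_eventually)
    show "\<forall>\<^sub>F t in at_right 0. z powr \<alpha> * (inverse t powr (- \<beta>) * exp (- (z\<^sup>2 / 4) * inverse t)) = time_weight \<alpha> \<beta> z t"
      unfolding eventually_at_filter
    proof (intro always_eventually allI impI)
      fix t :: real assume "t \<in> {0<..}"
      then have t: "t > 0" by simp
      have "inverse t powr (- \<beta>) = t powr \<beta>"
        by (simp only: inverse_powr powr_minus inverse_inverse_eq)
      moreover have "- (z\<^sup>2 / 4) * inverse t = - z\<^sup>2 / (4 * t)" using t by (simp add: field_simps)
      ultimately show "z powr \<alpha> * (inverse t powr (- \<beta>) * exp (- (z\<^sup>2 / 4) * inverse t)) = time_weight \<alpha> \<beta> z t"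
        using t by (simp only: time_weight_def if_True mult.assoc)
    qed
  qed
qed

context heat_extension
begin

section \<open>Differential identities for the integrals \<open>F\<close>\<close>

lemma F_slice_x:
  assumes J: "set J \<subseteq> {1..m}" and \<beta>: "\<beta> < -1" and z: "z > 0"
  shows "(\<lambda>y. F \<alpha> \<beta> J (y, z)) differentiable (at x)"
    and "vf_apply (X i) (\<lambda>y. F \<alpha> \<beta> J (y, z)) x = F \<alpha> \<beta> (i # J) (x, z)"
proof -
  have D: "(F \<alpha> \<beta> J has_derivative (\<lambda>v. LBINT q. H' \<alpha> \<beta> J (x, z) q v)) (at (x, z))"
    using F_has_derivative[OF J \<beta>, of "(x, z)"] z by simp
  then have d: "F \<alpha> \<beta> J differentiable (at (x, z))" by (auto simp: differentiable_def)
  note S = frechet_derivative_slice_fst[OF d]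
  show "(\<lambda>y. F \<alpha> \<beta> J (y, z)) differentiable (at x)" using S by (auto simp: differentiable_def)
  have "vf_apply (X i) (\<lambda>y. F \<alpha> \<beta> J (y, z)) x = FD (F \<alpha> \<beta> J) (x, z) (X i x, 0)"
    unfolding vf_apply_def using frechet_derivative_at[OF S, symmetric] by simp
  also have "\<dots> = (LBINT q. H' \<alpha> \<beta> J (x, z) q (X i x, 0))"
    using frechet_derivative_at[OF D, symmetric] by simp
  also have "\<dots> = F \<alpha> \<beta> (i # J) (x, z)"
    by (simp add: H'_def F_def H_def XP_Cons)
  finally show "vf_apply (X i) (\<lambda>y. F \<alpha> \<beta> J (y, z)) x = F \<alpha> \<beta> (i # J) (x, z)" .
qed

lemma F_slice_z:
  assumes J: "set J \<subseteq> {1..m}" and \<beta>: "\<beta> < -1" and z: "z > 0"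
  shows "((\<lambda>z. F \<alpha> \<beta> J (x, z)) has_real_derivative \<alpha> * F (\<alpha> - 1) \<beta> J (x, z) - F (\<alpha> + 1) (\<beta> - 1) J (x, z) / 2) (at z)"
proof -
  have D: "(F \<alpha> \<beta> J has_derivative (\<lambda>v. LBINT q. H' \<alpha> \<beta> J (x, z) q v)) (at (x, z))"
    using F_has_derivative[OF J \<beta>, of "(x, z)"] z by simp
  then have d: "F \<alpha> \<beta> J differentiable (at (x, z))" by (auto simp: differentiable_def)
  have "FD (F \<alpha> \<beta> J) (x, z) (0, 1) = (LBINT q. H' \<alpha> \<beta> J (x, z) q (0, 1))"
    using frechet_derivative_at[OF D, symmetric] by simp
  also have "\<dots> = (LBINT q. \<alpha> * H (\<alpha> - 1) \<beta> J (x, z) q - H (\<alpha> + 1) (\<beta> - 1) J (x, z) q / 2)"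
  proof (rule Bochner_Integration.integral_cong[OF refl])
    fix q :: "(real^'n) \<times> real"
    show "H' \<alpha> \<beta> J (x, z) q (0, 1) = \<alpha> * H (\<alpha> - 1) \<beta> J (x, z) q - H (\<alpha> + 1) (\<beta> - 1) J (x, z) q / 2"
    proof (cases "snd q > 0")
      case True
      then show ?thesis
        using linear_0[OF linear_frechet_derivative[OF XP_differentiable[OF J True]]] by (simp add: H'_def)
    qed (simp add: H'_eq_0 H_eq_0)
  qed
  also have "\<dots> = \<alpha> * F (\<alpha> - 1) \<beta> J (x, z) - F (\<alpha> + 1) (\<beta> - 1) J (x, z) / 2"
  proof -
    have "integrable lborel (H (\<alpha> - 1) \<beta> J (x, z))" "integrable lborel (H (\<alpha> + 1) (\<beta> - 1) J (x, z))"
      using J \<beta> z by (auto intro!: H_integrable)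
    then show ?thesis by (simp add: F_def)
  qed
  finally show ?thesis using frechet_derivative_slice_snd[OF d] by simp
qed

lemma H_shift: "z > 0 \<Longrightarrow> H (\<alpha> + 1) \<beta> J (x, z) q = z * H \<alpha> \<beta> J (x, z) q"
  by (simp add: H_def time_weight_def powr_add)

lemma F_shift: "z > 0 \<Longrightarrow> F (\<alpha> + 1) \<beta> J (x, z) = z * F \<alpha> \<beta> J (x, z)"
  by (simp add: F_def H_shift)

lemma XP_sub_laplacian:
  assumes "t > 0"
  shows "sub_laplacian m X (\<lambda>x. p x y t) x =
    (\<Sum>i=1..m. (\<Sum>b\<in>Basis. FD (X i) x b \<bullet> b) * XP [i] x y t + XP [i, i] x y t)"
proof -
  have v1: "vf_apply (X i) (\<lambda>x. p x y t) = (\<lambda>x. XP [i] x y t)" for i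
    by (simp add: fun_eq_iff XP_Cons vf_apply_def)
  have v2: "vf_apply (X i) (\<lambda>x. XP [i] x y t) x = XP [i, i] x y t" for i
    by (simp add: XP_Cons[of i "[i]"] vf_apply_def)
  show ?thesis
    by (subst sub_laplacian_expand)
       (auto simp: v1 v2 intro!: smooth_on_differentiable[OF smooth_X] XP_differentiable assms)
qed

text \<open>The heat equation turns the generator applied to the kernel into a time derivative, and the time
  weight satisfies the matching equation in the extension variable; the total is an exact derivative.\<close>

lemma time_derivative_integral_eq_0:
  fixes \<alpha> \<beta> x z
  defines "\<Theta> \<equiv> \<lambda>q. (\<Sum>i=1..m. (\<Sum>b\<in>Basis. FD (X i) x b \<bullet> b) * H \<alpha> \<beta> [i] (x, z) q
      + H \<alpha> \<beta> [i, i] (x, z) q) + (\<beta> * H \<alpha> (\<beta> - 1) [] (x, z) q + z\<^sup>2 / 4 * H \<alpha> (\<beta> - 2) [] (x, z) q)"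
  assumes \<beta>: "\<beta> < -1" and z: "z > 0"
  shows "integrable lborel \<Theta>" "(LBINT q. \<Theta> q) = 0"
proof -
  show int: "integrable lborel \<Theta>"
    unfolding \<Theta>_def using \<beta> z
    by (intro Bochner_Integration.integrable_add Bochner_Integration.integrable_sum integrable_mult_right H_integrable) auto
  \<comment> \<open>The integral is taken in t first, for fixed y. Integrability of the slice is a
    premise because it is known for almost every y only.\<close>
  have inner: "(LBINT t. \<Theta> (y, t)) = 0" if i: "integrable lborel (\<lambda>t. \<Theta> (y, t))" for y
  proof -
    define \<Phi> where "\<Phi> t = time_weight \<alpha> \<beta> z t * p x y t * u y" for t
    have \<Theta>0: "\<Theta> (y, t) = 0" if "t \<le> 0" for t
      using that by (simp add: \<Theta>_def H_eq_0)
    \<comment> \<open>In \<open>\<Theta>\<close> the words are the weight times the sub-Laplacian of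
      the kernel, that is, times its time derivative; the remaining two terms are the time
      derivative of the weight times the kernel. By the product rule their sum is the derivative of
      \<open>\<Phi>\<close>.\<close>
    have der: "(\<Phi> has_vector_derivative \<Theta> (y, t)) (at t)" if t: "t > 0" for t
    proof -
      have "(\<Phi> has_real_derivative
         (time_weight \<alpha> \<beta> z t * sub_laplacian m X (\<lambda>x. p x y t) x +
          (\<beta> * time_weight \<alpha> (\<beta> - 1) z t + z\<^sup>2 / 4 * time_weight \<alpha> (\<beta> - 2) z t) * p x y t) * u y) (at t)"
        unfolding \<Phi>_def
        by (intro DERIV_cmult_right DERIV_mult' time_weight_DERIV_t heat_equation[OF smooth_X fundamental] t)
      moreover have "(time_weight \<alpha> \<beta> z t * sub_laplacian m X (\<lambda>x. p x y t) x +
          (\<beta> * time_weight \<alpha> (\<beta> - 1) z t + z\<^sup>2 / 4 * time_weight \<alpha> (\<beta> - 2) z t) * p x y t) * u y = \<Theta> (y, t)"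
        unfolding XP_sub_laplacian[OF t] \<Theta>_def H_def
        by (simp add: sum_distrib_left sum_distrib_right distrib_left distrib_right sum.distrib mult_ac)
      ultimately show ?thesis by (simp add: has_real_derivative_iff_has_vector_derivative)
    qed
    have cont: "isCont (\<lambda>t. \<Theta> (y, t)) t" if t: "t > 0" for t
    proof -
      have "isCont (\<lambda>t. H \<alpha>' \<beta>' J (x, z) (y, t)) t" if "set J \<subseteq> {1..m}" for \<alpha>' \<beta>' J
      proof -
        have "isCont (\<lambda>t. XP J x y t) t"
          using XP_continuous_t[OF that, of x y] t by (simp add: continuous_on_eq_continuous_at)
        then show ?thesis
          unfolding H_def using DERIV_isCont[OF time_weight_DERIV_t[OF t]] by (auto intro!: continuous_intros)
      qed
      then show ?thesis unfolding \<Theta>_def by (intro continuous_intros) auto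
    qed
    \<comment> \<open>For fixed y the unit mass is of no help, so the boundary values of
      \<open>\<Phi>\<close> are controlled by the pointwise bound: two time weights with negative
      exponents, which vanish both at 0 and at infinity.\<close>
    obtain C Q where C: "C > 0" "Q \<ge> 0" "\<And>t. t > 0 \<Longrightarrow> p x y t \<le> C * (1 + t powr (- Q))"
      by (rule p_pointwise_bound[of x]) blast
    have \<Phi>_le: "\<bar>\<Phi> t\<bar> \<le> C * B * (time_weight \<alpha> \<beta> z t + time_weight \<alpha> (\<beta> - Q) z t)" if t: "t > 0" for t
    proof -
      have "\<bar>\<Phi> t\<bar> = time_weight \<alpha> \<beta> z t * p x y t * \<bar>u y\<bar>"
        using p_pos[OF t, of x y] by (simp add: \<Phi>_def abs_mult time_weight_nonneg)
      also have "\<dots> \<le> time_weight \<alpha> \<beta> z t * (C * (1 + t powr (- Q))) * B"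
        using p_pos[OF t, of x y] C t u_bound[of y]
        by (intro mult_mono mult_left_mono) (auto simp: time_weight_nonneg)
      also have "\<dots> = C * B * (time_weight \<alpha> \<beta> z t + time_weight \<alpha> \<beta> z t * t powr (- Q))"
        by (simp add: algebra_simps)
      also have "time_weight \<alpha> \<beta> z t * t powr (- Q) = time_weight \<alpha> (\<beta> - Q) z t"
        using t by (simp add: time_weight_def powr_diff powr_minus_divide)
      finally show ?thesis .
    qed
    have lim: "(\<Phi> \<longlongrightarrow> 0) A" if "\<forall>\<^sub>F t in A. t > 0"
      "\<And>\<beta>. \<beta> < 0 \<Longrightarrow> (time_weight \<alpha> \<beta> z \<longlongrightarrow> 0) A" for A
    proof (rule Lim_null_comparison)
      show "\<forall>\<^sub>F t in A. norm (\<Phi> t) \<le> C * B * (time_weight \<alpha> \<beta> z t + time_weight \<alpha> (\<beta> - Q) z t)"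
        using that(1) by eventually_elim (use \<Phi>_le in simp)
      show "((\<lambda>t. C * B * (time_weight \<alpha> \<beta> z t + time_weight \<alpha> (\<beta> - Q) z t)) \<longlongrightarrow> 0) A"
        using \<beta> C(2) by (intro tendsto_mult_right_zero tendsto_add_zero that(2)) auto
    qed
    have "(LBINT t=ereal 0..\<infinity>. \<Theta> (y, t)) = 0 - 0"
    proof (rule interval_integral_FTC_integrable)
      show "set_integrable lborel (einterval (ereal 0) \<infinity>) (\<lambda>t. \<Theta> (y, t))"
        unfolding set_integrable_def using i
        by (intro integrable_mult_indicator[where 'b = real, unfolded real_scaleR_def, simplified real_scaleR_def[symmetric]]) auto
      show "((\<Phi> \<circ> real_of_ereal) \<longlongrightarrow> 0) (at_right (ereal 0))"
        unfolding ereal_tendsto_simps using time_weight_tendsto_at_0[OF z]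
        by (intro lim) (auto simp: eventually_at_filter)
      show "((\<Phi> \<circ> real_of_ereal) \<longlongrightarrow> 0) (at_left \<infinity>)"
        unfolding ereal_tendsto_simps by (intro lim time_weight_tendsto_at_top) (auto simp: eventually_gt_at_top)
    qed (use der cont in auto)
    then have "(LINT t:{0<..}|lborel. \<Theta> (y, t)) = 0"
      by (simp add: interval_integral_to_infinity_eq)
    moreover have "(LINT t:{0<..}|lborel. \<Theta> (y, t)) = (LBINT t. \<Theta> (y, t))"
      unfolding set_lebesgue_integral_def
      by (intro Bochner_Integration.integral_cong) (auto simp: indicator_def \<Theta>0)
    ultimately show ?thesis by simp
  qed
  have int2: "integrable (lborel \<Otimes>\<^sub>M lborel) \<Theta>" using int by (simp add: lborel_prod)
  \<comment> \<open>Integrability on the product allows iterated integration; exceptional y form a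
    null set.\<close>
  have "(LBINT q. \<Theta> q) = (LBINT y. LBINT t. \<Theta> (y, t))"
    using lborel_pair.integral_fst'[OF int2] by (simp add: lborel_prod)
  also have "\<dots> = (LINT y|(lborel :: (real^'n) measure). 0)"
  proof (rule integral_cong_AE)
    show "AE y in lborel. (LBINT t. \<Theta> (y, t)) = 0"
      using lborel_pair.AE_integrable_fst'[OF int2] by eventually_elim (rule inner)
    show "(\<lambda>y. LBINT t. \<Theta> (y, t)) \<in> borel_measurable lborel"
      using borel_measurable_integrable[OF lborel_pair.integrable_fst'[OF int2]] .
  qed simp
  finally show "(LBINT q. \<Theta> q) = 0" by simp
qed

text \<open>The vanishing integral in terms of \<open>F\<close>, at the exponents of the Poisson
  weight. The sum over \<open>i\<close> is the expanded sub-Laplacian, and the last bracket comes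
  from the t-derivative of the weight.\<close>

lemma F_equation:
  assumes z: "z > 0" and s: "0 < s"
  shows "(\<Sum>i=1..m. (\<Sum>b\<in>Basis. FD (X i) x b \<bullet> b) * F (2 * s) (- 1 - s) [i] (x, z)
      + F (2 * s) (- 1 - s) [i, i] (x, z))
    + ((- 1 - s) * F (2 * s) (- 1 - s - 1) [] (x, z) + z\<^sup>2 / 4 * F (2 * s) (- 1 - s - 2) [] (x, z)) = 0"
proof -
  let ?D = "\<lambda>i. \<Sum>b\<in>Basis. FD (X i) x b \<bullet> b"
  let ?H = "\<lambda>\<beta> J. H (2 * s) \<beta> J (x, z)"
  have i: "integrable lborel (?H \<beta> J)" if "set J \<subseteq> {1..m}" "\<beta> < -1" for \<beta> J
    using that z by (intro H_integrable) auto
  have i1: "integrable lborel (?H (- 1 - s) [i])" "integrable lborel (?H (- 1 - s) [i, i])" if "i \<in> {1..m}" for i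
    using that s by (auto intro!: i)
  have i2: "integrable lborel (?H (- 1 - s - 1) [])" "integrable lborel (?H (- 1 - s - 2) [])"
    using s by (auto intro!: i)
  have i3: "integrable lborel (\<lambda>q. ?D i * ?H (- 1 - s) [i] q + ?H (- 1 - s) [i, i] q)" if "i \<in> {1..m}" for i
    using i1[OF that] by (intro Bochner_Integration.integrable_add integrable_mult_right)
  have i4: "integrable lborel (\<lambda>q. (- 1 - s) * ?H (- 1 - s - 1) [] q + z\<^sup>2 / 4 * ?H (- 1 - s - 2) [] q)"
    using i2 by (intro Bochner_Integration.integrable_add integrable_mult_right)
  have e3: "(LBINT q. ?D i * ?H (- 1 - s) [i] q + ?H (- 1 - s) [i, i] q) =
      ?D i * F (2 * s) (- 1 - s) [i] (x, z) + F (2 * s) (- 1 - s) [i, i] (x, z)" if "i \<in> {1..m}" for i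
    using i1[OF that] by (simp add: F_def)
  have e4: "(LBINT q. (- 1 - s) * ?H (- 1 - s - 1) [] q + z\<^sup>2 / 4 * ?H (- 1 - s - 2) [] q) =
      (- 1 - s) * F (2 * s) (- 1 - s - 1) [] (x, z) + z\<^sup>2 / 4 * F (2 * s) (- 1 - s - 2) [] (x, z)"
    unfolding F_def using i2
    by (subst Bochner_Integration.integral_add) (auto simp del: diff_diff_eq diff_numeral_special)
  have "0 = (LBINT q. (\<Sum>i=1..m. ?D i * ?H (- 1 - s) [i] q + ?H (- 1 - s) [i, i] q)
      + ((- 1 - s) * ?H (- 1 - s - 1) [] q + z\<^sup>2 / 4 * ?H (- 1 - s - 2) [] q))"
    using time_derivative_integral_eq_0(2)[where \<alpha> = "2 * s" and \<beta> = "- 1 - s" and x = x and z = z] z s by simp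
  also have "\<dots> = (LBINT q. (\<Sum>i=1..m. ?D i * ?H (- 1 - s) [i] q + ?H (- 1 - s) [i, i] q))
      + (LBINT q. (- 1 - s) * ?H (- 1 - s - 1) [] q + z\<^sup>2 / 4 * ?H (- 1 - s - 2) [] q)"
    by (rule Bochner_Integration.integral_add[OF Bochner_Integration.integrable_sum[OF i3] i4])
  also have "(LBINT q. (\<Sum>i=1..m. ?D i * ?H (- 1 - s) [i] q + ?H (- 1 - s) [i, i] q)) =
      (\<Sum>i=1..m. LBINT q. ?D i * ?H (- 1 - s) [i] q + ?H (- 1 - s) [i, i] q)"
    by (rule Bochner_Integration.integral_sum[OF i3])
  also have "\<dots> = (\<Sum>i=1..m. ?D i * F (2 * s) (- 1 - s) [i] (x, z) + F (2 * s) (- 1 - s) [i, i] (x, z))"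
    by (rule sum.cong[OF refl e3])
  finally show ?thesis unfolding e4 by simp
qed

text \<open>The Bessel operator is computed from the two z-derivatives of \<open>F\<close>, with
  powers of z moved out by \<open>F_shift\<close>. It reproduces exactly the bracket in
  \<open>F_equation\<close>, so both parts of the operator cancel.\<close>

lemma extension_equation:
  assumes s: "0 < s" "s < 1" and a: "a = 1 - 2 * s"
    and U: "\<And>x z. z > 0 \<Longrightarrow> U x z = c * F (2 * s) (- 1 - s) [] (x, z)" and z: "z > 0"
  shows "extension_op m X a U x z = 0"
proof -
  define \<alpha> \<beta> where "\<alpha> = 2 * s" and "\<beta> = - 1 - s"
  have \<beta>: "\<beta> < -1" using s by (simp add: \<beta>_def)
  have U': "U x z = c * F \<alpha> \<beta> [] (x, z)" if "z > 0" for x z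
    using U[OF that] by (simp add: \<alpha>_def \<beta>_def)
  define G where "G z = \<alpha> * F (\<alpha> - 1) \<beta> [] (x, z) - F (\<alpha> + 1) (\<beta> - 1) [] (x, z) / 2" for z
  have D1: "(U x has_real_derivative c * G z) (at z)" if "z > 0" for z
  proof -
    have "((\<lambda>z. c * F \<alpha> \<beta> [] (x, z)) has_real_derivative c * G z) (at z)"
      unfolding G_def using \<beta> that by (intro DERIV_cmult F_slice_z) auto
    then show ?thesis
      by (rule has_field_derivative_transform_within_open[of _ _ _ "{0<..}"]) (use that U' in auto)
  qed
  define G' where "G' = \<alpha> * ((\<alpha> - 1) * F (\<alpha> - 1 - 1) \<beta> [] (x, z) - F (\<alpha> - 1 + 1) (\<beta> - 1) [] (x, z) / 2)
      - ((\<alpha> + 1) * F (\<alpha> + 1 - 1) (\<beta> - 1) [] (x, z) - F (\<alpha> + 1 + 1) (\<beta> - 1 - 1) [] (x, z) / 2) / 2"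
  have D2: "(deriv (U x) has_real_derivative c * G') (at z)"
  proof -
    have "((\<lambda>z. c * G z) has_real_derivative c * G') (at z)"
      unfolding G_def G'_def using \<beta> z
      by (intro DERIV_cmult DERIV_diff DERIV_cdivide F_slice_z) auto
    then show ?thesis
      by (rule has_field_derivative_transform_within_open[of _ _ _ "{0<..}"])
         (use z DERIV_imp_deriv[OF D1] in auto)
  qed
  have sh: "F (\<alpha> - 1) \<beta> [] (x, z) = z * F (\<alpha> - 2) \<beta> [] (x, z)"
    "F (\<alpha> + 1) (\<beta> - 1) [] (x, z) = z * F \<alpha> (\<beta> - 1) [] (x, z)"
    "F (\<alpha> + 1 + 1) (\<beta> - 2) [] (x, z) = z\<^sup>2 * F \<alpha> (\<beta> - 2) [] (x, z)"
    using F_shift[OF z, of "\<alpha> - 2" \<beta> "[]" x] F_shift[OF z, of \<alpha> "\<beta> - 1" "[]" x]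
      F_shift[OF z, of \<alpha> "\<beta> - 2" "[]" x] F_shift[OF z, of "\<alpha> + 1" "\<beta> - 2" "[]" x]
    by (simp_all add: power2_eq_square)
  have "bessel_op a (U x) z = c * G' + a / z * (c * G z)"
    unfolding bessel_op_def using DERIV_imp_deriv[OF D2] DERIV_imp_deriv[OF D1[OF z]] by simp
  also have "\<dots> = c * (\<beta> * F \<alpha> (\<beta> - 1) [] (x, z) + z\<^sup>2 / 4 * F \<alpha> (\<beta> - 2) [] (x, z))"
  proof -
    have "a / z * (c * G z) = c * (a * (\<alpha> * F (\<alpha> - 2) \<beta> [] (x, z) - F \<alpha> (\<beta> - 1) [] (x, z) / 2))"
      using z unfolding G_def sh by (simp add: field_simps)
    moreover have "G' = \<alpha> * ((\<alpha> - 1) * F (\<alpha> - 2) \<beta> [] (x, z) - F \<alpha> (\<beta> - 1) [] (x, z) / 2)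
      - ((\<alpha> + 1) * F \<alpha> (\<beta> - 1) [] (x, z) - z\<^sup>2 * F \<alpha> (\<beta> - 2) [] (x, z) / 2) / 2"
      unfolding G'_def using sh(3) by simp
    \<comment> \<open>The coefficient of \<open>A1\<close> is
      \<open>\<alpha> * (\<alpha> - 1 + a) = 0\<close>, that of \<open>A2\<close> is
      \<open>- (2 * \<alpha> + 1 + a) / 2 = - 1 - s = \<beta>\<close>: here the relation between
      \<open>a\<close> and \<open>s\<close> enters.\<close>
    moreover have "c * (\<alpha> * ((\<alpha> - 1) * A1 - A2 / 2) - ((\<alpha> + 1) * A2 - z\<^sup>2 * A3 / 2) / 2) + c * (a * (\<alpha> * A1 - A2 / 2)) =
        c * (\<beta> * A2 + z\<^sup>2 / 4 * A3)" for A1 A2 A3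
      by (simp add: a \<alpha>_def \<beta>_def field_simps)
    ultimately show ?thesis by (simp only:)
  qed
  finally have bessel: "bessel_op a (U x) z = c * (\<beta> * F \<alpha> (\<beta> - 1) [] (x, z) + z\<^sup>2 / 4 * F \<alpha> (\<beta> - 2) [] (x, z))" .
  have Ux: "(\<lambda>y. U y z) = (\<lambda>y. c * F \<alpha> \<beta> [] (y, z))" using U'[OF z] by auto
  have vc: "vf_apply (X i) (\<lambda>y. c * F \<alpha> \<beta> J (y, z)) = (\<lambda>y. c * F \<alpha> \<beta> (i # J) (y, z))" if J: "set J \<subseteq> {1..m}" for i J
  proof
    fix y
    have "((\<lambda>y. c * F \<alpha> \<beta> J (y, z)) has_derivative (\<lambda>v. c * FD (\<lambda>y. F \<alpha> \<beta> J (y, z)) y v)) (at y)"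
      by (intro has_derivative_mult_right has_derivative_frechet F_slice_x J \<beta> z)
    from frechet_derivative_at[OF this, symmetric]
    show "vf_apply (X i) (\<lambda>y. c * F \<alpha> \<beta> J (y, z)) y = c * F \<alpha> \<beta> (i # J) (y, z)"
      using F_slice_x(2)[OF J \<beta> z, of i \<alpha> y] by (simp add: vf_apply_def)
  qed
  have "sub_laplacian m X (\<lambda>y. U y z) x =
    (\<Sum>i=1..m. (\<Sum>b\<in>Basis. FD (X i) x b \<bullet> b) * (c * F \<alpha> \<beta> [i] (x, z)) + c * F \<alpha> \<beta> [i, i] (x, z))"
    unfolding Ux
  proof (subst sub_laplacian_expand)
    show "vf_apply (X i) (\<lambda>y. c * F \<alpha> \<beta> [] (y, z)) differentiable (at x)" if "i \<in> {1..m}" for i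
      using that F_slice_x(1)[of "[i]" \<beta> z \<alpha> x] \<beta> z by (simp add: vc differentiable_mult)
    show "X i differentiable (at x)" if "i \<in> {1..m}" for i
      by (rule smooth_on_differentiable[OF smooth_X[OF that] UNIV_I])
  qed (intro sum.cong refl, simp add: vc)
  also have "\<dots> = c * (\<Sum>i=1..m. (\<Sum>b\<in>Basis. FD (X i) x b \<bullet> b) * F \<alpha> \<beta> [i] (x, z) + F \<alpha> \<beta> [i, i] (x, z))"
    by (simp add: sum_distrib_left distrib_left mult_ac)
  finally have "sub_laplacian m X (\<lambda>y. U y z) x + bessel_op a (U x) z = c * 0"
    using F_equation[OF z s(1), of x] unfolding bessel \<alpha>_def[symmetric] \<beta>_def[symmetric]
    by (simp only: distrib_left[symmetric])
  then show ?thesis by (simp add: extension_op_def)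
qed

section \<open>The Poisson integral and its boundary values\<close>

lemma poisson_integrand_eq:
  assumes a: "a = 1 - 2 * s" and z: "z > 0"
  shows "indicator {0<..} t *\<^sub>R poisson_integrand p a z x y t = time_weight 0 (- 1 - s) z t * (indicator {0<..} t * p x y t)"
proof (cases "t > 0")
  case True
  have e: "(3 - a) / 2 = 1 + s" by (simp add: a)
  have "- 1 - s = - (1 + s)" by simp
  then have pw: "t powr (- 1 - s) = inverse (t powr (1 + s))" by (simp only: powr_minus)
  have "indicator {0<..} t = (1::real)" "z powr 0 = 1" using True z by auto
  then show ?thesis
    unfolding poisson_integrand_def e time_weight_def pw
    by (simp only: True if_True scaleR_one divide_inverse mult_1_left mult_ac)
qed (simp add: time_weight_def)

lemma poisson_integrand_integrable:
  assumes s: "0 < s" and a: "a = 1 - 2 * s" and z: "z > 0"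
  shows "set_integrable lborel {0<..} (poisson_integrand p a z x y)"
proof -
  obtain C Q where C: "C > 0" "Q \<ge> 0" "\<And>t. t > 0 \<Longrightarrow> p x y t \<le> C * (1 + t powr (- Q))"
    by (rule p_pointwise_bound[of x]) blast
  have eq: "(\<lambda>t. indicator {0<..} t *\<^sub>R poisson_integrand p a z x y t) =
      (\<lambda>t. time_weight 0 (- 1 - s) z t * (indicator {0<..} t * p x y t))"
    using poisson_integrand_eq[OF a z] by blast
  have "(\<lambda>t. indicator {0<..} t *\<^sub>R p x y t) \<in> borel_measurable borel"
    using XP_continuous_t[of "[]" x y] by (intro borel_measurable_continuous_on_indicator) auto
  then have m: "(\<lambda>t. indicator {0<..} t * p x y t) \<in> borel_measurable borel" by simp
  show ?thesis
    unfolding set_integrable_def eq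
  proof (rule Bochner_Integration.integrable_bound)
    show "integrable lborel (\<lambda>t. C * (time_weight 0 (- 1 - s) z t + time_weight 0 (- 1 - s - Q) z t))"
      using s z C by (intro integrable_mult_right Bochner_Integration.integrable_add time_weight_integrable) auto
    show "(\<lambda>t. time_weight 0 (- 1 - s) z t * (indicator {0<..} t * p x y t)) \<in> borel_measurable lborel"
      using m by simp
    show "AE t in lborel. norm (time_weight 0 (- 1 - s) z t * (indicator {0<..} t * p x y t)) \<le>
        norm (C * (time_weight 0 (- 1 - s) z t + time_weight 0 (- 1 - s - Q) z t))"
    proof (rule AE_I2)
      fix t :: real
      show "norm (time_weight 0 (- 1 - s) z t * (indicator {0<..} t * p x y t)) \<le>
        norm (C * (time_weight 0 (- 1 - s) z t + time_weight 0 (- 1 - s - Q) z t))"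
      proof (cases "t > 0")
        case True
        have "time_weight 0 (- 1 - s) z t * p x y t \<le> time_weight 0 (- 1 - s) z t * (C * (1 + t powr (- Q)))"
          by (intro mult_left_mono C(3) True time_weight_nonneg)
        also have "\<dots> = C * (time_weight 0 (- 1 - s) z t + time_weight 0 (- 1 - s) z t * t powr (- Q))"
          by (simp add: algebra_simps)
        also have "time_weight 0 (- 1 - s) z t * t powr (- Q) = time_weight 0 (- 1 - s - Q) z t"
          using True by (simp add: time_weight_def powr_diff powr_minus_divide)
        finally show ?thesis
          using True p_pos[OF True, of x y] C(1) by (simp add: abs_mult time_weight_nonneg)
      qed (simp add: time_weight_def)
    qed
  qed
qed

text \<open>Up to the constant, the Poisson kernel times \<open>u y\<close> is the time integral of
  \<open>H\<close> at fixed y. Since \<open>H\<close> is integrable on the product, Fubini's theorem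
  gives integrability in y and the value; the normalization is
  \<open>2 powr (1 - a) * Gamma ((1 - a) / 2) = 4 powr s * Gamma s\<close>.\<close>

lemma poisson_extension:
  assumes s: "0 < s" and a: "a = 1 - 2 * s" and z: "z > 0"
  shows "integrable lborel (\<lambda>y. poisson_kernel p a z x y * u y)"
    and "(LBINT y. poisson_kernel p a z x y * u y) = 1 / (4 powr s * Gamma s) * F (2 * s) (- 1 - s) [] (x, z)"
proof -
  have K: "poisson_kernel p a z x y * u y =
      1 / (4 powr s * Gamma s) * (LBINT t. H (2 * s) (- 1 - s) [] (x, z) (y, t))" for y
  proof -
    have "(LBINT t. H (2 * s) (- 1 - s) [] (x, z) (y, t)) =
        (LBINT t. z powr (1 - a) * u y * (indicator {0<..} t *\<^sub>R poisson_integrand p a z x y t))"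
    proof (rule Bochner_Integration.integral_cong[OF refl])
      fix t :: real
      have "1 - a = 2 * s" by (simp add: a)
      then show "H (2 * s) (- 1 - s) [] (x, z) (y, t) =
          z powr (1 - a) * u y * (indicator {0<..} t *\<^sub>R poisson_integrand p a z x y t)"
        unfolding poisson_integrand_eq[OF a z] using z by (simp add: H_def time_weight_def)
    qed
    also have "\<dots> = z powr (1 - a) * u y * (LINT t:{0<..}|lborel. poisson_integrand p a z x y t)"
      by (simp add: set_lebesgue_integral_def)
    finally have "(LBINT t. H (2 * s) (- 1 - s) [] (x, z) (y, t)) =
        z powr (1 - a) * u y * (LINT t:{0<..}|lborel. poisson_integrand p a z x y t)" .
    moreover have "2 powr (1 - a) = 4 powr s" "(1 - a) / 2 = s"
      using powr_powr[of 2 2 s] by (auto simp: a powr_numeral)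
    ultimately show ?thesis by (simp add: poisson_kernel_def mult_ac)
  qed
  have int: "integrable (lborel \<Otimes>\<^sub>M lborel) (H (2 * s) (- 1 - s) [] (x, z))"
    using H_integrable[of "[]" "- 1 - s" "(x, z)"] s z by (simp add: lborel_prod)
  show "integrable lborel (\<lambda>y. poisson_kernel p a z x y * u y)"
    unfolding K using lborel_pair.integrable_fst'[OF int] by simp
  show "(LBINT y. poisson_kernel p a z x y * u y) = 1 / (4 powr s * Gamma s) * F (2 * s) (- 1 - s) [] (x, z)"
    unfolding K F_def using lborel_pair.integral_fst'[OF int] by (simp add: lborel_prod)
qed

text \<open>The factor \<open>z powr (2 * s)\<close> compensates the scaling of the time integral,
  so the mass does not depend on z and the normalized weights are probability densities in
  t.\<close>

lemma time_weight_mass: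
  assumes "0 < s" "z > 0"
  shows "(LBINT t. time_weight (2 * s) (- 1 - s) z t) = 4 powr s * Gamma s"
proof -
  have "z powr (2 * s) * (z\<^sup>2 / 4) powr (- s) = 4 powr s"
  proof -
    have "z powr (2 * s) = (z\<^sup>2) powr s"
      using assms powr_powr[of z 2 s] by (simp add: powr_numeral)
    moreover have "(z\<^sup>2 / 4) powr (- s) = 4 powr s / (z\<^sup>2) powr s"
      using assms by (simp add: powr_divide powr_minus_divide)
    moreover have "(z\<^sup>2) powr s \<noteq> 0" using assms by simp
    ultimately show ?thesis by simp
  qed
  then show ?thesis
    using time_weight_integrable(2)[of "- 1 - s" z "2 * s"] assms by simp
qed

text \<open>The extension is the mean of the heat semigroup \<open>P x t\<close> over t with respect
  to the normalized weight. For t < b the semigroup is close to \<open>u x0\<close>; the part t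
  \<ge> b contributes at most a constant times \<open>z powr (2 * s)\<close>.\<close>

lemma extension_tendsto:
  assumes s: "0 < s"
  shows "((\<lambda>w. 1 / (4 powr s * Gamma s) * F (2 * s) (- 1 - s) [] w) \<longlongrightarrow> u x0) (at (x0, 0) within UNIV \<times> {0<..})"
proof (rule tendstoI)
  fix \<epsilon> :: real assume \<epsilon>: "\<epsilon> > 0"
  define P where "P x t = (LBINT y. p x y t * u y)" for x t
  define c where "c = 4 powr s * Gamma s"
  have c: "c > 0" using s by (simp add: c_def Gamma_real_pos)
  let ?T = "time_weight (2 * s) (- 1 - s)"
  obtain b where b: "b > 0" "\<And>x t. dist x x0 < b \<Longrightarrow> 0 < t \<Longrightarrow> t < b \<Longrightarrow> \<bar>P x t - u x0\<bar> < \<epsilon> / 2"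
  proof -
    have "\<forall>\<^sub>F w in at (x0, 0) within UNIV \<times> {0<..}. dist (case w of (x, t) \<Rightarrow> P x t) (u x0) < \<epsilon> / 2"
      unfolding P_def using heat_semigroup_tendsto[OF u_cont u_bound, of x0] \<epsilon> by (intro tendstoD) auto
    then obtain d where d: "d > 0" "\<And>w. w \<in> UNIV \<times> {0<..} \<Longrightarrow> w \<noteq> (x0, 0) \<Longrightarrow> dist w (x0, 0) < d \<Longrightarrow>
        dist (case w of (x, t) \<Rightarrow> P x t) (u x0) < \<epsilon> / 2"
      unfolding eventually_at by blast
    have "\<bar>P x t - u x0\<bar> < \<epsilon> / 2" if "dist x x0 < d / 2" "0 < t" "t < d / 2" for x t
    proof -
      have "dist (x, t) (x0, 0) \<le> dist x x0 + \<bar>t\<bar>"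
        by (simp add: dist_Pair_Pair dist_real_def) (metis abs_of_nonneg real_sqrt_abs2 sqrt_sum_squares_le_sum_abs zero_le_dist)
      then show ?thesis using d(2)[of "(x, t)"] that by (simp add: dist_real_def)
    qed
    then show thesis using that[of "d / 2"] d(1) by simp
  qed
  \<comment> \<open>For t \<ge> b the weight is compared with its value at z = 1, an integrable
    function: exp(-z^2/4t) \<le> 1 \<le> exp(1/(4b) - 1/(4t)). The factor exp(1/(4b)) is the price
    of inserting the exponential.\<close>
  define E where "E = exp (1 / (4 * b)) * (LBINT t. time_weight 0 (- 1 - s) 1 t)"
  have E0: "E \<ge> 0" unfolding E_def by (intro mult_nonneg_nonneg Bochner_Integration.integral_nonneg time_weight_nonneg) auto
  have main: "\<bar>1 / c * F (2 * s) (- 1 - s) [] (x, z) - u x0\<bar> \<le> \<epsilon> / 2 + 2 * B * E / c * z powr (2 * s)"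
    if x: "dist x x0 < b" and z: "z > 0" for x z
  proof -
    have int: "integrable (lborel \<Otimes>\<^sub>M lborel) (H (2 * s) (- 1 - s) [] (x, z))"
      using H_integrable[of "[]" "- 1 - s" "(x, z)"] s z by (simp add: lborel_prod)
    have inner: "(LBINT y. H (2 * s) (- 1 - s) [] (x, z) (y, t)) = ?T z t * P x t" for t
      by (simp add: H_def P_def mult.assoc)
    have iP: "integrable lborel (\<lambda>t. ?T z t * P x t)"
      using lborel_pair.integrable_snd[of "\<lambda>y t. H (2 * s) (- 1 - s) [] (x, z) (y, t)"] int inner by simp
    have FP: "F (2 * s) (- 1 - s) [] (x, z) = (LBINT t. ?T z t * P x t)"
      using lborel_pair.integral_snd[of "\<lambda>y t. H (2 * s) (- 1 - s) [] (x, z) (y, t)"] int inner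
      by (simp add: F_def lborel_prod)
    have iT: "integrable lborel (?T z)" "integrable lborel (time_weight 0 (- 1 - s) 1)"
      using s z by (auto intro!: time_weight_integrable)
    have massT: "(LBINT t. ?T z t) = c" using time_weight_mass[OF s z] by (simp add: c_def)
    have Pb: "\<bar>P x t\<bar> \<le> B" if t: "t > 0" for t
    proof -
      have i: "integrable lborel (\<lambda>y. p x y t * B)" using p_integrable[OF t, of x] by simp
      have "\<bar>P x t\<bar> \<le> (LBINT y. \<bar>p x y t * u y\<bar>)"
        unfolding P_def using integral_norm_bound[of lborel "\<lambda>y. p x y t * u y"] by simp
      also have "\<dots> \<le> (LBINT y. p x y t * B)"
      proof (rule integral_mono)
        show le: "\<bar>p x y t * u y\<bar> \<le> p x y t * B" for y
          using p_pos[OF t, of x y] u_bound[of y] by (simp add: abs_mult)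
        show "integrable lborel (\<lambda>y. \<bar>p x y t * u y\<bar>)"
          by (rule Bochner_Integration.integrable_bound[OF i])
             (use borel_measurable_integrable[OF p_integrable[OF t, of x]] order_trans[OF le abs_ge_self] in auto)
      qed (rule i)
      finally show ?thesis using mass[OF t, of x] by simp
    qed
    have "(LBINT t. ?T z t * P x t - u x0 * ?T z t) = F (2 * s) (- 1 - s) [] (x, z) - u x0 * c"
      unfolding FP massT[symmetric] using iP iT by simp
    then have *: "1 / c * F (2 * s) (- 1 - s) [] (x, z) - u x0 = 1 / c * (LBINT t. ?T z t * P x t - u x0 * ?T z t)"
      using c by (simp add: diff_divide_distrib)
    have "\<bar>1 / c * F (2 * s) (- 1 - s) [] (x, z) - u x0\<bar> \<le> 1 / c * (LBINT t. \<bar>?T z t * P x t - u x0 * ?T z t\<bar>)"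
      unfolding * using c integral_norm_bound[of lborel "\<lambda>t. ?T z t * P x t - u x0 * ?T z t"]
      by (simp add: abs_mult divide_right_mono)
    also have "(LBINT t. \<bar>?T z t * P x t - u x0 * ?T z t\<bar>) \<le>
        (LBINT t. \<epsilon> / 2 * ?T z t + 2 * B * (z powr (2 * s) * exp (1 / (4 * b))) * time_weight 0 (- 1 - s) 1 t)"
    proof (rule integral_mono)
      fix t
      show "\<bar>?T z t * P x t - u x0 * ?T z t\<bar> \<le>
        \<epsilon> / 2 * ?T z t + 2 * B * (z powr (2 * s) * exp (1 / (4 * b))) * time_weight 0 (- 1 - s) 1 t"
      proof (cases "t > 0")
        case True
        have eq: "\<bar>?T z t * P x t - u x0 * ?T z t\<bar> = ?T z t * \<bar>P x t - u x0\<bar>"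
        proof -
          have "?T z t * P x t - u x0 * ?T z t = ?T z t * (P x t - u x0)" by (simp add: algebra_simps)
          then show ?thesis by (simp add: abs_mult time_weight_nonneg)
        qed
        show ?thesis
        proof (cases "t < b")
          case tb: True
          have "?T z t * \<bar>P x t - u x0\<bar> \<le> ?T z t * (\<epsilon> / 2)"
            using b(2)[OF x True tb] by (intro mult_left_mono) (auto simp: time_weight_nonneg)
          then show ?thesis using B_nonneg unfolding eq
            by (simp add: mult.commute add_increasing2 time_weight_nonneg)
        next
          case False
          have "exp (- z\<^sup>2 / (4 * t)) \<le> 1" using True by simp
          also have "1 \<le> exp (1 / (4 * b) - 1 / (4 * t))"
            using False True b(1) by (simp add: frac_le)
          also have "\<dots> = exp (1 / (4 * b)) * exp (- 1 / (4 * t))" by (simp flip: exp_add)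
          finally have "?T z t \<le> z powr (2 * s) * exp (1 / (4 * b)) * time_weight 0 (- 1 - s) 1 t"
            using True by (simp add: time_weight_def mult_left_mono mult.assoc mult.left_commute[of "exp _"])
          moreover have "\<bar>P x t - u x0\<bar> \<le> 2 * B" using Pb[OF True] u_bound[of x0] by linarith
          ultimately have "?T z t * \<bar>P x t - u x0\<bar> \<le> z powr (2 * s) * exp (1 / (4 * b)) * time_weight 0 (- 1 - s) 1 t * (2 * B)"
            by (intro mult_mono) (auto simp: time_weight_nonneg)
          then show ?thesis using \<epsilon> unfolding eq
            by (simp add: mult_ac add_increasing time_weight_nonneg)
        qed
      qed (simp add: time_weight_def)
    qed (use iP iT in auto)
    also have "\<dots> = \<epsilon> / 2 * c + 2 * B * z powr (2 * s) * E"
      using iT by (simp add: massT E_def)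
    finally show ?thesis using c by (simp add: divide_right_mono mult_left_mono field_simps)
  qed
  have "((\<lambda>z. 2 * B * E / c * z powr (2 * s)) \<longlongrightarrow> 0) (at_right 0)"
  proof (rule tendsto_mult_right_zero)
    show "((\<lambda>z. z powr (2 * s)) \<longlongrightarrow> 0) (at_right (0::real))"
      using s by (intro tendsto_zero_powrI[where b = "2 * s"]) (auto simp: eventually_at_filter)
  qed
  then have "\<forall>\<^sub>F z in at_right 0. 2 * B * E / c * z powr (2 * s) < \<epsilon> / 2"
    using \<epsilon> by (intro order_tendstoD) auto
  then obtain d where d: "d > 0" "\<And>z. 0 < z \<Longrightarrow> z < d \<Longrightarrow> 2 * B * E / c * z powr (2 * s) < \<epsilon> / 2"
    unfolding eventually_at_right_field by auto
  show "\<forall>\<^sub>F w in at (x0, 0) within UNIV \<times> {0<..}. dist (1 / (4 powr s * Gamma s) * F (2 * s) (- 1 - s) [] w) (u x0) < \<epsilon>"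
    unfolding eventually_at
  proof (intro exI[of _ "min b d"] conjI ballI impI)
    show "min b d > 0" using b(1) d(1) by simp
    fix w :: "(real^'n) \<times> real"
    assume w: "w \<in> UNIV \<times> {0<..}" "w \<noteq> (x0, 0) \<and> dist w (x0, 0) < min b d"
    obtain x z where wz: "w = (x, z)" by (cases w)
    have "dist x x0 < b" "\<bar>z\<bar> < d"
      using w(2) dist_fst_le[of w "(x0, 0)"] dist_snd_le[of w "(x0, 0)"] by (auto simp: wz dist_real_def)
    moreover have "z > 0" using w(1) wz by simp
    ultimately show "dist (1 / (4 powr s * Gamma s) * F (2 * s) (- 1 - s) [] w) (u x0) < \<epsilon>"
      using main[of x z] d(2)[of z] by (simp add: wz dist_real_def c_def)
  qed
qed

end

theorem proposition10p7:
  fixes m :: nat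
    and X :: "nat \<Rightarrow> real ^ 'n \<Rightarrow> real ^ 'n"
    and p :: "real ^ 'n \<Rightarrow> real ^ 'n \<Rightarrow> real \<Rightarrow> real"
    and s a :: real
    and u :: "real ^ 'n \<Rightarrow> real"
    and U :: "real ^ 'n \<Rightarrow> real \<Rightarrow> real"
  assumes "CARD('n) \<ge> 3"
    and "\<And>i. i \<in> {1..m} \<Longrightarrow> smooth_on UNIV (X i)"
    and "hormander m X"
    and "laplacian_outside_compact m X"
    and "heat_fundamental_solution m X p"
    and "gaussian_bounds m X p"
    and "\<And>x t. t > 0 \<Longrightarrow> (LINT y|lborel. p x y t) = 1"
    and "doubling m X"
    and "0 < s" and "s < 1" and "a = 1 - 2 * s"
    and "schwartz u"
    and "\<And>x z. z > 0 \<Longrightarrow> U x z = (LINT y|lborel. poisson_kernel p a z x y * u y)"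
  shows "(\<forall>x z. z > 0 \<longrightarrow>
            (\<forall>y. set_integrable lborel {0<..} (poisson_integrand p a z x y)) \<and>
            integrable lborel (\<lambda>y. poisson_kernel p a z x y * u y)) \<and>
         Ck_on 2 (UNIV \<times> {0<..}) (\<lambda>(x, z). U x z) \<and>
         (\<forall>x z. z > 0 \<longrightarrow> extension_op m X a U x z = 0) \<and>
         (\<forall>x\<^sub>0. ((\<lambda>(x, z). U x z) \<longlongrightarrow> u x\<^sub>0) (at (x\<^sub>0, 0) within UNIV \<times> {0<..}))"
proof -
  have "smooth_on UNIV u" using \<open>schwartz u\<close> by (simp add: schwartz_def)
  then have cont: "continuous_on UNIV u"
    by (intro Ck_on_imp_continuous_on smooth_on_imp_Ck_on)
  have "\<forall>k bs. set bs \<subseteq> Basis \<longrightarrow> (\<exists>C. \<forall>x. (1 + norm x) ^ k * \<bar>foldr partial bs u x\<bar> \<le> C)"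
    using \<open>schwartz u\<close> by (simp add: schwartz_def)
  \<comment> \<open>The Schwartz seminorm without derivatives and without weight is the supremum
    bound for \<open>u\<close>.\<close>
  from this[rule_format, of "[]" 0] obtain B where B: "\<And>x. \<bar>u x\<bar> \<le> B" by auto
  interpret heat_extension m X p u B
    by unfold_locales (fact assms cont B)+
  define c where "c = 1 / (4 powr s * Gamma s)"
  have U: "U x z = c * F (2 * s) (- 1 - s) [] (x, z)" if "z > 0" for x z
    using poisson_extension(2)[OF \<open>0 < s\<close> \<open>a = 1 - 2 * s\<close> that, of x] assms(13)[OF that, of x]
    by (simp add: c_def)
  have o: "open (UNIV \<times> {0<..} :: ((real^'n) \<times> real) set)" by (simp add: open_Times)
  have "Ck_on 2 (UNIV \<times> {0<..}) (\<lambda>w. c * F (2 * s) (- 1 - s) [] w)"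
    using \<open>0 < s\<close> by (intro Ck_on_mult Ck_on_const o F_Ck) auto
  then have C2: "Ck_on 2 (UNIV \<times> {0<..}) (\<lambda>(x, z). U x z)"
    by (rule Ck_on_cong[OF o, rotated]) (auto simp: U)
  have lim: "((\<lambda>(x, z). U x z) \<longlongrightarrow> u x0) (at (x0, 0) within UNIV \<times> {0<..})" for x0
  proof (rule Lim_transform_eventually[OF extension_tendsto[OF \<open>0 < s\<close>]])
    show "\<forall>\<^sub>F w in at (x0, 0) within UNIV \<times> {0<..}.
        1 / (4 powr s * Gamma s) * F (2 * s) (- 1 - s) [] w = (case w of (x, z) \<Rightarrow> U x z)"
      by (auto simp: eventually_at_filter U c_def intro!: always_eventually)
  qed
  show ?thesis
    using poisson_integrand_integrable[OF \<open>0 < s\<close> \<open>a = 1 - 2 * s\<close>]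
      poisson_extension(1)[OF \<open>0 < s\<close> \<open>a = 1 - 2 * s\<close>] C2
      extension_equation[OF \<open>0 < s\<close> \<open>s < 1\<close> \<open>a = 1 - 2 * s\<close> U] lim
    by blast
qed

end
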